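(* Let $S\subset\mathbb{R}^3$ be an oriented connected surface with nonzero Gauss curvature. Then $S$ is an HQSF-surface of rotation if, and only if, there exist real constants $c\neq 0$, $c_1$, $c_2$ and $z_1\in\mathbb{C}\setminus\{0\}$ such that, with $\Omega=(cc_1-c_2)^2+4c|z_1|^2$, $S$ can be locally parametrized by $$X_i(u_1,u_2)=(A_i(u_1)\cos u_2,\;A_i(u_1)\sin u_2,\;B_i(u_1)),$$ where $i=1$ if $\Omega>0$, $i=2$ if $\Omega<0$, $i=3$ if $\Omega=0$, $$A_i(u_1)=\frac{(1-e^{2u_1})h_i'(u_1)+2e^{2u_1}h_i(u_1)}{e^{u_1}(1+e^{2u_1})},\qquad B_i(u_1)=-\frac{2(h_i'(u_1)-h_i(u_1))}{1+e^{2u_1}},$$ and, for some real constants $a_1,a_2$ (when $i=1$ or $i=3$) or $b_1,b_2$ (when $i=2$), $$h_1(u_1)=\frac{e^{\frac{2(cc_1+c_2-\sqrt{\Omega})u_1}{c}}\left(a_1^2\left(\Omega+(cc_1-c_2)\sqrt{\Omega}\right)+a_2^2e^{\frac{2\sqrt{\Omega}u_1}{c}}\left(\Omega-(cc_1-c_2)\sqrt{\Omega}\right)\right)^2}{4c^2(e^{2u_1}+1)|z_1|^4},$$ $$h_2(u_1)=\frac{-\Omega\, e^{2\left(\frac{c_2}{c}+c_1\right)u_1}}{16c^2(e^{2u_1}+1)|z_1|^4}\left(\left((b_1^2-b_2^2)(cc_1-c_2)+2b_1b_2\sqrt{-\Omega}\right)\sin\left(\frac{\sqrt{-\Omega}\,u_1}{c}\right)+\left((b_1^2-b_2^2)\sqrt{-\Omega}-2b_1b_2(cc_1-c_2)\right)\cos\left(\frac{\sqrt{-\Omega}\,u_1}{c}\right)\right)^2,$$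 $$h_3(u_1)=\frac{e^{2\left(\frac{c_2}{c}+c_1\right)u_1}\left(a_2\left((a_1+a_2u_1)(c_2-cc_1)+a_2c\right)\right)^2}{(e^{2u_1}+1)|z_1|^4}.$$
   Context: For a surface $S\subset\mathbb{R}^3$ oriented by its unit normal Gauss map $N$, the support function is $\Psi(p)=\langle p,N(p)\rangle$ and the quadratic distance function is $\Lambda(p)=\langle p,p\rangle$, with the Euclidean scalar product of $\mathbb{R}^3$. $K$ is the Gaussian curvature and $H$ is the mean curvature, i.e. half the trace of $-dN$ (the unit sphere with outward normal has $H=-1$). The third fundamental form is $III=\langle dN,dN\rangle$, a Riemannian metric where $K\neq 0$. Definition: an oriented surface $S\subset\mathbb{R}^3$ is a surface with quadratic support function of harmonic type (HQSF-surface) if $$2\Psi H+(c\Psi e^{2\mu}+\Lambda-\Psi^2)K=0$$ on $S$, where $c$ is a real constant and $\mu$ is a function on $S$ that is harmonic with respect to the third fundamental form. An HQSF-surface of rotation is an HQSF-surface that is a surface of revolution; the axis of rotation is the $x_3$-axis (through the origin). The local parametrizations are understood to be regular (immersions), with $(u_1,u_2)$ in an open subset of $\mathbb{R}^2$; primes on $h_i$ denote derivatives with respect to $u_1$. In the Gauss map convention $N=\frac{1}{1+|g|^2}(2g,1-|g|^2)$ the parametrization corresponds to $g=e^{u_1+iu_2}$.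
   Formalization: "Surface of revolution" is taken to miss the axis and to be rotation-invariant only locally around each point; otherwise the full unit sphere (c=2, mu=0), whose poles no regular X_i covers, and small open patches of rotational surfaces would contradict the claim. *)

theory Defs
  imports "HOL-Analysis.Analysis"
begin

section \<open>Smooth maps and regular surfaces\<close>

definition pd :: "'n \<Rightarrow> (real ^ 'n \<Rightarrow> 'b::real_normed_vector) \<Rightarrow> real ^ 'n \<Rightarrow> 'b" where
  "pd i f u = frechet_derivative f (at u) (axis i 1)"

primrec Ck_on :: "nat \<Rightarrow> (real ^ 'n) set \<Rightarrow> (real ^ 'n \<Rightarrow> 'b::real_normed_vector) \<Rightarrow> bool" where
  "Ck_on 0 U f \<longleftrightarrow> continuous_on U f"
| "Ck_on (Suc k) U f \<longleftrightarrow> f differentiable_on U \<and> (\<forall>i. Ck_on k U (pd i f))"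

definition smooth_map_on :: "(real ^ 'n) set \<Rightarrow> (real ^ 'n \<Rightarrow> 'b::real_normed_vector) \<Rightarrow> bool" where
  "smooth_map_on U f \<longleftrightarrow> (\<forall>k. Ck_on k U f)"

definition local_parametrization ::
    "(real ^ 3) set \<Rightarrow> (real ^ 2) set \<Rightarrow> (real ^ 2 \<Rightarrow> real ^ 3) \<Rightarrow> bool" where
  "local_parametrization S U X \<longleftrightarrow>
     open U \<and> smooth_map_on U X \<and>
     (\<forall>q\<in>U. inj (frechet_derivative X (at q))) \<and>
     openin (top_of_set S) (X ` U) \<and>
     (\<exists>Y. homeomorphism U (X ` U) X Y)"

definition locally_parametrized_by :: "(real ^ 3) set \<Rightarrow> (real ^ 2 \<Rightarrow> real ^ 3) \<Rightarrow> bool" where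
  "locally_parametrized_by S X \<longleftrightarrow> (\<forall>p\<in>S. \<exists>U. local_parametrization S U X \<and> p \<in> X ` U)"

definition regular_surface :: "(real ^ 3) set \<Rightarrow> bool" where
  "regular_surface S \<longleftrightarrow> (\<forall>p\<in>S. \<exists>U X. local_parametrization S U X \<and> p \<in> X ` U)"

text \<open>\<open>N\<close> is a smooth unit normal field (Gauss map) on \<open>S\<close>; its values off \<open>S\<close> are irrelevant.\<close>

definition oriented_surface :: "(real ^ 3) set \<Rightarrow> (real ^ 3 \<Rightarrow> real ^ 3) \<Rightarrow> bool" where
  "oriented_surface S N \<longleftrightarrow>
     regular_surface S \<and>
     (\<forall>U X. local_parametrization S U X \<longrightarrow>
        smooth_map_on U (N \<circ> X) \<and>
        (\<forall>q\<in>U. norm (N (X q)) = 1 \<and> (\<forall>i. pd i X q \<bullet> N (X q) = 0)))"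


section \<open>Curvature\<close>

text \<open>The matrix of the shape operator \<open>- dN\<close> at \<open>X q\<close> in the basis of the tangent plane
  formed by the partial derivatives of the local parametrization \<open>X\<close>. Its trace and determinant
  do not depend on \<open>X\<close>. The unit sphere with outward normal has mean curvature \<open>- 1\<close>.\<close>

definition shape_matrix :: "(real ^ 3 \<Rightarrow> real ^ 3) \<Rightarrow> (real ^ 2 \<Rightarrow> real ^ 3) \<Rightarrow> real ^ 2 \<Rightarrow> real ^ 2 ^ 2" where
  "shape_matrix N X q = (THE A. \<forall>j. - pd j (N \<circ> X) q = (\<Sum>i\<in>UNIV. (A $ i $ j) *\<^sub>R pd i X q))"

definition gauss_curvature :: "(real ^ 3 \<Rightarrow> real ^ 3) \<Rightarrow> (real ^ 2 \<Rightarrow> real ^ 3) \<Rightarrow> real ^ 2 \<Rightarrow> real" where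
  "gauss_curvature N X q = det (shape_matrix N X q)"

definition mean_curvature :: "(real ^ 3 \<Rightarrow> real ^ 3) \<Rightarrow> (real ^ 2 \<Rightarrow> real ^ 3) \<Rightarrow> real ^ 2 \<Rightarrow> real" where
  "mean_curvature N X q = trace (shape_matrix N X q) / 2"

definition nonzero_gauss_curvature :: "(real ^ 3) set \<Rightarrow> (real ^ 3 \<Rightarrow> real ^ 3) \<Rightarrow> bool" where
  "nonzero_gauss_curvature S N \<longleftrightarrow>
     (\<forall>U X. local_parametrization S U X \<longrightarrow> (\<forall>q\<in>U. gauss_curvature N X q \<noteq> 0))"


section \<open>Harmonicity with respect to the third fundamental form\<close>

definition third_form :: "(real ^ 3 \<Rightarrow> real ^ 3) \<Rightarrow> (real ^ 2 \<Rightarrow> real ^ 3) \<Rightarrow> real ^ 2 \<Rightarrow> real ^ 2 ^ 2" where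
  "third_form N X q = (\<chi> i j. pd i (N \<circ> X) q \<bullet> pd j (N \<circ> X) q)"

text \<open>The Laplace-Beltrami operator of the metric with coefficient matrix \<open>G\<close>, in coordinates.\<close>

definition laplace_beltrami :: "(real ^ 2 \<Rightarrow> real ^ 2 ^ 2) \<Rightarrow> (real ^ 2 \<Rightarrow> real) \<Rightarrow> real ^ 2 \<Rightarrow> real" where
  "laplace_beltrami G f q =
     (\<Sum>i\<in>UNIV. pd i (\<lambda>u. sqrt (det (G u)) * (\<Sum>j\<in>UNIV. matrix_inv (G u) $ i $ j * pd j f u)) q)
       / sqrt (det (G q))"

definition harmonic_III ::
    "(real ^ 3) set \<Rightarrow> (real ^ 3 \<Rightarrow> real ^ 3) \<Rightarrow> (real ^ 3 \<Rightarrow> real) \<Rightarrow> bool" where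
  "harmonic_III S N \<mu> \<longleftrightarrow>
     (\<forall>U X. local_parametrization S U X \<longrightarrow>
        Ck_on 2 U (\<mu> \<circ> X) \<and> (\<forall>q\<in>U. laplace_beltrami (third_form N X) (\<mu> \<circ> X) q = 0))"


section \<open>HQSF-surfaces\<close>

definition support_function :: "(real ^ 3 \<Rightarrow> real ^ 3) \<Rightarrow> real ^ 3 \<Rightarrow> real" where
  "support_function N p = p \<bullet> N p"

definition quadratic_distance :: "real ^ 3 \<Rightarrow> real" where
  "quadratic_distance p = p \<bullet> p"

definition HQSF_surface :: "(real ^ 3) set \<Rightarrow> (real ^ 3 \<Rightarrow> real ^ 3) \<Rightarrow> bool" where
  "HQSF_surface S N \<longleftrightarrow>
     oriented_surface S N \<and>
     (\<exists>(c::real) \<mu>. harmonic_III S N \<mu> \<and>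
        (\<forall>U X. local_parametrization S U X \<longrightarrow>
           (\<forall>q\<in>U. let p = X q; \<Psi> = support_function N p; \<Lambda> = quadratic_distance p;
                      H = mean_curvature N X q; K = gauss_curvature N X q
                  in 2 * \<Psi> * H + (c * \<Psi> * exp (2 * \<mu> p) + \<Lambda> - \<Psi>\<^sup>2) * K = 0)))"

definition rotation_x3 :: "real \<Rightarrow> real ^ 3 \<Rightarrow> real ^ 3" where
  "rotation_x3 \<theta> p = vector [p $ 1 * cos \<theta> - p $ 2 * sin \<theta>, p $ 1 * sin \<theta> + p $ 2 * cos \<theta>, p $ 3]"

text \<open>A surface of revolution is generated by a curve that does not meet the axis. Being of
  revolution is a local property: around each of its points, \<open>S\<close> coincides with a set \<open>M\<close>
  invariant under all rotations about the axis, but \<open>S\<close> need not contain full circles.\<close>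

definition surface_of_revolution :: "(real ^ 3) set \<Rightarrow> bool" where
  "surface_of_revolution S \<longleftrightarrow>
     (\<forall>p\<in>S. (p $ 1, p $ 2) \<noteq> (0, 0)) \<and>
     (\<forall>p\<in>S. \<exists>V M. open V \<and> p \<in> V \<and> (\<forall>\<theta>. rotation_x3 \<theta> ` M = M) \<and> S \<inter> V = M \<inter> V)"

definition HQSF_surface_of_rotation :: "(real ^ 3) set \<Rightarrow> (real ^ 3 \<Rightarrow> real ^ 3) \<Rightarrow> bool" where
  "HQSF_surface_of_rotation S N \<longleftrightarrow> HQSF_surface S N \<and> surface_of_revolution S"


section \<open>The explicit parametrizations\<close>

definition profile_A :: "(real \<Rightarrow> real) \<Rightarrow> real \<Rightarrow> real" where
  "profile_A h t =
     ((1 - exp (2 * t)) * deriv h t + 2 * exp (2 * t) * h t) / (exp t * (1 + exp (2 * t)))"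

definition profile_B :: "(real \<Rightarrow> real) \<Rightarrow> real \<Rightarrow> real" where
  "profile_B h t = - (2 * (deriv h t - h t)) / (1 + exp (2 * t))"

definition rotational_X :: "(real \<Rightarrow> real) \<Rightarrow> real ^ 2 \<Rightarrow> real ^ 3" where
  "rotational_X h u =
     vector [profile_A h (u $ 1) * cos (u $ 2), profile_A h (u $ 1) * sin (u $ 2), profile_B h (u $ 1)]"

definition Omega :: "real \<Rightarrow> real \<Rightarrow> real \<Rightarrow> complex \<Rightarrow> real" where
  "Omega c c1 c2 z1 = (c * c1 - c2)\<^sup>2 + 4 * c * (cmod z1)\<^sup>2"

definition h1 :: "real \<Rightarrow> real \<Rightarrow> real \<Rightarrow> complex \<Rightarrow> real \<Rightarrow> real \<Rightarrow> real \<Rightarrow> real" where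
  "h1 c c1 c2 z1 a1 a2 t =
     (let \<Omega> = Omega c c1 c2 z1 in
       exp (2 * (c * c1 + c2 - sqrt \<Omega>) * t / c) *
       (a1\<^sup>2 * (\<Omega> + (c * c1 - c2) * sqrt \<Omega>) +
        a2\<^sup>2 * exp (2 * sqrt \<Omega> * t / c) * (\<Omega> - (c * c1 - c2) * sqrt \<Omega>))\<^sup>2
       / (4 * c\<^sup>2 * (exp (2 * t) + 1) * cmod z1 ^ 4))"

definition h2 :: "real \<Rightarrow> real \<Rightarrow> real \<Rightarrow> complex \<Rightarrow> real \<Rightarrow> real \<Rightarrow> real \<Rightarrow> real" where
  "h2 c c1 c2 z1 b1 b2 t =
     (let \<Omega> = Omega c c1 c2 z1 in
       (- \<Omega> * exp (2 * (c2 / c + c1) * t)) / (16 * c\<^sup>2 * (exp (2 * t) + 1) * cmod z1 ^ 4) *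
       (((b1\<^sup>2 - b2\<^sup>2) * (c * c1 - c2) + 2 * b1 * b2 * sqrt (- \<Omega>)) * sin (sqrt (- \<Omega>) * t / c) +
        ((b1\<^sup>2 - b2\<^sup>2) * sqrt (- \<Omega>) - 2 * b1 * b2 * (c * c1 - c2)) * cos (sqrt (- \<Omega>) * t / c))\<^sup>2)"

definition h3 :: "real \<Rightarrow> real \<Rightarrow> real \<Rightarrow> complex \<Rightarrow> real \<Rightarrow> real \<Rightarrow> real \<Rightarrow> real" where
  "h3 c c1 c2 z1 a1 a2 t =
     exp (2 * (c2 / c + c1) * t) *
     (a2 * ((a1 + a2 * t) * (c2 - c * c1) + a2 * c))\<^sup>2
     / ((exp (2 * t) + 1) * cmod z1 ^ 4)"

end

theory Submission
  imports Defs "HOL-Complex_Analysis.Conformal_Mappings"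
begin

text \<open>
  In the coordinates \<open>(u\<^sub>1, u\<^sub>2)\<close> of the Gauss image, a surface of nonzero curvature is determined by its
  support function \<open>\<psi>\<close>, and the HQSF equation becomes an equation for \<open>\<psi>\<close>. The normal of a surface of
  revolution is orthogonal to the parallels, which makes \<open>\<psi>\<close> a function of \<open>u\<^sub>1\<close> alone. If \<open>c \<noteq> 0\<close>, the
  equation shows the same for \<open>\<mu>\<close>; since the third fundamental form is conformal to
  \<open>du\<^sub>1\<^sup>2 + du\<^sub>2\<^sup>2\<close>, harmonicity means that \<open>\<mu> = a u\<^sub>1 + b\<close>. With
  \<open>\<psi> = exp (2 a u\<^sub>1) F\<^sup>2 / (2 cosh\<^sup>2 u\<^sub>1)\<close> the HQSF equation says that \<open>F F'' - F'\<^sup>2\<close> is constant, that is,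
  \<open>F'' = l F\<close> for a constant \<open>l\<close>, whose sign is that of \<open>\<Omega>\<close> up to the degenerate choices of the
  constants. These degenerate choices, for which \<open>F\<close> is an exponential, also cover \<open>c = 0\<close>.

  The support function does not vanish, so replacing \<open>N\<close> by \<open>- N\<close> and \<open>c\<close> by \<open>- c\<close> makes it positive. The
  profile functions are analytic, so the one found near a point of a connected surface is valid
  everywhere.
\<close>

section \<open>Differentiable maps\<close>

text \<open>The constant \<open>c\<close> of the explicit formulas need not be the constant of the
  HQSF equation; only the two classes of profile functions have to match. For F = P exp(rt) + Q
  exp(-rt) the constant F F'' - F'^2 is 4 P Q r^2, and for l = 0 or l < 0 it is at most 0. In the
  formulas, \<Omega> \<le> 0 forces c < 0, while for \<Omega> > 0 the two coefficients in
  \<open>h1\<close> have equal signs if c > 0 and opposite signs if c < 0. So every F occurs,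
  already with c = 1 or c = -1. The definitions quantify over all local parametrizations, not only
  over those that suit the Gauss map. Curvature and the Laplace-Beltrami operator are therefore
  computed for an arbitrary \<open>X\<close>, through a map T into the (u1, u2)-plane with N o X =
  \<sigma> \<open>sphere_chart\<close> o T. The inverse of T is only known to be differentiable
  once, so further regularity has to be drawn from identities rather than from the chain
  rule.\<close>

lemma pd_eqI: "(f has_derivative f') (at u) \<Longrightarrow> pd i f u = f' (axis i 1)"
  unfolding pd_def by (metis frechet_derivative_at)

lemma has_derivative_pd:
  fixes f :: "real ^ 2 \<Rightarrow> 'b::real_normed_vector"
  assumes "f differentiable at u"
  shows "(f has_derivative (\<lambda>v. (v $ 1) *\<^sub>R pd 1 f u + (v $ 2) *\<^sub>R pd 2 f u)) (at u)"
proof -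
  obtain f' where f': "(f has_derivative f') (at u)"
    using assms by (auto simp: differentiable_def)
  then interpret f': bounded_linear f' by (rule has_derivative_bounded_linear)
  have "f' v = (v $ 1) *\<^sub>R pd 1 f u + (v $ 2) *\<^sub>R pd 2 f u" for v
  proof -
    have "v = (v $ 1) *\<^sub>R axis 1 1 + (v $ 2) *\<^sub>R axis 2 1"
      by (simp add: vec_eq_iff forall_2 axis_def)
    then have "f' v = f' ((v $ 1) *\<^sub>R axis 1 1 + (v $ 2) *\<^sub>R axis 2 1)" by simp
    also have "\<dots> = (v $ 1) *\<^sub>R pd 1 f u + (v $ 2) *\<^sub>R pd 2 f u"
      by (simp add: f'.add f'.scaleR pd_eqI[OF f'])
    finally show ?thesis .
  qed
  then have "f' = (\<lambda>v. (v $ 1) *\<^sub>R pd 1 f u + (v $ 2) *\<^sub>R pd 2 f u)" by blast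
  with f' show ?thesis by simp
qed

lemma pd_cong:
  assumes "open U" "q \<in> U" "\<And>x. x \<in> U \<Longrightarrow> f x = g x"
  shows "pd i f q = pd i g q"
proof -
  have "(f has_derivative f') (at q) \<longleftrightarrow> (g has_derivative f') (at q)" for f'
    using assms has_derivative_transform_within_open[of f f' q UNIV U g]
      has_derivative_transform_within_open[of g f' q UNIV U f] by auto
  then show ?thesis by (simp add: pd_def frechet_derivative_def)
qed

lemma pd_component:
  assumes "f differentiable at q" "bounded_linear L"
  shows "pd i (\<lambda>x. L (f x)) q = L (pd i f q)"
proof -
  obtain f' where f': "(f has_derivative f') (at q)"
    using assms by (auto simp: differentiable_def)
  have "((\<lambda>x. L (f x)) has_derivative (\<lambda>v. L (f' v))) (at q)"
    using bounded_linear.has_derivative[OF assms(2) f'] .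
  from pd_eqI[OF this] pd_eqI[OF f'] show ?thesis by simp
qed

lemma pd_vec_nth: "f differentiable at q \<Longrightarrow> pd i (\<lambda>x. f x $ j) q = pd i f q $ j"
  using pd_component[of f q "\<lambda>v. v $ j" i] bounded_linear_vec_nth by blast

lemma Ck_on_cong:
  assumes "open U" "\<And>x. x \<in> U \<Longrightarrow> f x = g x" "Ck_on k U f"
  shows "Ck_on k U g"
  using assms(2,3)
proof (induction k arbitrary: f g)
  case 0
  then show ?case using continuous_on_cong by fastforce
next
  case (Suc k)
  have "f differentiable_on U" using Suc.prems(2) by simp
  then have "g differentiable_on U"
    using Suc.prems(1) unfolding differentiable_on_def differentiable_def
    by (metis has_derivative_transform)
  moreover have "Ck_on k U (pd i g)" for i
  proof (rule Suc.IH[of "pd i f"])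
    show "pd i f x = pd i g x" if "x \<in> U" for x
      using pd_cong[OF assms(1) that] Suc.prems(1) by blast
  qed (use Suc.prems in auto)
  ultimately show ?case by simp
qed

lemma Ck_on_SucD: "Ck_on (Suc k) U f \<Longrightarrow> Ck_on k U f"
proof (induction k arbitrary: f)
  case 0
  then show ?case by (simp add: differentiable_imp_continuous_on)
next
  case (Suc k)
  then show ?case using Ck_on.simps(2) by blast
qed

lemma Ck_on_mono: "k \<le> l \<Longrightarrow> Ck_on l U f \<Longrightarrow> Ck_on k U f"
  by (induction rule: dec_induct) (simp_all add: Ck_on_SucD del: Ck_on.simps)

lemma Ck_on_subset: "Ck_on k U f \<Longrightarrow> V \<subseteq> U \<Longrightarrow> Ck_on k V f"
proof (induction k arbitrary: f)
  case 0
  then show ?case using continuous_on_subset by auto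
next
  case (Suc k)
  then show ?case using differentiable_on_subset by auto
qed

lemma Ck_on_differentiable:
  "Ck_on (Suc k) U f \<Longrightarrow> open U \<Longrightarrow> q \<in> U \<Longrightarrow> f differentiable at q"
  by (metis Ck_on.simps(2) differentiable_on_eq_differentiable_at)

text \<open>Off \<open>U\<close> a partial derivative has whatever value
  \<open>frechet_derivative\<close> gives there, so it is enough to know a function that agrees with
  it on \<open>U\<close>.\<close>

lemma Ck_on_SucI:
  assumes "open U" "\<And>q. q \<in> U \<Longrightarrow> f differentiable at q"
    and "\<And>i. \<exists>g. Ck_on k U g \<and> (\<forall>q\<in>U. pd i f q = g q)"
  shows "Ck_on (Suc k) U f"
proof -
  have "Ck_on k U (pd i f)" for i
    using assms(3)[of i] Ck_on_cong[OF assms(1)] by metis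
  then show ?thesis
    using assms by (simp add: differentiable_on_eq_differentiable_at)
qed

lemma Ck_on_pd: "Ck_on (Suc k) U f \<Longrightarrow> Ck_on k U (pd i f)"
  by simp

lemma pd_const: "pd i (\<lambda>x. c) q = 0"
  using pd_eqI[OF has_derivative_const] by metis

lemma Ck_on_const: "open U \<Longrightarrow> Ck_on k U (\<lambda>x. c)"
proof (induction k arbitrary: c)
  case (Suc k)
  show ?case
    by (rule Ck_on_SucI) (use Suc in \<open>auto intro!: exI[of _ "\<lambda>x. 0"] simp: pd_const\<close>)
qed simp

lemma Ck_on_linear:
  assumes "open U" "bounded_linear L"
  shows "Ck_on k U L"
proof (cases k)
  case 0
  then show ?thesis using assms by (simp add: linear_continuous_on)
next
  case (Suc l)
  have L: "(L has_derivative L) (at q)" for q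
    using assms(2) by (rule bounded_linear_imp_has_derivative)
  show ?thesis unfolding Suc
  proof (rule Ck_on_SucI[OF assms(1)])
    show "\<exists>g. Ck_on l U g \<and> (\<forall>q\<in>U. pd i L q = g q)" for i
      using pd_eqI[OF L] Ck_on_const[OF assms(1)] by blast
  qed (use L differentiable_def in blast)
qed

lemma Ck_on_bounded_linear:
  assumes "open U" "bounded_linear L" "Ck_on k U f"
  shows "Ck_on k U (\<lambda>x. L (f x))"
  using assms(3)
proof (induction k arbitrary: f)
  case 0
  then show ?case using bounded_linear.continuous_on[OF assms(2)] by simp
next
  case (Suc k)
  note d = Ck_on_differentiable[OF Suc.prems assms(1)]
  show ?case
  proof (rule Ck_on_SucI[OF assms(1)])
    show "(\<lambda>x. L (f x)) differentiable at q" if "q \<in> U" for q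
      using d[OF that] bounded_linear.has_derivative[OF assms(2)] unfolding differentiable_def by blast
    show "\<exists>g. Ck_on k U g \<and> (\<forall>q\<in>U. pd i (\<lambda>x. L (f x)) q = g q)" for i
      using Suc.IH[of "pd i f"] Suc.prems pd_component[OF d assms(2)] by (metis Ck_on_pd)
  qed
qed

lemma pd_add:
  assumes "f differentiable at q" "g differentiable at q"
  shows "pd i (\<lambda>x. f x + g x) q = pd i f q + pd i g q"
proof -
  obtain f' g' where d: "(f has_derivative f') (at q)" "(g has_derivative g') (at q)"
    using assms by (auto simp: differentiable_def)
  show ?thesis using pd_eqI[OF has_derivative_add[OF d]] pd_eqI[OF d(1)] pd_eqI[OF d(2)] by simp
qed

lemma Ck_on_add:
  assumes "open U" "Ck_on k U f" "Ck_on k U g"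
  shows "Ck_on k U (\<lambda>x. f x + g x)"
  using assms(2,3)
proof (induction k arbitrary: f g)
  case 0
  then show ?case by (simp add: continuous_on_add)
next
  case (Suc k)
  note df = Ck_on_differentiable[OF Suc.prems(1) assms(1)]
  note dg = Ck_on_differentiable[OF Suc.prems(2) assms(1)]
  show ?case
  proof (rule Ck_on_SucI[OF assms(1)])
    show "(\<lambda>x. f x + g x) differentiable at q" if "q \<in> U" for q
      using df dg that by simp
    have "pd i (\<lambda>x. f x + g x) q = pd i f q + pd i g q" if q: "q \<in> U" for i q
      by (rule pd_add[OF df[OF q] dg[OF q]])
    then show "\<exists>h. Ck_on k U h \<and> (\<forall>q\<in>U. pd i (\<lambda>x. f x + g x) q = h q)" for i
      using Suc.IH[OF Ck_on_pd[OF Suc.prems(1)] Ck_on_pd[OF Suc.prems(2)]] by blast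
  qed
qed

lemma (in bounded_bilinear) pd_prod:
  assumes "f differentiable at q" "g differentiable at q"
  shows "pd i (\<lambda>x. prod (f x) (g x)) q = prod (f q) (pd i g q) + prod (pd i f q) (g q)"
proof -
  obtain f' g' where d: "(f has_derivative f') (at q)" "(g has_derivative g') (at q)"
    using assms by (auto simp: differentiable_def)
  show ?thesis using pd_eqI[OF FDERIV[OF d]] pd_eqI[OF d(1)] pd_eqI[OF d(2)] by metis
qed

lemma (in bounded_bilinear) Ck_on_prod:
  assumes "open U" "Ck_on k U f" "Ck_on k U g"
  shows "Ck_on k U (\<lambda>x. prod (f x) (g x))"
  using assms(2,3)
proof (induction k arbitrary: f g)
  case 0
  then show ?case by (simp add: continuous_on)
next
  case (Suc k)
  note df = Ck_on_differentiable[OF Suc.prems(1) assms(1)]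
  note dg = Ck_on_differentiable[OF Suc.prems(2) assms(1)]
  show ?case
  proof (rule Ck_on_SucI[OF assms(1)])
    show "(\<lambda>x. prod (f x) (g x)) differentiable at q" if "q \<in> U" for q
      using df[OF that] dg[OF that] FDERIV unfolding differentiable_def by blast
    have "Ck_on k U (\<lambda>x. prod (f x) (pd i g x) + prod (pd i f x) (g x))" for i
      using Suc.prems Suc.IH[of f "pd i g"] Suc.IH[of "pd i f" g] Ck_on_SucD[OF Suc.prems(1)]
        Ck_on_SucD[OF Suc.prems(2)] by (intro Ck_on_add[OF assms(1)]) auto
    then show "\<exists>h. Ck_on k U h \<and> (\<forall>q\<in>U. pd i (\<lambda>x. prod (f x) (g x)) q = h q)" for i
      using pd_prod df dg by blast
  qed
qed

lemmas Ck_on_mult = bounded_bilinear.Ck_on_prod[OF bounded_bilinear_mult]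
lemmas pd_mult = bounded_bilinear.pd_prod[OF bounded_bilinear_mult]
lemmas pd_inner = bounded_bilinear.pd_prod[OF bounded_bilinear_inner]

text \<open>Each derivative is only determined on the set, so it is quantified rather than taken to be
  \<^const>\<open>deriv\<close>.\<close>

primrec Ck_real_on :: "nat \<Rightarrow> real set \<Rightarrow> (real \<Rightarrow> real) \<Rightarrow> bool" where
  "Ck_real_on 0 J g \<longleftrightarrow> continuous_on J g"
| "Ck_real_on (Suc k) J g \<longleftrightarrow>
     (\<exists>g'. (\<forall>t\<in>J. (g has_real_derivative g' t) (at t)) \<and> Ck_real_on k J g')"

lemma Ck_real_on_SucD: "Ck_real_on (Suc k) J g \<Longrightarrow> Ck_real_on k J g"
proof (induction k arbitrary: g)
  case 0
  then obtain g' where "\<And>t. t \<in> J \<Longrightarrow> (g has_real_derivative g' t) (at t)" by auto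
  then have "isCont g t" if "t \<in> J" for t using that DERIV_isCont by blast
  then show ?case by (simp add: continuous_at_imp_continuous_on)
next
  case (Suc k)
  then obtain g' where "\<forall>t\<in>J. (g has_real_derivative g' t) (at t)" "Ck_real_on (Suc k) J g'"
    unfolding Ck_real_on.simps(2)[of "Suc k"] by blast
  with Suc.IH[of g'] show ?case unfolding Ck_real_on.simps(2)[of k J g] by blast
qed

lemma pd_compose_real:
  assumes "f differentiable at q" "(g has_real_derivative g') (at (f q))"
  shows "pd i (\<lambda>x. g (f x)) q = g' * pd i f q" "(\<lambda>x. g (f x)) differentiable at q"
proof -
  obtain f' where f': "(f has_derivative f') (at q)"
    using assms by (auto simp: differentiable_def)
  have g: "(g has_derivative (\<lambda>h. g' * h)) (at (f q))"
    using assms(2) by (simp add: has_field_derivative_def)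
  have d: "((\<lambda>x. g (f x)) has_derivative (\<lambda>v. g' * f' v)) (at q)"
    using has_derivative_compose[OF f' g] .
  show "pd i (\<lambda>x. g (f x)) q = g' * pd i f q" "(\<lambda>x. g (f x)) differentiable at q"
    using pd_eqI[OF d] pd_eqI[OF f'] d by (auto simp: differentiable_def)
qed

lemma Ck_on_compose_real:
  assumes "open U" "Ck_on k U f" "Ck_real_on k J g" "f ` U \<subseteq> J"
  shows "Ck_on k U (\<lambda>x. g (f x))"
  using assms(2,3)
proof (induction k arbitrary: g)
  case 0
  then have "continuous_on J g" "continuous_on U f" by simp_all
  then show ?case using assms(4) continuous_on_compose2[of J g U f] by simp
next
  case (Suc k)
  note df = Ck_on_differentiable[OF Suc.prems(1) assms(1)]
  obtain g' where g': "\<And>t. t \<in> J \<Longrightarrow> (g has_real_derivative g' t) (at t)" "Ck_real_on k J g'"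
    using Suc.prems(2) unfolding Ck_real_on.simps by blast
  have gf: "(g has_real_derivative g' (f q)) (at (f q))" if "q \<in> U" for q
    using that assms(4) g'(1) by blast
  show ?case
  proof (rule Ck_on_SucI[OF assms(1)])
    show "(\<lambda>x. g (f x)) differentiable at q" if "q \<in> U" for q
      using pd_compose_real[OF df[OF that] gf[OF that]] by blast
    have "Ck_on k U (\<lambda>x. g' (f x) * pd i f x)" for i
      by (rule Ck_on_mult[OF assms(1) Suc.IH[OF Ck_on_SucD[OF Suc.prems(1)] g'(2)]
          Ck_on_pd[OF Suc.prems(1)]])
    then show "\<exists>h. Ck_on k U h \<and> (\<forall>q\<in>U. pd i (\<lambda>x. g (f x)) q = h q)" for i
      using pd_compose_real[OF df gf] by blast
  qed
qed

lemma Ck_real_on_SucI: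
  "(\<And>t. t \<in> J \<Longrightarrow> (g has_real_derivative g' t) (at t)) \<Longrightarrow> Ck_real_on k J g' \<Longrightarrow>
    Ck_real_on (Suc k) J g"
  by auto

lemma Ck_real_on_cong: "Ck_real_on k UNIV f \<Longrightarrow> (\<And>t. f t = g t) \<Longrightarrow> Ck_real_on k UNIV g"
  by (metis ext)

lemma Ck_real_on_const: "Ck_real_on k J (\<lambda>t. c)"
proof (induction k arbitrary: c)
  case (Suc k)
  show ?case by (rule Ck_real_on_SucI[OF _ Suc[of 0]]) simp
qed simp

lemma Ck_real_on_id: "Ck_real_on k J (\<lambda>t. t)"
proof (cases k)
  case (Suc l)
  show ?thesis unfolding Suc by (rule Ck_real_on_SucI[OF _ Ck_real_on_const[of _ _ 1]]) simp
qed simp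

lemma Ck_real_on_add:
  "Ck_real_on k J f \<Longrightarrow> Ck_real_on k J g \<Longrightarrow> Ck_real_on k J (\<lambda>t. f t + g t)"
proof (induction k arbitrary: f g)
  case (Suc k)
  from Suc.prems obtain f' g' where
    "\<And>t. t \<in> J \<Longrightarrow> (f has_real_derivative f' t) (at t)" "Ck_real_on k J f'"
    "\<And>t. t \<in> J \<Longrightarrow> (g has_real_derivative g' t) (at t)" "Ck_real_on k J g'"
    unfolding Ck_real_on.simps by blast
  then show ?case
    by (intro Ck_real_on_SucI[of _ _ "\<lambda>t. f' t + g' t"] Suc.IH DERIV_add)
qed (simp add: continuous_on_add)

lemma Ck_real_on_mult:
  "Ck_real_on k J f \<Longrightarrow> Ck_real_on k J g \<Longrightarrow> Ck_real_on k J (\<lambda>t. f t * g t)"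
proof (induction k arbitrary: f g)
  case (Suc k)
  from Suc.prems obtain f' g' where
    *: "\<And>t. t \<in> J \<Longrightarrow> (f has_real_derivative f' t) (at t)" "Ck_real_on k J f'"
    "\<And>t. t \<in> J \<Longrightarrow> (g has_real_derivative g' t) (at t)" "Ck_real_on k J g'"
    unfolding Ck_real_on.simps by blast
  then show ?case
    using Ck_real_on_SucD[OF Suc.prems(1)] Ck_real_on_SucD[OF Suc.prems(2)]
    by (intro Ck_real_on_SucI[of _ _ "\<lambda>t. f' t * g t + g' t * f t"] Suc.IH DERIV_mult
        Ck_real_on_add)
qed (simp add: continuous_on_mult)

lemma Ck_real_on_compose:
  "Ck_real_on k J f \<Longrightarrow> Ck_real_on k I g \<Longrightarrow> f ` J \<subseteq> I \<Longrightarrow> Ck_real_on k J (\<lambda>t. g (f t))"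
proof (induction k arbitrary: g)
  case 0
  then have "continuous_on I g" "continuous_on J f" by simp_all
  then show ?case using 0 continuous_on_compose2[of I g J f] by simp
next
  case (Suc k)
  from Suc.prems obtain f' g' where
    *: "\<And>t. t \<in> J \<Longrightarrow> (f has_real_derivative f' t) (at t)" "Ck_real_on k J f'"
    "\<And>t. t \<in> I \<Longrightarrow> (g has_real_derivative g' t) (at t)" "Ck_real_on k I g'"
    unfolding Ck_real_on.simps by blast
  show ?case
  proof (rule Ck_real_on_SucI[of _ _ "\<lambda>t. g' (f t) * f' t"])
    show "((\<lambda>t. g (f t)) has_real_derivative g' (f t) * f' t) (at t)" if "t \<in> J" for t
      using DERIV_chain2 * that Suc.prems(3) by blast
    show "Ck_real_on k J (\<lambda>t. g' (f t) * f' t)"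
      by (rule Ck_real_on_mult[OF Suc.IH[OF Ck_real_on_SucD[OF Suc.prems(1)] *(4) Suc.prems(3)] *(2)])
  qed
qed

lemma Ck_real_on_exp: "Ck_real_on k J exp"
proof (induction k)
  case (Suc k)
  then show ?case by (rule Ck_real_on_SucI[OF DERIV_exp])
qed (simp add: continuous_on_exp)

text \<open>Taking all combinations at once makes the class closed under differentiation, so one
  induction on k serves both functions.\<close>

lemma Ck_real_on_sin_cos: "Ck_real_on k J (\<lambda>t. a * sin t + b * cos t)"
proof (induction k arbitrary: a b)
  case (Suc k)
  show ?case
  proof (rule Ck_real_on_SucI[of _ _ "\<lambda>t. (- b) * sin t + a * cos t"])
    show "((\<lambda>t. a * sin t + b * cos t) has_real_derivative (- b) * sin t + a * cos t) (at t)" for t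
      by (auto intro!: derivative_eq_intros)
  qed (rule Suc)
qed (auto intro!: continuous_intros)

text \<open>The derivative is minus the square of \<open>inverse\<close> itself, so the induction
  hypothesis and the product rule suffice.\<close>

lemma Ck_real_on_inverse: "0 \<notin> J \<Longrightarrow> Ck_real_on k J inverse"
proof (induction k)
  case 0
  show ?case using 0 by (auto intro!: continuous_intros)
next
  case (Suc k)
  have "Ck_real_on k J (\<lambda>t. (- 1) * (inverse t * inverse t))"
    using Suc by (intro Ck_real_on_mult Ck_real_on_const) auto
  moreover have "(inverse has_real_derivative (- 1) * (inverse t * inverse t)) (at t)" if "t \<in> J" for t
    using DERIV_inverse[of t UNIV] that Suc.prems by (auto simp: power2_eq_square)
  ultimately show ?case by (intro Ck_real_on_SucI)
qed

lemma Ck_real_on_deriv: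
  assumes "Ck_real_on (Suc k) UNIV g"
  shows "Ck_real_on k UNIV (deriv g)"
proof -
  obtain g' where "\<And>t. (g has_real_derivative g' t) (at t)" "Ck_real_on k UNIV g'"
    using assms by auto
  then show ?thesis by (metis DERIV_imp_deriv ext)
qed

lemma Ck_real_on_artanh: "Ck_real_on k {-1<..<1} artanh"
proof (cases k)
  case 0
  then show ?thesis by (auto intro!: continuous_intros)
next
  case (Suc l)
  have "Ck_real_on l {-1<..<1} (\<lambda>t. 1 + (- 1) * (t * t))"
    by (intro Ck_real_on_add Ck_real_on_mult Ck_real_on_const Ck_real_on_id)
  then have 1: "Ck_real_on l {-1<..<1} (\<lambda>t. inverse (1 + (- 1) * (t * t)))"
    by (rule Ck_real_on_compose[OF _ Ck_real_on_inverse[of "{0<..}"]])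
      (auto simp: abs_square_less_1 power2_eq_square[symmetric])
  have "(artanh has_real_derivative inverse (1 + (- 1) * (t * t))) (at t)" if "t \<in> {-1<..<1}" for t :: real
    using artanh_real_has_field_derivative[of t UNIV] that
    by (auto simp: power2_eq_square divide_simps)
  with 1 show ?thesis unfolding Suc by (intro Ck_real_on_SucI)
qed

lemma Ck_real_on_arctan: "Ck_real_on k J arctan"
proof (cases k)
  case 0
  then show ?thesis by (auto intro!: continuous_intros)
next
  case (Suc l)
  have "1 + t * t > (0::real)" for t by (simp add: add_pos_nonneg)
  moreover have "Ck_real_on l J (\<lambda>t. 1 + t * t)"
    by (intro Ck_real_on_add Ck_real_on_mult Ck_real_on_const Ck_real_on_id)
  ultimately have "Ck_real_on l J (\<lambda>t. inverse (1 + t * t))"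
    by (intro Ck_real_on_compose[OF _ Ck_real_on_inverse[of "{0<..}"]]) auto
  moreover have "(arctan has_real_derivative inverse (1 + t * t)) (at t)" for t :: real
    using DERIV_arctan[of t] by (simp add: power2_eq_square)
  ultimately show ?thesis unfolding Suc by (intro Ck_real_on_SucI)
qed

section \<open>Equality of mixed partial derivatives\<close>

lemma DERIV_pd:
  fixes f :: "real ^ 'n \<Rightarrow> real"
  assumes "f differentiable at (q + s *\<^sub>R axis i 1)"
  shows "((\<lambda>s. f (q + s *\<^sub>R axis i 1)) has_real_derivative pd i f (q + s *\<^sub>R axis i 1)) (at s)"
proof -
  obtain f' where f': "(f has_derivative f') (at (q + s *\<^sub>R axis i 1))"
    using assms by (auto simp: differentiable_def)
  interpret f': bounded_linear f' using f' by (rule has_derivative_bounded_linear)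
  have "((\<lambda>s. q + s *\<^sub>R axis i 1) has_derivative (\<lambda>s. s *\<^sub>R axis i 1)) (at s)"
    by (auto intro!: derivative_eq_intros)
  from has_derivative_compose[OF this f'] show ?thesis
    using pd_eqI[OF f'] by (simp add: has_field_derivative_def f'.scaleR mult_commute_abs)
qed

text \<open>The mean value theorem is used twice: for the increment in direction \<open>j\<close> as
  a function of the step in direction \<open>i\<close>, then for \<open>pd i f\<close> along
  direction \<open>j\<close>. The left side is symmetric in \<open>i\<close> and \<open>j\<close>,
  which \<open>pd_commute\<close> exploits.\<close>

lemma second_difference_eq_pd_pd:
  fixes f :: "real ^ 'n \<Rightarrow> real"
  assumes U: "open U" and f: "Ck_on 2 U f" and t: "t > 0"
    and sub: "\<And>x y. \<lbrakk>0 \<le> x; x \<le> t; 0 \<le> y; y \<le> t\<rbrakk> \<Longrightarrow> q + x *\<^sub>R axis i 1 + y *\<^sub>R axis j 1 \<in> U"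
  shows "\<exists>x y. 0 < x \<and> x < t \<and> 0 < y \<and> y < t \<and>
    f (q + t *\<^sub>R axis i 1 + t *\<^sub>R axis j 1) - f (q + t *\<^sub>R axis i 1) - f (q + t *\<^sub>R axis j 1) + f q
      = t * t * pd j (pd i f) (q + x *\<^sub>R axis i 1 + y *\<^sub>R axis j 1)"
proof -
  have f2: "Ck_on (Suc (Suc 0)) U f" using f by (simp only: numeral_2_eq_2)
  note df = Ck_on_differentiable[OF f2 U]
  note ddf = Ck_on_differentiable[OF Ck_on_pd[OF f2] U]
  define g where "g s = f ((q + t *\<^sub>R axis j 1) + s *\<^sub>R axis i 1) - f (q + s *\<^sub>R axis i 1)" for s
  have "(g has_real_derivative (pd i f ((q + t *\<^sub>R axis j 1) + s *\<^sub>R axis i 1)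
      - pd i f (q + s *\<^sub>R axis i 1))) (at s)" if "0 \<le> s" "s \<le> t" for s
    unfolding g_def using that t sub[of s t] sub[of s 0]
    by (intro DERIV_diff DERIV_pd df) (simp_all add: add_ac)
  from MVT2[OF t this] obtain x where x: "0 < x" "x < t"
    "g t - g 0 = (t - 0) * (pd i f ((q + t *\<^sub>R axis j 1) + x *\<^sub>R axis i 1) - pd i f (q + x *\<^sub>R axis i 1))"
    by auto
  have "((\<lambda>s. pd i f ((q + x *\<^sub>R axis i 1) + s *\<^sub>R axis j 1)) has_real_derivative
      pd j (pd i f) ((q + x *\<^sub>R axis i 1) + s *\<^sub>R axis j 1)) (at s)" if "0 \<le> s" "s \<le> t" for s
    using that x sub[of x s] by (intro DERIV_pd ddf) simp
  from MVT2[OF t this] obtain y where y: "0 < y" "y < t"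
    "pd i f ((q + x *\<^sub>R axis i 1) + t *\<^sub>R axis j 1) - pd i f (q + x *\<^sub>R axis i 1)
      = t * pd j (pd i f) (q + x *\<^sub>R axis i 1 + y *\<^sub>R axis j 1)"
    by auto
  have "g t - g 0 = t * (t * pd j (pd i f) (q + x *\<^sub>R axis i 1 + y *\<^sub>R axis j 1))"
    using x(3) y(3) by (simp add: add_ac)
  moreover have "g t - g 0 = f (q + t *\<^sub>R axis i 1 + t *\<^sub>R axis j 1) - f (q + t *\<^sub>R axis i 1)
      - f (q + t *\<^sub>R axis j 1) + f q"
    by (simp add: g_def add_ac)
  ultimately show ?thesis using x(1,2) y(1,2)
    by (intro exI[of _ x] exI[of _ y]) (simp only: mult.assoc)
qed

lemma pd_commute:
  fixes f :: "real ^ 'n \<Rightarrow> real"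
  assumes U: "open U" and f: "Ck_on 2 U f" and q: "q \<in> U"
  shows "pd i (pd j f) q = pd j (pd i f) q"
proof -
  have "\<bar>pd i (pd j f) q - pd j (pd i f) q\<bar> \<le> e" if e: "e > 0" for e
  proof -
    have c: "continuous_on U (pd i (pd j f))" "continuous_on U (pd j (pd i f))"
      using f by (simp_all add: numeral_2_eq_2)
    obtain d0 where d0: "d0 > 0" "ball q d0 \<subseteq> U" using U q openE by blast
    obtain d1 where d1: "d1 > 0" "\<And>x. x \<in> U \<Longrightarrow> dist x q < d1 \<Longrightarrow>
        dist (pd i (pd j f) x) (pd i (pd j f) q) < e / 2"
      using c(1) q e unfolding continuous_on_iff by (metis half_gt_zero)
    obtain d2 where d2: "d2 > 0" "\<And>x. x \<in> U \<Longrightarrow> dist x q < d2 \<Longrightarrow>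
        dist (pd j (pd i f) x) (pd j (pd i f) q) < e / 2"
      using c(2) q e unfolding continuous_on_iff by (metis half_gt_zero)
    \<comment> \<open>Two steps of length at most t lead to a point within 2 t, hence less than 3 t,
      of q, so inside all three neighbourhoods.\<close>
    define t where "t = min d0 (min d1 d2) / 3"
    have t: "t > 0" "3 * t \<le> d0" "3 * t \<le> d1" "3 * t \<le> d2" using d0 d1 d2 by (auto simp: t_def)
    have near: "dist (q + x *\<^sub>R axis k 1 + y *\<^sub>R axis l 1) q < 3 * t"
      if "0 \<le> x" "x \<le> t" "0 \<le> y" "y \<le> t" for x y and k l :: 'n
    proof -
      have "norm (x *\<^sub>R axis k 1 + y *\<^sub>R axis l (1::real)) \<le> x + y"
        by (rule norm_triangle_le) (use that in simp)
      then show ?thesis using that t by (simp add: dist_norm add.assoc)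
    qed
    have sub: "q + x *\<^sub>R axis k 1 + y *\<^sub>R axis l 1 \<in> U"
      if "0 \<le> x" "x \<le> t" "0 \<le> y" "y \<le> t" for x y and k l :: 'n
      using near[OF that, of k l] d0 t by (auto simp: dist_commute subset_iff)
    obtain x y where xy: "0 < x" "x < t" "0 < y" "y < t"
      "f (q + t *\<^sub>R axis i 1 + t *\<^sub>R axis j 1) - f (q + t *\<^sub>R axis i 1) - f (q + t *\<^sub>R axis j 1) + f q
        = t * t * pd j (pd i f) (q + x *\<^sub>R axis i 1 + y *\<^sub>R axis j 1)"
      using second_difference_eq_pd_pd[OF U f t(1) sub] by blast
    obtain z w where zw: "0 < z" "z < t" "0 < w" "w < t"
      "f (q + t *\<^sub>R axis j 1 + t *\<^sub>R axis i 1) - f (q + t *\<^sub>R axis j 1) - f (q + t *\<^sub>R axis i 1) + f q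
        = t * t * pd i (pd j f) (q + z *\<^sub>R axis j 1 + w *\<^sub>R axis i 1)"
      using second_difference_eq_pd_pd[OF U f t(1) sub] by blast
    have "t * t * pd j (pd i f) (q + x *\<^sub>R axis i 1 + y *\<^sub>R axis j 1)
      = t * t * pd i (pd j f) (q + z *\<^sub>R axis j 1 + w *\<^sub>R axis i 1)"
    proof -
      have "q + t *\<^sub>R axis i 1 + t *\<^sub>R axis j 1 = q + t *\<^sub>R axis j 1 + t *\<^sub>R axis i 1"
        by (simp add: add_ac)
      then have "f (q + t *\<^sub>R axis i 1 + t *\<^sub>R axis j 1) = f (q + t *\<^sub>R axis j 1 + t *\<^sub>R axis i 1)"
        by (rule arg_cong)
      with xy(5) zw(5) show ?thesis by linarith
    qed
    then have "pd j (pd i f) (q + x *\<^sub>R axis i 1 + y *\<^sub>R axis j 1)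
      = pd i (pd j f) (q + z *\<^sub>R axis j 1 + w *\<^sub>R axis i 1)"
      using t by simp
    moreover have "dist (pd j (pd i f) (q + x *\<^sub>R axis i 1 + y *\<^sub>R axis j 1)) (pd j (pd i f) q) < e / 2"
      using near[of x y i j] xy t sub[of x y i j] by (intro d2) auto
    moreover have "dist (pd i (pd j f) (q + z *\<^sub>R axis j 1 + w *\<^sub>R axis i 1)) (pd i (pd j f) q) < e / 2"
      using near[of z w j i] zw t sub[of z w j i] by (intro d1) auto
    ultimately show ?thesis unfolding dist_real_def by linarith
  qed
  then have "\<bar>pd i (pd j f) q - pd j (pd i f) q\<bar> \<le> 0" by (rule field_le_epsilon) simp
  then show ?thesis by simp
qed

section \<open>Local inversion and the chain rule in the plane\<close>

text \<open>The inverse function theorem asks for the derivative as a continuous operator-valued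
  map, with a left inverse at q. \<open>f'\<close> is assembled from the partial derivatives and
  inherits their continuity; the determinant makes it injective.\<close>

lemma local_inverse_plane:
  fixes T :: "real ^ 2 \<Rightarrow> real ^ 2"
  assumes V: "open V" and T: "Ck_on 1 V T" and q: "q \<in> V"
    and det: "pd 1 T q $ 1 * pd 2 T q $ 2 - pd 2 T q $ 1 * pd 1 T q $ 2 \<noteq> 0"
  obtains V' D \<kappa> where "open V'" "V' \<subseteq> V" "q \<in> V'" "open D" "homeomorphism V' D T \<kappa>"
    "\<And>y. y \<in> D \<Longrightarrow> \<kappa> differentiable at y"
proof -
  have T1: "Ck_on (Suc 0) V T" using T by simp
  define pr :: "2 \<Rightarrow> (real ^ 2) \<Rightarrow>\<^sub>L real" where "pr i = Blinfun (\<lambda>v. v $ i)" for i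
  have pr: "blinfun_apply (pr i) v = v $ i" for i v
    unfolding pr_def by (simp add: bounded_linear_Blinfun_apply bounded_linear_vec_nth)
  define f' where "f' x = (blinfun_scaleR_left (pd 1 T x) o\<^sub>L pr 1)
    + (blinfun_scaleR_left (pd 2 T x) o\<^sub>L pr 2)" for x
  have f': "blinfun_apply (f' x) v = v $ 1 *\<^sub>R pd 1 T x + v $ 2 *\<^sub>R pd 2 T x" for x v
    unfolding f'_def by (simp add: blinfun.add_left pr)
  have der: "(T has_derivative blinfun_apply (f' x)) (at x)" if "x \<in> V" for x
    using has_derivative_pd[OF Ck_on_differentiable[OF T1 V that]] by (simp add: f'[abs_def])
  have "continuous_on V (pd i T)" for i using T1 by simp
  then have cont: "continuous_on V f'"
    unfolding f'_def
    by (intro continuous_on_add bounded_bilinear.continuous_on[OF bounded_bilinear_blinfun_compose]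
        bounded_linear.continuous_on[OF bounded_linear_blinfun_scaleR_left] continuous_on_const)
  have inj: "inj (blinfun_apply (f' q))"
  proof (subst linear_injective_0)
    show "linear (blinfun_apply (f' q))" by (simp add: blinfun.bounded_linear_right bounded_linear.linear)
    show "\<forall>v. blinfun_apply (f' q) v = 0 \<longrightarrow> v = 0"
    proof (intro allI impI)
      fix v assume "blinfun_apply (f' q) v = 0"
      then have e: "v $ 1 * pd 1 T q $ 1 + v $ 2 * pd 2 T q $ 1 = 0"
        "v $ 1 * pd 1 T q $ 2 + v $ 2 * pd 2 T q $ 2 = 0"
        by (simp_all add: f' vec_eq_iff forall_2)
      \<comment> \<open>Cramer's rule: each unknown times the determinant vanishes.\<close>
      have "v $ 1 * (pd 1 T q $ 1 * pd 2 T q $ 2 - pd 2 T q $ 1 * pd 1 T q $ 2) = 0"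
        "v $ 2 * (pd 1 T q $ 1 * pd 2 T q $ 2 - pd 2 T q $ 1 * pd 1 T q $ 2) = 0"
        using e by algebra+
      then show "v = 0" using det by (simp add: vec_eq_iff forall_2)
    qed
  qed
  obtain g where g: "linear g" "g \<circ> blinfun_apply (f' q) = id"
    using linear_injective_left_inverse[OF _ inj]
    by (auto simp: blinfun.bounded_linear_right bounded_linear.linear)
  have "Blinfun g o\<^sub>L f' q = id_blinfun"
    by (rule blinfun_eqI)
      (use g in \<open>simp add: bounded_linear_Blinfun_apply linear_conv_bounded_linear[symmetric] fun_eq_iff\<close>)
  from inverse_function_theorem[OF V der cont q this]
  obtain V' D \<kappa> g' where "open V'" "V' \<subseteq> V" "q \<in> V'" "open D" "homeomorphism V' D T \<kappa>"
    "\<And>y. y \<in> D \<Longrightarrow> (\<kappa> has_derivative g' y) (at y)"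
    by metis
  then show thesis by (intro that[of V' D \<kappa>]) (auto simp: differentiable_def)
qed

lemma pd_compose_plane:
  fixes F :: "real ^ 2 \<Rightarrow> 'b::real_normed_vector" and T :: "real ^ 'n \<Rightarrow> real ^ 2"
  assumes "F differentiable at (T q)" "T differentiable at q"
  shows "pd j (\<lambda>q. F (T q)) q = pd j T q $ 1 *\<^sub>R pd 1 F (T q) + pd j T q $ 2 *\<^sub>R pd 2 F (T q)"
    "(\<lambda>q. F (T q)) differentiable at q"
proof -
  obtain T' where T': "(T has_derivative T') (at q)" using assms by (auto simp: differentiable_def)
  note d = has_derivative_compose[OF T' has_derivative_pd[OF assms(1)]]
  show "pd j (\<lambda>q. F (T q)) q = pd j T q $ 1 *\<^sub>R pd 1 F (T q) + pd j T q $ 2 *\<^sub>R pd 2 F (T q)"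
    using pd_eqI[OF d] pd_eqI[OF T'] by simp
  show "(\<lambda>q. F (T q)) differentiable at q" using d by (auto simp: differentiable_def)
qed

section \<open>Tangent planes of parametrized surfaces\<close>

lemma local_parametrizationD:
  assumes "local_parametrization S U X"
  shows "open U" "smooth_map_on U X" "openin (top_of_set S) (X ` U)" "X ` U \<subseteq> S"
    and "q \<in> U \<Longrightarrow> inj (frechet_derivative X (at q))"
    and "\<exists>Y. homeomorphism U (X ` U) X Y"
    and "q \<in> U \<Longrightarrow> X differentiable at q"
proof -
  show "openin (top_of_set S) (X ` U)" using assms by (simp add: local_parametrization_def)
  from openin_imp_subset[OF this] show "X ` U \<subseteq> S" .
  show o: "open U" and s: "smooth_map_on U X" using assms by (auto simp: local_parametrization_def)
  show "q \<in> U \<Longrightarrow> X differentiable at q"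
    using Ck_on_differentiable[of 0 U X q] o s unfolding smooth_map_on_def by blast
qed (use assms in \<open>auto simp: local_parametrization_def\<close>)

lemma local_parametrization_independent:
  assumes "local_parametrization S U X" "q \<in> U"
    and "a *\<^sub>R pd 1 X q + b *\<^sub>R pd 2 X q = 0"
  shows "a = 0" "b = 0"
proof -
  have X: "X differentiable at q" and inj: "inj (frechet_derivative X (at q))"
    using local_parametrizationD[OF assms(1)] assms(2) by auto
  have "frechet_derivative X (at q) = (\<lambda>v. v $ 1 *\<^sub>R pd 1 X q + v $ 2 *\<^sub>R pd 2 X q)"
    using frechet_derivative_at[OF has_derivative_pd[OF X]] by simp
  then have "frechet_derivative X (at q) (vector [a, b]) = frechet_derivative X (at q) 0"
    using assms(3) by simp
  then have "vector [a, b] = (0 :: real ^ 2)" using inj by (metis injD)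
  then show "a = 0" "b = 0" by (metis vector_2 zero_index)+
qed

text \<open>The velocity of a curve lying in a surface is tangent to it: by injectivity of the derivative,
  the parameters of \<open>\<gamma> t\<close> converge at rate \<open>O(t)\<close>, while the normal component of a displacement along
  the surface is of smaller order.\<close>

lemma curve_velocity_orthogonal:
  fixes \<gamma> :: "real \<Rightarrow> real ^ 3"
  assumes X: "local_parametrization S U X" and q: "q \<in> U"
    and n: "\<And>i. pd i X q \<bullet> n = 0"
    and \<gamma>0: "\<gamma> 0 = X q" and \<gamma>: "(\<gamma> has_vector_derivative v) (at 0)"
    and S: "\<forall>\<^sub>F t in at 0. \<gamma> t \<in> S"
  shows "v \<bullet> n = 0"
proof -
  note lp = local_parametrizationD[OF X]
  obtain g where g: "homeomorphism U (X ` U) X g" using lp(6) by blast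
  define D where "D = frechet_derivative X (at q)"
  have D: "(X has_derivative D) (at q)" unfolding D_def
    using lp(7)[OF q] frechet_derivative_works by blast
  have "D = (\<lambda>v. v $ 1 *\<^sub>R pd 1 X q + v $ 2 *\<^sub>R pd 2 X q)"
    unfolding D_def using frechet_derivative_at[OF has_derivative_pd[OF lp(7)[OF q]]] by simp
  then have Dn: "D w \<bullet> n = 0" for w using n by (simp add: inner_add_left)
  have blD: "bounded_linear D" using D by (rule has_derivative_bounded_linear)
  have "inj D" using lp(5)[OF q] by (simp add: D_def)
  then obtain B where B: "B > 0" "\<And>x. B * norm x \<le> norm (D x)"
    using linear_inj_bounded_below_pos[of D] bounded_linear.linear[OF blD] by blast
  have cont\<gamma>: "(\<gamma> \<longlongrightarrow> X q) (at 0)"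
    using has_vector_derivative_continuous[OF \<gamma>] \<gamma>0 by (simp add: continuous_at)
  \<comment> \<open>The image of the chart is open in \<open>S\<close>, so for small t the curve
    stays in it and has parameters \<open>g (\<gamma> t)\<close> tending to q.\<close>
  obtain W where W: "open W" "X ` U = S \<inter> W" using lp(3) by (auto simp: openin_open)
  have XqW: "X q \<in> W" using W q by blast
  have evU: "\<forall>\<^sub>F t in at 0. \<gamma> t \<in> X ` U"
    unfolding W(2) using eventually_conj[OF S topological_tendstoD[OF cont\<gamma> W(1) XqW]] by simp
  have gX: "g (X q) = q" using g q by (auto simp: homeomorphism_def)
  have "((\<lambda>t. g (\<gamma> t)) \<longlongrightarrow> g (X q)) (at 0)"
    by (rule continuous_on_tendsto_compose[OF _ cont\<gamma> _ evU])
      (use g q in \<open>auto simp: homeomorphism_def\<close>)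
  then have g\<gamma>: "((\<lambda>t. g (\<gamma> t)) \<longlongrightarrow> q) (at 0)" using gX by simp
  have key: "\<forall>\<^sub>F t in at 0. \<bar>(\<gamma> t - \<gamma> 0) \<bullet> n\<bar> \<le> e * norm (\<gamma> t - \<gamma> 0)" if e: "e > 0" for e
  proof -
    \<comment> \<open>The bound B / 2 lets half of the lower bound \<open>B * norm (y - q)\<close>
      absorb the remainder; the second bound then leaves at most e times the displacement for the
      normal component.\<close>
    define e' where "e' = min (B / 2) (e * B / (2 * (norm n + 1)))"
    have n1: "norm n + 1 > 0" by (simp add: add_nonneg_pos)
    then have e': "e' > 0" using B e by (simp add: e'_def)
    obtain d where d: "d > 0" "\<And>y. norm (y - q) < d \<Longrightarrow> norm (X y - X q - D (y - q)) \<le> e' * norm (y - q)"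
      using D e' unfolding has_derivative_at_alt by blast
    have "\<forall>\<^sub>F t in at 0. dist (g (\<gamma> t)) q < d" using tendstoD[OF g\<gamma> d(1)] .
    with evU show ?thesis
    proof eventually_elim
      case (elim t)
      define y where "y = g (\<gamma> t)"
      have Xy: "X y = \<gamma> t" using g elim(1) unfolding y_def homeomorphism_def by blast
      have r: "norm (X y - X q - D (y - q)) \<le> e' * norm (y - q)"
        using d(2) elim(2) by (simp add: y_def dist_norm)
      have "B * norm (y - q) \<le> norm (D (y - q))" by (rule B)
      also have "\<dots> \<le> norm (X y - X q) + norm (X y - X q - D (y - q))"
        by (metis norm_triangle_sub norm_minus_commute)
      also have "\<dots> \<le> norm (X y - X q) + B / 2 * norm (y - q)"
      proof -
        have "e' \<le> B / 2" unfolding e'_def by (rule min.cobounded1)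
        then have "e' * norm (y - q) \<le> B / 2 * norm (y - q)" by (rule mult_right_mono) simp
        with r show ?thesis by linarith
      qed
      finally have yq: "B / 2 * norm (y - q) \<le> norm (X y - X q)" by simp
      have "(X y - X q) \<bullet> n = (X y - X q - D (y - q)) \<bullet> n"
        using Dn by (simp add: inner_diff_left)
      then have "\<bar>(X y - X q) \<bullet> n\<bar> \<le> norm (X y - X q - D (y - q)) * norm n"
        using Cauchy_Schwarz_ineq2 by metis
      also have "\<dots> \<le> (e' * norm (y - q)) * (norm n + 1)"
        using r e' by (intro mult_mono) auto
      also have "\<dots> \<le> (e * B / (2 * (norm n + 1)) * norm (y - q)) * (norm n + 1)"
        using n1 by (intro mult_right_mono) (auto simp: e'_def)
      also have "\<dots> = e * (B / 2 * norm (y - q))" using n1 by (simp add: field_simps)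
      also have "\<dots> \<le> e * norm (X y - X q)" using yq e by (intro mult_left_mono) auto
      finally show ?case using Xy \<gamma>0 by simp
    qed
  qed
  have lim: "((\<lambda>t. (\<gamma> t - \<gamma> 0) /\<^sub>R t) \<longlongrightarrow> v) (at 0)"
  proof -
    have "((\<lambda>t. norm ((\<gamma> t - \<gamma> 0 - t *\<^sub>R v) /\<^sub>R t)) \<longlongrightarrow> 0) (at 0)"
      using \<gamma> by (simp add: has_vector_derivative_def has_derivative_at divide_inverse mult.commute)
    then have "((\<lambda>t. (\<gamma> t - \<gamma> 0 - t *\<^sub>R v) /\<^sub>R t + v) \<longlongrightarrow> 0 + v) (at 0)"
      by (intro tendsto_add tendsto_const) (rule tendsto_norm_zero_cancel)
    moreover have "\<forall>\<^sub>F t in at 0. (\<gamma> t - \<gamma> 0 - t *\<^sub>R v) /\<^sub>R t + v = (\<gamma> t - \<gamma> 0) /\<^sub>R t"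
      by (rule eventually_at_filter[THEN iffD2]) (simp add: scaleR_diff_right)
    ultimately show ?thesis by (simp add: Lim_transform_eventually)
  qed
  have "\<bar>v \<bullet> n\<bar> \<le> 0 + e" if e: "e > 0" for e
  proof -
    define e' where "e' = e / (norm v + 1)"
    have v1: "norm v + 1 > 0" by (simp add: add_nonneg_pos)
    then have e': "e' > 0" using e by (simp add: e'_def)
    have "\<bar>v \<bullet> n\<bar> \<le> e' * norm v"
    proof (rule tendsto_le[OF _ tendsto_mult[OF tendsto_const tendsto_norm[OF lim]]
          tendsto_rabs[OF tendsto_inner[OF lim tendsto_const]]])
      show "\<forall>\<^sub>F t in at 0. \<bar>((\<gamma> t - \<gamma> 0) /\<^sub>R t) \<bullet> n\<bar> \<le> e' * norm ((\<gamma> t - \<gamma> 0) /\<^sub>R t)"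
        using key[OF e']
        by eventually_elim (auto simp: abs_mult mult_left_mono mult.left_commute[of e'])
    qed simp
    also have "\<dots> \<le> e" using v1 e unfolding e'_def by (simp add: field_simps)
    finally show ?thesis by simp
  qed
  then have "\<bar>v \<bullet> n\<bar> \<le> 0" by (rule field_le_epsilon)
  then show ?thesis by simp
qed

section \<open>Surfaces given by their support function\<close>

text \<open>The point of the meridian plane of longitude \<phi> with radial coordinate a, which may
  be negative, and height b. \<open>revolve 1 0 \<phi>\<close>, \<open>revolve 0 1 \<phi>\<close>
  and \<open>e_phi \<phi>\<close> form an orthonormal frame, so inner products do not involve
  \<phi>.\<close>

definition revolve :: "real \<Rightarrow> real \<Rightarrow> real \<Rightarrow> real ^ 3" where
  "revolve a b \<phi> = vector [a * cos \<phi>, a * sin \<phi>, b]"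

definition e_phi :: "real \<Rightarrow> real ^ 3" where
  "e_phi \<phi> = vector [- sin \<phi>, cos \<phi>, 0]"

lemma revolve_nth [simp]:
  "revolve a b \<phi> $ 1 = a * cos \<phi>" "revolve a b \<phi> $ 2 = a * sin \<phi>" "revolve a b \<phi> $ 3 = b"
  "e_phi \<phi> $ 1 = - sin \<phi>" "e_phi \<phi> $ 2 = cos \<phi>" "e_phi \<phi> $ 3 = 0"
  by (simp_all add: revolve_def e_phi_def)

lemma inner_revolve [simp]:
  "revolve a b \<phi> \<bullet> revolve c d \<phi> = a * c + b * d"
  "revolve a b \<phi> \<bullet> e_phi \<phi> = 0" "e_phi \<phi> \<bullet> revolve a b \<phi> = 0"
  "e_phi \<phi> \<bullet> e_phi \<phi> = 1"
proof -
  have "a * cos \<phi> * (c * cos \<phi>) + a * sin \<phi> * (c * sin \<phi>) = a * c * ((cos \<phi>)\<^sup>2 + (sin \<phi>)\<^sup>2)"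
    by algebra
  then show "revolve a b \<phi> \<bullet> revolve c d \<phi> = a * c + b * d"
    by (simp add: inner_vec_def sum_3)
  have "sin \<phi> * sin \<phi> + cos \<phi> * cos \<phi> = 1"
    using sin_cos_squared_add[of \<phi>] by (simp add: power2_eq_square)
  then show "e_phi \<phi> \<bullet> e_phi \<phi> = 1" by (simp add: inner_vec_def sum_3)
qed (simp_all add: inner_vec_def sum_3)

lemma scaleR_revolve: "r *\<^sub>R revolve a b \<phi> = revolve (r * a) (r * b) \<phi>"
  by (simp add: vec_eq_iff forall_3)

lemma revolve_expansion:
  assumes "p \<bullet> e_phi \<phi> = 0"
  shows "p = revolve (p \<bullet> revolve 1 0 \<phi>) (p $ 3) \<phi>"
proof -
  have e: "p $ 1 * sin \<phi> = p $ 2 * cos \<phi>" using assms by (simp add: inner_vec_def sum_3)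
  have s: "(sin \<phi>)\<^sup>2 + (cos \<phi>)\<^sup>2 = 1" by simp
  have "p $ 1 = (p $ 1 * cos \<phi> + p $ 2 * sin \<phi>) * cos \<phi>"
    "p $ 2 = (p $ 1 * cos \<phi> + p $ 2 * sin \<phi>) * sin \<phi>"
    using e s by algebra+
  then show ?thesis by (simp add: vec_eq_iff forall_3 inner_vec_def sum_3)
qed

lemma has_derivative_vector_3:
  assumes "(f has_derivative f') F" "(g has_derivative g') F" "(h has_derivative h') F"
  shows "((\<lambda>x. vector [f x, g x, h x] :: real ^ 3) has_derivative (\<lambda>v. vector [f' v, g' v, h' v])) F"
proof -
  have eq: "(vector [a, b, c] :: real ^ 3) = a *\<^sub>R axis 1 1 + b *\<^sub>R axis 2 1 + c *\<^sub>R axis 3 1" for a b c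
    by (simp add: vec_eq_iff forall_3 axis_def)
  show ?thesis unfolding eq
    by (intro has_derivative_add has_derivative_scaleR_left assms)
qed

lemma has_derivative_separated:
  fixes x :: "real ^ 2"
  assumes "(f has_real_derivative f') (at (x $ 1))" "(g has_real_derivative g') (at (x $ 2))"
  shows "((\<lambda>x. f (x $ 1) * g (x $ 2)) has_derivative (\<lambda>v. f (x $ 1) * (g' * v $ 2) + f' * v $ 1 * g (x $ 2))) (at x)"
proof -
  have c: "((\<lambda>x. x $ i) has_derivative (\<lambda>v. v $ i)) (at x)" for i
    by (rule bounded_linear_imp_has_derivative[OF bounded_linear_vec_nth])
  have "(f has_derivative (\<lambda>h. f' * h)) (at (x $ 1))" "(g has_derivative (\<lambda>h. g' * h)) (at (x $ 2))"
    using assms by (simp_all add: has_field_derivative_def)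
  from has_derivative_mult[OF has_derivative_compose[OF c this(1)] has_derivative_compose[OF c this(2)]]
  show ?thesis by simp
qed

lemma pd_revolve:
  fixes x :: "real ^ 2"
  assumes a: "(a has_real_derivative a') (at (x $ 1))" and b: "(b has_real_derivative b') (at (x $ 1))"
  shows "(\<lambda>x. revolve (a (x $ 1)) (b (x $ 1)) (x $ 2)) differentiable at x"
    and "pd 1 (\<lambda>x. revolve (a (x $ 1)) (b (x $ 1)) (x $ 2)) x = revolve a' b' (x $ 2)"
    and "pd 2 (\<lambda>x. revolve (a (x $ 1)) (b (x $ 1)) (x $ 2)) x = a (x $ 1) *\<^sub>R e_phi (x $ 2)"
proof -
  have c: "((\<lambda>x. x $ 1) has_derivative (\<lambda>v. v $ 1)) (at x)"
    by (rule bounded_linear_imp_has_derivative[OF bounded_linear_vec_nth])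
  have b': "(b has_derivative (\<lambda>h. b' * h)) (at (x $ 1))"
    using b by (simp add: has_field_derivative_def)
  note d = has_derivative_vector_3[OF has_derivative_separated[OF a DERIV_cos]
    has_derivative_separated[OF a DERIV_sin] has_derivative_compose[OF c b'], folded revolve_def]
  show "(\<lambda>x. revolve (a (x $ 1)) (b (x $ 1)) (x $ 2)) differentiable at x"
    using d by (auto simp: differentiable_def)
  show "pd 1 (\<lambda>x. revolve (a (x $ 1)) (b (x $ 1)) (x $ 2)) x = revolve a' b' (x $ 2)"
    "pd 2 (\<lambda>x. revolve (a (x $ 1)) (b (x $ 1)) (x $ 2)) x = a (x $ 1) *\<^sub>R e_phi (x $ 2)"
    unfolding pd_eqI[OF d] by (simp_all add: vec_eq_iff forall_3 axis_def)
qed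

text \<open>In the notation of the paper, \<open>sphere_chart (u\<^sub>1, u\<^sub>2)\<close> is the unit vector \<open>N\<close> with \<open>g = exp (u\<^sub>1 + i u\<^sub>2)\<close>.\<close>

definition sphere_chart :: "real ^ 2 \<Rightarrow> real ^ 3" where
  "sphere_chart x = revolve (1 / cosh (x $ 1)) (- tanh (x $ 1)) (x $ 2)"

definition sphere_chart1 :: "real ^ 2 \<Rightarrow> real ^ 3" where
  "sphere_chart1 x = revolve (- sinh (x $ 1) / (cosh (x $ 1))\<^sup>2) (- 1 / (cosh (x $ 1))\<^sup>2) (x $ 2)"

definition sphere_chart2 :: "real ^ 2 \<Rightarrow> real ^ 3" where
  "sphere_chart2 x = (1 / cosh (x $ 1)) *\<^sub>R e_phi (x $ 2)"

lemma pd_sphere_chart: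
  "sphere_chart differentiable at x" "pd 1 sphere_chart x = sphere_chart1 x"
  "pd 2 sphere_chart x = sphere_chart2 x"
proof -
  have c0: "cosh (x $ 1) \<noteq> (0::real)" by simp
  have 1: "((\<lambda>t. 1 / cosh t) has_real_derivative - sinh (x $ 1) / (cosh (x $ 1))\<^sup>2) (at (x $ 1))"
    by (auto intro!: derivative_eq_intros simp: power2_eq_square)
  have s: "(sinh (x $ 1))\<^sup>2 = (cosh (x $ 1))\<^sup>2 - 1" using cosh_square_eq[of "x $ 1"] by simp
  have "1 - (tanh (x $ 1))\<^sup>2 = 1 / (cosh (x $ 1))\<^sup>2"
    using c0 by (simp add: tanh_def power_divide s field_simps)
  then have 2: "((\<lambda>t. - tanh t) has_real_derivative - 1 / (cosh (x $ 1))\<^sup>2) (at (x $ 1))"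
    by (auto intro!: derivative_eq_intros)
  note r = pd_revolve[OF 1 2]
  show "sphere_chart differentiable at x" "pd 1 sphere_chart x = sphere_chart1 x"
    "pd 2 sphere_chart x = sphere_chart2 x"
    using r by (simp_all add: sphere_chart_def[abs_def] sphere_chart1_def sphere_chart2_def)
qed

text \<open>These are Mercator coordinates on the sphere: the partial derivatives are orthogonal and
  both of length 1 / cosh u1.\<close>

lemma inner_sphere_chart:
  "sphere_chart x \<bullet> sphere_chart x = 1" "sphere_chart1 x \<bullet> sphere_chart x = 0"
  "sphere_chart2 x \<bullet> sphere_chart x = 0" "sphere_chart1 x \<bullet> sphere_chart2 x = 0"
  "sphere_chart2 x \<bullet> sphere_chart1 x = 0"
  "sphere_chart1 x \<bullet> sphere_chart1 x = 1 / (cosh (x $ 1))\<^sup>2"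
  "sphere_chart2 x \<bullet> sphere_chart2 x = 1 / (cosh (x $ 1))\<^sup>2"
proof -
  have c0: "cosh (x $ 1) \<noteq> (0::real)" by simp
  have s: "(sinh (x $ 1))\<^sup>2 = (cosh (x $ 1))\<^sup>2 - 1" using cosh_square_eq[of "x $ 1"] by simp
  show "sphere_chart x \<bullet> sphere_chart x = 1"
    using c0 s by (simp add: sphere_chart_def tanh_def field_simps power2_eq_square[symmetric])
  show "sphere_chart1 x \<bullet> sphere_chart x = 0"
    using c0 by (simp add: sphere_chart_def sphere_chart1_def tanh_def)
  show "sphere_chart1 x \<bullet> sphere_chart1 x = 1 / (cosh (x $ 1))\<^sup>2"
    using c0 s by (simp add: sphere_chart1_def field_simps power2_eq_square[symmetric])
  show "sphere_chart2 x \<bullet> sphere_chart2 x = 1 / (cosh (x $ 1))\<^sup>2"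
    by (simp add: sphere_chart2_def power2_eq_square)
qed (simp_all add: sphere_chart_def sphere_chart1_def sphere_chart2_def)

lemma sphere_chart_independent:
  assumes "a *\<^sub>R sphere_chart1 x + b *\<^sub>R sphere_chart2 x = 0"
  shows "a = 0" "b = 0"
proof -
  have c0: "cosh (x $ 1) \<noteq> (0::real)" by simp
  have "(a *\<^sub>R sphere_chart1 x + b *\<^sub>R sphere_chart2 x) \<bullet> sphere_chart1 x = 0"
    "(a *\<^sub>R sphere_chart1 x + b *\<^sub>R sphere_chart2 x) \<bullet> sphere_chart2 x = 0" using assms by simp_all
  then show "a = 0" "b = 0" using c0 by (simp_all add: inner_add_left inner_sphere_chart)
qed

text \<open>The principal radii of curvature along the meridian and the parallel of the surface with support
  function \<open>\<psi>\<close>, at the values \<open>p, p1, p2\<close> of \<open>\<psi>, \<psi>', \<psi>''\<close>.\<close>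

definition radius1 :: "real \<Rightarrow> real \<Rightarrow> real \<Rightarrow> real \<Rightarrow> real" where
  "radius1 p p1 p2 t = p + p2 * (cosh t)\<^sup>2 + p1 * sinh t * cosh t"

definition radius2 :: "real \<Rightarrow> real \<Rightarrow> real \<Rightarrow> real" where
  "radius2 p p1 t = p - p1 * sinh t * cosh t"

text \<open>The surface with Gauss map \<open>sphere_chart\<close> and support function \<open>\<psi> (u\<^sub>1)\<close>; \<open>\<psi>1\<close> stands for the
  derivative of \<open>\<psi>\<close>.\<close>

definition support_param :: "(real \<Rightarrow> real) \<Rightarrow> (real \<Rightarrow> real) \<Rightarrow> real ^ 2 \<Rightarrow> real ^ 3" where
  "support_param \<psi> \<psi>1 x = revolve (\<psi> (x $ 1) / cosh (x $ 1) - \<psi>1 (x $ 1) * sinh (x $ 1))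
     (- \<psi> (x $ 1) * tanh (x $ 1) - \<psi>1 (x $ 1)) (x $ 2)"

text \<open>The coordinate curves are lines of curvature. By Rodrigues' formula each partial
  derivative of the surface is a multiple of the same partial derivative of the normal, the factor
  being the principal radius.\<close>

lemma pd_support_param:
  assumes \<psi>: "(\<psi> has_real_derivative \<psi>1 (x $ 1)) (at (x $ 1))"
    and \<psi>1: "(\<psi>1 has_real_derivative p2) (at (x $ 1))"
  shows "support_param \<psi> \<psi>1 differentiable at x"
    and "pd 1 (support_param \<psi> \<psi>1) x = radius1 (\<psi> (x $ 1)) (\<psi>1 (x $ 1)) p2 (x $ 1) *\<^sub>R sphere_chart1 x"
    and "pd 2 (support_param \<psi> \<psi>1) x = radius2 (\<psi> (x $ 1)) (\<psi>1 (x $ 1)) (x $ 1) *\<^sub>R sphere_chart2 x"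
proof -
  define t where "t = x $ 1"
  define w where "w = radius1 (\<psi> t) (\<psi>1 t) p2 t"
  have c0: "cosh t \<noteq> (0::real)" by simp
  have s: "(sinh t)\<^sup>2 = (cosh t)\<^sup>2 - 1" using cosh_square_eq[of t] by simp
  have "(\<psi>1 t * cosh t - \<psi> t * sinh t) / (cosh t * cosh t) - (p2 * sinh t + \<psi>1 t * cosh t)
    = - (w * sinh t / (cosh t)\<^sup>2)"
    using c0 s unfolding w_def radius1_def by (simp add: field_simps) algebra
  then have 1: "((\<lambda>t. \<psi> t / cosh t - \<psi>1 t * sinh t) has_real_derivative - (w * sinh t / (cosh t)\<^sup>2)) (at t)"
    using \<psi> \<psi>1 unfolding t_def[symmetric]
    by (auto intro!: derivative_eq_intros simp: mult.commute)
  have "1 - (tanh t)\<^sup>2 = 1 / (cosh t)\<^sup>2"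
    using c0 by (simp add: tanh_def power_divide s field_simps)
  moreover have "w / (cosh t)\<^sup>2 = \<psi> t * (1 / (cosh t)\<^sup>2) + p2 + \<psi>1 t * tanh t"
    using c0 unfolding w_def radius1_def by (simp add: field_simps tanh_def power2_eq_square)
  ultimately have w: "- (\<psi>1 t * tanh t + (1 - (tanh t)\<^sup>2) * \<psi> t) - p2 = - (w / (cosh t)\<^sup>2)"
    by simp
  have 2: "((\<lambda>t. - \<psi> t * tanh t - \<psi>1 t) has_real_derivative - (w / (cosh t)\<^sup>2)) (at t)"
    unfolding w[symmetric] using \<psi> \<psi>1 unfolding t_def[symmetric]
    by (auto intro!: derivative_eq_intros)
  note r = pd_revolve[OF 1[unfolded t_def] 2[unfolded t_def], folded support_param_def]
  show "support_param \<psi> \<psi>1 differentiable at x" using r(1) by (simp add: support_param_def[abs_def])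
  show "pd 1 (support_param \<psi> \<psi>1) x = radius1 (\<psi> (x $ 1)) (\<psi>1 (x $ 1)) p2 (x $ 1) *\<^sub>R sphere_chart1 x"
    using r(2) by (simp add: support_param_def[abs_def] sphere_chart1_def scaleR_revolve w_def t_def)
  have "\<psi> t / cosh t - \<psi>1 t * sinh t = radius2 (\<psi> t) (\<psi>1 t) t / cosh t"
    using c0 by (simp add: radius2_def field_simps)
  then show "pd 2 (support_param \<psi> \<psi>1) x = radius2 (\<psi> (x $ 1)) (\<psi>1 (x $ 1)) (x $ 1) *\<^sub>R sphere_chart2 x"
    using r(3) by (simp add: support_param_def[abs_def] sphere_chart2_def t_def)
qed

text \<open>The position vector is the support function times the normal plus the gradient of the
  support function on the sphere. The sphere's metric is the plane one divided by cosh^2, whence the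
  factor in the squared gradient.\<close>

lemma support_param_inner:
  "support_param \<psi> \<psi>1 x \<bullet> sphere_chart x = \<psi> (x $ 1)"
  "support_param \<psi> \<psi>1 x \<bullet> sphere_chart1 x = \<psi>1 (x $ 1)"
  "support_param \<psi> \<psi>1 x \<bullet> support_param \<psi> \<psi>1 x = (\<psi> (x $ 1))\<^sup>2 + (\<psi>1 (x $ 1))\<^sup>2 * (cosh (x $ 1))\<^sup>2"
proof -
  have c0: "cosh (x $ 1) \<noteq> (0::real)" by simp
  have s: "(sinh (x $ 1))\<^sup>2 = (cosh (x $ 1))\<^sup>2 - 1" using cosh_square_eq[of "x $ 1"] by simp
  show "support_param \<psi> \<psi>1 x \<bullet> sphere_chart x = \<psi> (x $ 1)"
    "support_param \<psi> \<psi>1 x \<bullet> sphere_chart1 x = \<psi>1 (x $ 1)"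
    "support_param \<psi> \<psi>1 x \<bullet> support_param \<psi> \<psi>1 x = (\<psi> (x $ 1))\<^sup>2 + (\<psi>1 (x $ 1))\<^sup>2 * (cosh (x $ 1))\<^sup>2"
    using c0 s unfolding support_param_def sphere_chart_def sphere_chart1_def inner_revolve tanh_def
    by (simp_all add: field_simps) algebra+
qed

text \<open>A surface is recovered from its normal and its support function: the components along
  the normal and its u1-derivative form a linear system for the radial coordinate and the
  height.\<close>

lemma eq_support_param:
  assumes "p \<bullet> sphere_chart x = \<psi> (x $ 1)" "p \<bullet> sphere_chart1 x = \<psi>1 (x $ 1)" "p \<bullet> e_phi (x $ 2) = 0"
  shows "p = support_param \<psi> \<psi>1 x"
proof -
  define t where "t = x $ 1"
  define a where "a = p \<bullet> revolve 1 0 (x $ 2)"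
  have p: "p = revolve a (p $ 3) (x $ 2)" using revolve_expansion[OF assms(3)] by (simp add: a_def)
  have c0: "cosh t \<noteq> (0::real)" by simp
  have s: "(sinh t)\<^sup>2 = (cosh t)\<^sup>2 - 1" using cosh_square_eq[of t] by simp
  have e: "a * (1 / cosh t) + p $ 3 * (- tanh t) = \<psi> t"
    "a * (- sinh t / (cosh t)\<^sup>2) + p $ 3 * (- 1 / (cosh t)\<^sup>2) = \<psi>1 t"
  proof -
    have "p \<bullet> v = revolve a (p $ 3) (x $ 2) \<bullet> v" for v using p by simp
    with assms(1,2) have "revolve a (p $ 3) (x $ 2) \<bullet> sphere_chart x = \<psi> (x $ 1)"
      "revolve a (p $ 3) (x $ 2) \<bullet> sphere_chart1 x = \<psi>1 (x $ 1)" by metis+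
    then show "a * (1 / cosh t) + p $ 3 * (- tanh t) = \<psi> t"
      "a * (- sinh t / (cosh t)\<^sup>2) + p $ 3 * (- 1 / (cosh t)\<^sup>2) = \<psi>1 t"
      by (simp_all only: sphere_chart_def sphere_chart1_def inner_revolve t_def)
  qed
  have e': "a - p $ 3 * sinh t = \<psi> t * cosh t" "- a * sinh t - p $ 3 = \<psi>1 t * (cosh t)\<^sup>2"
    using e c0 by (simp_all add: tanh_def field_simps)
  \<comment> \<open>Eliminating with cosh^2 - sinh^2 = 1 yields the two solutions with an additional
    factor cosh, cancelled next.\<close>
  have "cosh t * (a * cosh t + cosh t * (sinh t * \<psi>1 t) - \<psi> t) = 0"
    "cosh t * (cosh t * \<psi>1 t + cosh t * p $ 3 + sinh t * \<psi> t) = 0"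
    using e' s by algebra+
  then have "a * cosh t + cosh t * (sinh t * \<psi>1 t) = \<psi> t"
    "cosh t * \<psi>1 t + cosh t * p $ 3 = - (sinh t * \<psi> t)"
    using c0 by simp_all
  then have "a = \<psi> t / cosh t - \<psi>1 t * sinh t" "p $ 3 = - \<psi> t * tanh t - \<psi>1 t"
    using c0 by (simp_all add: tanh_def field_simps)
  then show ?thesis unfolding support_param_def t_def[symmetric] using p by simp
qed

section \<open>Curvature and the third fundamental form\<close>

lemma shape_matrix_eqI:
  assumes X: "local_parametrization S U X" and q: "q \<in> U"
    and A: "\<And>j. - pd j (N \<circ> X) q = (\<Sum>i\<in>UNIV. (A $ i $ j) *\<^sub>R pd i X q)"
  shows "shape_matrix N X q = A"
  unfolding shape_matrix_def
proof (rule the_equality)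
  fix B assume B: "\<forall>j. - pd j (N \<circ> X) q = (\<Sum>i\<in>UNIV. (B $ i $ j) *\<^sub>R pd i X q)"
  have "B $ 1 $ j = A $ 1 $ j \<and> B $ 2 $ j = A $ 2 $ j" for j
  proof -
    have "(\<Sum>i\<in>UNIV. (B $ i $ j) *\<^sub>R pd i X q) = (\<Sum>i\<in>UNIV. (A $ i $ j) *\<^sub>R pd i X q)"
      using A[of j] B by metis
    then have "(B $ 1 $ j - A $ 1 $ j) *\<^sub>R pd 1 X q + (B $ 2 $ j - A $ 2 $ j) *\<^sub>R pd 2 X q = 0"
      by (simp add: sum_2 algebra_simps)
    from local_parametrization_independent[OF X q this] show ?thesis by simp
  qed
  then show "B = A" by (simp add: vec_eq_iff forall_2)
qed (use A in auto)

lemma oriented_surfaceD: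
  assumes "oriented_surface S N" "local_parametrization S U X" "q \<in> U"
  shows "norm (N (X q)) = 1" "pd i X q \<bullet> N (X q) = 0" "smooth_map_on U (N \<circ> X)"
    "(N \<circ> X) differentiable at q" "pd i (N \<circ> X) q \<bullet> N (X q) = 0"
proof -
  show n1: "norm (N (X q)) = 1" and "pd i X q \<bullet> N (X q) = 0" and s: "smooth_map_on U (N \<circ> X)"
    using assms by (auto simp: oriented_surface_def)
  have U: "open U" using local_parametrizationD[OF assms(2)] by blast
  show d: "(N \<circ> X) differentiable at q"
    using Ck_on_differentiable[of 0 U "N \<circ> X" q] s U assms(3) unfolding smooth_map_on_def by blast
  have "(N \<circ> X) x \<bullet> (N \<circ> X) x = 1" if "x \<in> U" for x
    using that assms by (auto simp: oriented_surface_def dot_square_norm)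
  then have "pd i (\<lambda>x. (N \<circ> X) x \<bullet> (N \<circ> X) x) q = pd i (\<lambda>x. 1) q"
    by (rule pd_cong[OF U assms(3)])
  then have "pd i (\<lambda>x. (N \<circ> X) x \<bullet> (N \<circ> X) x) q = 0" by (simp only: pd_const)
  then show "pd i (N \<circ> X) q \<bullet> N (X q) = 0"
    unfolding pd_inner[OF d d] by (simp add: inner_commute)
qed

text \<open>Subtracting from w its projection to the span of a and b, found from the Gram matrix,
  leaves a vector d orthogonal to a, b and n. The cross product of a and b is a nonzero multiple of
  n; d is orthogonal to it and, by Lagrange's identity, also parallel to it.\<close>

lemma in_span_orthogonal_pair:
  fixes a b n w :: "real ^ 3"
  assumes n: "norm n = 1" and o: "a \<bullet> n = 0" "b \<bullet> n = 0" "w \<bullet> n = 0"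
    and ind: "\<And>x y. x *\<^sub>R a + y *\<^sub>R b = 0 \<Longrightarrow> x = 0 \<and> y = 0"
  shows "\<exists>x y. w = x *\<^sub>R a + y *\<^sub>R b"
proof -
  define g where "g = (a \<bullet> a) * (b \<bullet> b) - (a \<bullet> b)\<^sup>2"
  have "b \<noteq> 0" using ind[of 0 1] by auto
  have g: "g \<noteq> 0"
  proof
    assume "g = 0"
    \<comment> \<open>If the Gram determinant were 0, this combination would have length 0, and
      independence would give b = 0.\<close>
    define z where "z = (b \<bullet> b) *\<^sub>R a + (- (a \<bullet> b)) *\<^sub>R b"
    have "z \<bullet> z = (b \<bullet> b) * g"
      unfolding z_def g_def
      by (simp add: inner_diff_left inner_diff_right inner_commute[of b a] power2_eq_square algebra_simps)
    with \<open>g = 0\<close> have "z = 0" by simp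
    then have "b \<bullet> b = 0" using ind[of "b \<bullet> b" "- (a \<bullet> b)"] unfolding z_def by simp
    with \<open>b \<noteq> 0\<close> show False by simp
  qed
  define x where "x = ((w \<bullet> a) * (b \<bullet> b) - (w \<bullet> b) * (a \<bullet> b)) / g"
  define y where "y = ((w \<bullet> b) * (a \<bullet> a) - (w \<bullet> a) * (a \<bullet> b)) / g"
  define d where "d = w - (x *\<^sub>R a + y *\<^sub>R b)"
  have dot: "d \<bullet> a = w \<bullet> a - (x * (a \<bullet> a) + y * (a \<bullet> b))" "d \<bullet> b = w \<bullet> b - (x * (a \<bullet> b) + y * (b \<bullet> b))"
    by (simp_all add: d_def inner_diff_left inner_add_left inner_commute[of b a])
  have xg: "x * g = (w \<bullet> a) * (b \<bullet> b) - (w \<bullet> b) * (a \<bullet> b)" "y * g = (w \<bullet> b) * (a \<bullet> a) - (w \<bullet> a) * (a \<bullet> b)"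
    using g by (simp_all add: x_def y_def)
  have "(d \<bullet> a) * g = 0" "(d \<bullet> b) * g = 0"
    using xg g_def unfolding dot by algebra+
  then have da: "d \<bullet> a = 0" and db: "d \<bullet> b = 0" using g by simp_all
  have dn: "d \<bullet> n = 0" using o by (simp add: d_def inner_diff_left inner_add_left)
  define c where "c = cross3 a b"
  have c2: "c \<bullet> c = g" using norm_cross_dot[of a b]
    by (simp add: c_def g_def power2_norm_eq_inner[symmetric] power_mult_distrib)
  have "cross3 n c = 0" using o unfolding c_def Lagrange by (simp add: inner_commute)
  then have cn: "c = (n \<bullet> c) *\<^sub>R n"
    using Lagrange[of n n c] n by (simp add: dot_square_norm)
  have "d \<bullet> c = 0" using dn by (subst cn) simp
  moreover have "cross3 d c = 0" using da db unfolding c_def Lagrange by simp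
  ultimately have "(norm d * norm c)\<^sup>2 = 0" using norm_cross_dot[of d c] by simp
  moreover have "c \<noteq> 0" using c2 g by auto
  ultimately have "d = 0" by simp
  then show ?thesis unfolding d_def by (intro exI[of _ x] exI[of _ y]) simp
qed

text \<open>The derivatives of a unit normal are tangent to the surface, so a matrix as in the
  definite description exists; \<open>shape_matrix_eqI\<close> makes it the described one.\<close>

lemma shape_matrix:
  assumes N: "oriented_surface S N" and X: "local_parametrization S U X" and q: "q \<in> U"
  shows "- pd j (N \<circ> X) q = (\<Sum>i\<in>UNIV. (shape_matrix N X q $ i $ j) *\<^sub>R pd i X q)"
proof -
  note d = oriented_surfaceD[OF N X q]
  have "\<exists>x y. - pd j (N \<circ> X) q = x *\<^sub>R pd 1 X q + y *\<^sub>R pd 2 X q" for j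
    by (rule in_span_orthogonal_pair[OF d(1) d(2) d(2)])
      (use d(5) local_parametrization_independent[OF X q] in auto)
  then obtain x y where xy: "- pd j (N \<circ> X) q = x j *\<^sub>R pd 1 X q + y j *\<^sub>R pd 2 X q" for j
    by metis
  define A :: "real ^ 2 ^ 2" where "A = vector [vector [x 1, x 2], vector [y 1, y 2]]"
  have A: "- pd j (N \<circ> X) q = (\<Sum>i\<in>UNIV. (A $ i $ j) *\<^sub>R pd i X q)" for j
    unfolding xy using exhaust_2[of j] by (auto simp: sum_2 A_def)
  from shape_matrix_eqI[OF X q A] A show ?thesis by simp
qed

text \<open>The shape operator is invertible where its determinant is nonzero, so there the Gauss
  map is an immersion and can supply coordinates.\<close>

lemma gauss_image_independent:
  assumes N: "oriented_surface S N" and X: "local_parametrization S U X" and q: "q \<in> U"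
    and K: "gauss_curvature N X q \<noteq> 0"
    and "a *\<^sub>R pd 1 (N \<circ> X) q + b *\<^sub>R pd 2 (N \<circ> X) q = 0"
  shows "a = 0" "b = 0"
proof -
  define A where "A = shape_matrix N X q"
  have s: "- pd j (N \<circ> X) q = A $ 1 $ j *\<^sub>R pd 1 X q + A $ 2 $ j *\<^sub>R pd 2 X q" for j
    using shape_matrix[OF N X q] by (simp add: sum_2 A_def)
  have "a *\<^sub>R (- pd 1 (N \<circ> X) q) + b *\<^sub>R (- pd 2 (N \<circ> X) q) = 0"
    using assms(5) by (simp add: add_eq_0_iff)
  then have "(a * A $ 1 $ 1 + b * A $ 1 $ 2) *\<^sub>R pd 1 X q + (a * A $ 2 $ 1 + b * A $ 2 $ 2) *\<^sub>R pd 2 X q = 0"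
    unfolding s by (simp add: algebra_simps)
  note e = local_parametrization_independent[OF X q this]
  have det: "A $ 1 $ 1 * A $ 2 $ 2 - A $ 1 $ 2 * A $ 2 $ 1 \<noteq> 0"
    using K by (simp add: gauss_curvature_def A_def det_2)
  have "a * (A $ 1 $ 1 * A $ 2 $ 2 - A $ 1 $ 2 * A $ 2 $ 1) = 0"
    "b * (A $ 1 $ 1 * A $ 2 $ 2 - A $ 1 $ 2 * A $ 2 $ 1) = 0" using e by algebra+
  then show "a = 0" "b = 0" using det by simp_all
qed

definition jacobian :: "(real ^ 2 \<Rightarrow> real ^ 2) \<Rightarrow> real ^ 2 \<Rightarrow> real" where
  "jacobian T q = pd 1 T q $ 1 * pd 2 T q $ 2 - pd 2 T q $ 1 * pd 1 T q $ 2"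

lemma pd_gauss_map:
  assumes V: "open V" "q \<in> V" and T: "T differentiable at q"
    and N: "\<And>x. x \<in> V \<Longrightarrow> N (X x) = \<sigma> *\<^sub>R sphere_chart (T x)"
  shows "pd j (N \<circ> X) q = \<sigma> *\<^sub>R (pd j T q $ 1 *\<^sub>R sphere_chart1 (T q) + pd j T q $ 2 *\<^sub>R sphere_chart2 (T q))"
proof -
  note c = pd_compose_plane[OF pd_sphere_chart(1) T]
  have "pd j (N \<circ> X) q = pd j (\<lambda>x. \<sigma> *\<^sub>R sphere_chart (T x)) q"
    by (rule pd_cong[OF V]) (simp add: N)
  also have "\<dots> = \<sigma> *\<^sub>R pd j (\<lambda>x. sphere_chart (T x)) q"
    by (rule pd_component[OF c(2) bounded_linear_scaleR_right])
  finally show ?thesis unfolding c(1) by (simp add: pd_sphere_chart)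
qed

text \<open>In the frame \<open>sphere_chart1\<close>, \<open>sphere_chart2\<close> the differential
  of N o X is \<sigma> T' and that of X is diag(W1, W2) T'. Hence the shape operator is conjugate to
  -\<sigma> diag(1/W1, 1/W2). Neither factor of the differential of X can be singular, because X is
  an immersion.\<close>

lemma curvature_support_param:
  assumes X: "local_parametrization S U X" and V: "open V" "V \<subseteq> U" "q \<in> V"
    and T: "T differentiable at q" and \<sigma>: "\<sigma> * \<sigma> = (1::real)"
    and N: "\<And>x. x \<in> V \<Longrightarrow> N (X x) = \<sigma> *\<^sub>R sphere_chart (T x)"
    and XT: "\<And>x. x \<in> V \<Longrightarrow> X x = support_param \<psi> \<psi>1 (T x)"
    and \<psi>: "(\<psi> has_real_derivative \<psi>1 (T q $ 1)) (at (T q $ 1))"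
      "(\<psi>1 has_real_derivative p2) (at (T q $ 1))"
  defines "W1 \<equiv> radius1 (\<psi> (T q $ 1)) (\<psi>1 (T q $ 1)) p2 (T q $ 1)"
    and "W2 \<equiv> radius2 (\<psi> (T q $ 1)) (\<psi>1 (T q $ 1)) (T q $ 1)"
  shows "jacobian T q \<noteq> 0" "W1 \<noteq> 0" "W2 \<noteq> 0"
    "mean_curvature N X q = - \<sigma> * (1 / W1 + 1 / W2) / 2" "gauss_curvature N X q = 1 / (W1 * W2)"
proof -
  define a where "a j = pd j T q $ 1" for j
  define b where "b j = pd j T q $ 2" for j
  define D where "D = jacobian T q"
  have D: "D = a 1 * b 2 - a 2 * b 1" by (simp add: D_def jacobian_def a_def b_def)
  have q: "q \<in> U" using V by blast
  have dN: "pd j (N \<circ> X) q = \<sigma> *\<^sub>R (a j *\<^sub>R sphere_chart1 (T q) + b j *\<^sub>R sphere_chart2 (T q))" for j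
    unfolding a_def b_def by (rule pd_gauss_map[where V=V and N=N and X=X, OF V(1,3) T N])
  have "pd j X q = pd j (\<lambda>x. support_param \<psi> \<psi>1 (T x)) q" for j
    by (rule pd_cong[OF V(1,3)]) (simp add: XT)
  then have dX: "pd j X q = a j *\<^sub>R W1 *\<^sub>R sphere_chart1 (T q) + b j *\<^sub>R W2 *\<^sub>R sphere_chart2 (T q)" for j
    using pd_support_param[where x="T q", OF \<psi>]
    by (simp add: pd_compose_plane(1)[OF _ T] a_def b_def W1_def W2_def)
  note ind = local_parametrization_independent[OF X q]
  have W1: "W1 \<noteq> 0"
  proof
    assume "W1 = 0"
    then have "b 2 *\<^sub>R pd 1 X q + (- b 1) *\<^sub>R pd 2 X q = 0" unfolding dX by simp
    from ind[OF this] have "pd 1 X q = 0" unfolding dX using \<open>W1 = 0\<close> by simp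
    then show False using ind[of 1 0] by simp
  qed
  have W2: "W2 \<noteq> 0"
  proof
    assume "W2 = 0"
    then have "a 2 *\<^sub>R pd 1 X q + (- a 1) *\<^sub>R pd 2 X q = 0" unfolding dX by simp
    from ind[OF this] have "pd 1 X q = 0" unfolding dX using \<open>W2 = 0\<close> by simp
    then show False using ind[of 1 0] by simp
  qed
  have D0: "D \<noteq> 0"
  proof
    assume "D = 0"
    have *: "b 2 *\<^sub>R pd 1 X q + (- b 1) *\<^sub>R pd 2 X q = (D * W1) *\<^sub>R sphere_chart1 (T q)"
      "a 2 *\<^sub>R pd 1 X q + (- a 1) *\<^sub>R pd 2 X q = (- D * W2) *\<^sub>R sphere_chart2 (T q)"
      unfolding dX D by (simp_all add: algebra_simps)
    have "b 1 = 0" "b 2 = 0" "a 1 = 0" "a 2 = 0"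
      using ind[of "b 2" "- b 1"] ind[of "a 2" "- a 1"] * \<open>D = 0\<close> by auto
    then have "pd 1 X q = 0" unfolding dX by simp
    then show False using ind[of 1 0] by simp
  qed
  define A where "A = shape_matrix N X q"
  \<comment> \<open>The product -\<sigma> T'^(-1) diag(1/W1, 1/W2) T'.\<close>
  define B :: "real ^ 2 ^ 2" where "B = (- \<sigma> / D) *\<^sub>R vector
     [vector [a 1 * b 2 / W1 - a 2 * b 1 / W2, a 2 * b 2 / W1 - a 2 * b 2 / W2],
      vector [a 1 * b 1 / W2 - a 1 * b 1 / W1, a 1 * b 2 / W2 - a 2 * b 1 / W1]]"
  have "shape_matrix N X q = B"
  proof (rule shape_matrix_eqI[OF X q])
    fix j
    have "\<sigma> * a j + (B $ 1 $ j * a 1 + B $ 2 $ j * a 2) * W1 = 0"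
      "\<sigma> * b j + (B $ 1 $ j * b 1 + B $ 2 $ j * b 2) * W2 = 0"
      using exhaust_2[of j] W1 W2 D0 unfolding B_def
      by (auto simp: field_simps) (auto simp: D algebra_simps)
    then have e: "- \<sigma> * a j = (B $ 1 $ j * a 1 + B $ 2 $ j * a 2) * W1"
      "- \<sigma> * b j = (B $ 1 $ j * b 1 + B $ 2 $ j * b 2) * W2" by simp_all
    have "- pd j (N \<circ> X) q = (- \<sigma> * a j) *\<^sub>R sphere_chart1 (T q) + (- \<sigma> * b j) *\<^sub>R sphere_chart2 (T q)"
      unfolding dN by (simp add: algebra_simps)
    also have "\<dots> = (\<Sum>i\<in>UNIV. (B $ i $ j) *\<^sub>R pd i X q)"
      unfolding e dX by (simp add: sum_2 algebra_simps)
    finally show "- pd j (N \<circ> X) q = (\<Sum>i\<in>UNIV. (B $ i $ j) *\<^sub>R pd i X q)" .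
  qed
  moreover have "trace B = - \<sigma> * (1 / W1 + 1 / W2)"
    using D0 W1 W2 unfolding trace_def sum_2 B_def by (simp add: field_simps) (simp add: D algebra_simps)
  moreover have "det B = 1 / (W1 * W2)"
  proof -
    have "det B * (D * D) = \<sigma> * \<sigma> * ((a 1 * b 2 / W1 - a 2 * b 1 / W2) * (a 1 * b 2 / W2 - a 2 * b 1 / W1)
      - (a 2 * b 2 / W1 - a 2 * b 2 / W2) * (a 1 * b 1 / W2 - a 1 * b 1 / W1))"
      using D0 unfolding det_2 B_def by (simp add: field_simps)
    also have "\<dots> = D * D / (W1 * W2)"
      using W1 W2 unfolding \<sigma> by (simp add: field_simps) (simp add: D algebra_simps power2_eq_square)
    finally have "det B * (D * D) = (1 / (W1 * W2)) * (D * D)" by simp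
    then show ?thesis using D0 mult_right_cancel[of "D * D" "det B" "1 / (W1 * W2)"] by simp
  qed
  ultimately show "mean_curvature N X q = - \<sigma> * (1 / W1 + 1 / W2) / 2"
    "gauss_curvature N X q = 1 / (W1 * W2)"
    by (simp_all add: mean_curvature_def gauss_curvature_def)
  show "jacobian T q \<noteq> 0" "W1 \<noteq> 0" "W2 \<noteq> 0" using D0 W1 W2 by (simp_all add: D_def)
qed

text \<open>Multiplying by W1 W2 turns the mean curvature into the sum of the radii, in which the
  first-order terms cancel. The sign \<sigma> survives only as a factor of c.\<close>

lemma HQSF_equation_support_param:
  fixes \<sigma> c m W1 W2 \<psi> \<psi>1 p2 t :: real
  assumes "\<sigma> * \<sigma> = 1" "W1 \<noteq> 0" "W2 \<noteq> 0"
    and "W1 = radius1 \<psi> \<psi>1 p2 t" "W2 = radius2 \<psi> \<psi>1 t"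
  shows "2 * (\<sigma> * \<psi>) * (- \<sigma> * (1 / W1 + 1 / W2) / 2)
      + (c * (\<sigma> * \<psi>) * m + (\<psi>\<^sup>2 + \<psi>1\<^sup>2 * (cosh t)\<^sup>2) - (\<sigma> * \<psi>)\<^sup>2) * (1 / (W1 * W2)) = 0
    \<longleftrightarrow> - \<psi> * (2 * \<psi> + p2 * (cosh t)\<^sup>2) + (\<sigma> * c) * \<psi> * m + \<psi>1\<^sup>2 * (cosh t)\<^sup>2 = 0" (is "?L = 0 \<longleftrightarrow> ?R = 0")
proof -
  have "?L * (W1 * W2) = - (\<sigma> * \<sigma>) * \<psi> * (W1 + W2) + \<sigma> * c * \<psi> * m + \<psi>\<^sup>2 + \<psi>1\<^sup>2 * (cosh t)\<^sup>2 - (\<sigma> * \<sigma>) * \<psi>\<^sup>2"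
    using assms(2,3) by (simp add: field_simps power2_eq_square)
  also have "W1 + W2 = 2 * \<psi> + p2 * (cosh t)\<^sup>2"
    using assms(4,5) by (simp add: radius1_def radius2_def)
  finally have "?L * (W1 * W2) = ?R" unfolding assms(1) by simp
  then show ?thesis using assms(2,3) by (metis mult_eq_0_iff mult_zero_left)
qed

section \<open>The Laplace-Beltrami operator of the third fundamental form\<close>

lemma matrix_inv_2:
  fixes a b c d :: real
  assumes "a * d - b * c \<noteq> 0"
  shows "matrix_inv (vector [vector [a, b], vector [c, d]] :: real ^ 2 ^ 2)
    = vector [vector [d / (a * d - b * c), - b / (a * d - b * c)],
        vector [- c / (a * d - b * c), a / (a * d - b * c)]]" (is "matrix_inv ?A = ?B")
proof -
  have "?A ** ?B = mat 1" "?B ** ?A = mat 1"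
    using assms by (simp_all add: vec_eq_iff forall_2 matrix_matrix_mult_def sum_2 mat_def
        diff_divide_distrib[symmetric] mult.commute)
  then have "?A ** matrix_inv ?A = mat 1 \<and> matrix_inv ?A ** ?A = mat 1"
    unfolding matrix_inv_def by (rule_tac someI[of _ ?B]) simp
  then have "matrix_inv ?A ** (?A ** ?B) = ?B" by (simp add: matrix_mul_assoc)
  with \<open>?A ** ?B = mat 1\<close> show ?thesis by simp
qed

lemma pd_component_plane:
  fixes T :: "real ^ 2 \<Rightarrow> real ^ 2"
  assumes "open V" "Ck_on 2 V T"
  shows "Ck_on 2 V (\<lambda>x. T x $ i)" "x \<in> V \<Longrightarrow> pd j (\<lambda>x. T x $ i) x = pd j T x $ i"
proof -
  show "Ck_on 2 V (\<lambda>x. T x $ i)"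
    by (rule Ck_on_bounded_linear[OF assms(1) bounded_linear_vec_nth assms(2)])
  show "x \<in> V \<Longrightarrow> pd j (\<lambda>x. T x $ i) x = pd j T x $ i"
    using pd_vec_nth Ck_on_differentiable[of 1 V T x] assms by (simp add: numeral_2_eq_2)
qed

lemma pd_pd_component:
  fixes T :: "real ^ 2 \<Rightarrow> real ^ 2"
  assumes V: "open V" "Ck_on 2 V T" "q \<in> V"
  shows "(\<lambda>x. pd j T x $ k) differentiable at q"
    and "pd i (\<lambda>x. pd j T x $ k) q = pd j (\<lambda>x. pd i T x $ k) q"
proof -
  have T2: "Ck_on (Suc (Suc 0)) V T" using V(2) by (simp only: numeral_2_eq_2)
  have "pd j T differentiable at q" using Ck_on_differentiable[OF Ck_on_pd[OF T2] V(1,3)] .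
  then show "(\<lambda>x. pd j T x $ k) differentiable at q"
    using bounded_linear.has_derivative[OF bounded_linear_vec_nth] unfolding differentiable_def by blast
  have e: "pd i (\<lambda>x. pd j T x $ k) q = pd i (pd j (\<lambda>x. T x $ k)) q" for i j
    by (rule pd_cong[OF V(1,3)]) (simp add: pd_component_plane(2)[OF V(1,2)])
  show "pd i (\<lambda>x. pd j T x $ k) q = pd j (\<lambda>x. pd i T x $ k) q"
    unfolding e by (rule pd_commute[OF V(1) pd_component_plane(1)[OF V(1,2)] V(3)])
qed

lemma continuous_on_jacobian:
  fixes T :: "real ^ 2 \<Rightarrow> real ^ 2"
  assumes "Ck_on 1 V T"
  shows "continuous_on V (jacobian T)"
proof -
  have c: "continuous_on V (pd i T)" for i using assms by simp
  show ?thesis unfolding jacobian_def[abs_def]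
    by (intro continuous_intros bounded_linear.continuous_on[OF bounded_linear_vec_nth] c)
qed

text \<open>In the coordinates T the metric is conformal to the plane and f has only a u1-derivative
  g. The flux is then, up to sign, g times the rotated gradient of u2, which is divergence free by
  the symmetry of second derivatives. So only derivatives of g remain.\<close>

lemma laplace_beltrami_third_form:
  fixes T :: "real ^ 2 \<Rightarrow> real ^ 2"
  assumes V: "open V" "q \<in> V" and T: "Ck_on 2 V T" and \<sigma>: "\<sigma> * \<sigma> = (1::real)"
    and N: "\<And>x. x \<in> V \<Longrightarrow> N (X x) = \<sigma> *\<^sub>R sphere_chart (T x)"
    and J: "jacobian T q \<noteq> 0"
    and f: "\<And>x j. x \<in> V \<Longrightarrow> pd j f x = g x * pd j T x $ 1" and g: "g differentiable at q"
  shows "laplace_beltrami (third_form N X) f q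
    = (pd 1 g q * pd 2 T q $ 2 - pd 2 g q * pd 1 T q $ 2) * (cosh (T q $ 1))\<^sup>2 / jacobian T q"
proof -
  define a where "a j x = pd j T x $ 1" for j x
  define b where "b j x = pd j T x $ 2" for j x
  define C where "C x = (cosh (T x $ 1))\<^sup>2" for x
  define J where "J x = jacobian T x" for x
  have Jeq: "J x = a 1 x * b 2 x - a 2 x * b 1 x" for x by (simp add: J_def jacobian_def a_def b_def)
  have C: "C x > 0" for x by (simp add: C_def)
  have dT: "T differentiable at x" if "x \<in> V" for x
    using Ck_on_differentiable[of 1 V T x] T V that by (simp add: numeral_2_eq_2)
  have cJ: "continuous_on V J" unfolding J_def[abs_def]
    using continuous_on_jacobian[of V T] Ck_on_mono[of 1 2 V T] T by simp
  define s where "s = sgn (J q)"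
  have s: "s * s = 1" "s * J q = \<bar>J q\<bar>" using J by (auto simp: s_def J_def sgn_if)
  \<comment> \<open>Where the Jacobian keeps the sign it has at q, the square root of the
    determinant is s J / C, without an absolute value.\<close>
  define V' where "V' = {x \<in> V. J x * s > 0}"
  have "V' = V \<inter> (\<lambda>x. J x * s) -` {0<..}" by (auto simp: V'_def)
  moreover have "continuous_on V (\<lambda>x. J x * s)" by (intro continuous_intros cJ)
  ultimately have oV': "open V'"
    using continuous_open_preimage[of V "\<lambda>x. J x * s" "{0<..}"] V(1) by simp
  have qV': "q \<in> V'" using J V s by (simp add: V'_def mult.commute J_def)
  have third: "third_form N X x = vector
      [vector [(a 1 x * a 1 x + b 1 x * b 1 x) / C x, (a 1 x * a 2 x + b 1 x * b 2 x) / C x],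
       vector [(a 1 x * a 2 x + b 1 x * b 2 x) / C x, (a 2 x * a 2 x + b 2 x * b 2 x) / C x]]"
    if x: "x \<in> V" for x
  proof -
    have dN: "pd j (N \<circ> X) x
        = \<sigma> *\<^sub>R (a j x *\<^sub>R sphere_chart1 (T x) + b j x *\<^sub>R sphere_chart2 (T x))" for j
      unfolding a_def b_def by (rule pd_gauss_map[where V=V and N=N and X=X, OF V(1) x dT[OF x] N])
    have "pd i (N \<circ> X) x \<bullet> pd j (N \<circ> X) x
        = (\<sigma> * \<sigma>) * ((a i x * a j x + b i x * b j x) / C x)" for i j
      unfolding dN by (simp add: inner_add_left inner_add_right inner_sphere_chart C_def
          add_divide_distrib algebra_simps)
    then show ?thesis using \<sigma>
      by (simp add: third_form_def vec_eq_iff forall_2 mult.commute)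
  qed
  define G where "G = third_form N X"
  have det: "det (G x) = (J x / C x)\<^sup>2" if x: "x \<in> V" for x
    unfolding G_def third[OF x] det_2 using C[of x]
    by (simp add: field_simps power2_eq_square) (simp add: Jeq algebra_simps)
  have sq: "sqrt (det (G x)) = s * J x / C x" if x: "x \<in> V'" for x
  proof -
    have "\<bar>J x\<bar> = s * J x" using x s(1) by (auto simp: V'_def s_def sgn_if split: if_splits)
    then show ?thesis using det x C[of x] by (simp add: V'_def real_sqrt_abs abs_divide)
  qed
  have flux: "sqrt (det (G x)) * (\<Sum>j\<in>UNIV. matrix_inv (G x) $ i $ j * pd j f x)
      = (if i = 1 then s * (g x * b 2 x) else (- s) * (g x * b 1 x))" if x: "x \<in> V'" for x i
  proof -
    have xV: "x \<in> V" and Jx: "J x \<noteq> 0" using x by (auto simp: V'_def)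
    have det': "(a 1 x * a 1 x + b 1 x * b 1 x) / C x * ((a 2 x * a 2 x + b 2 x * b 2 x) / C x)
      - (a 1 x * a 2 x + b 1 x * b 2 x) / C x * ((a 1 x * a 2 x + b 1 x * b 2 x) / C x) = (J x / C x)\<^sup>2"
      using det[OF xV] unfolding G_def third[OF xV] det_2 by simp
    have ne: "(J x / C x)\<^sup>2 \<noteq> 0" using Jx C[of x] by simp
    note inv = matrix_inv_2[of "(a 1 x * a 1 x + b 1 x * b 1 x) / C x"
        "(a 2 x * a 2 x + b 2 x * b 2 x) / C x" "(a 1 x * a 2 x + b 1 x * b 2 x) / C x"
        "(a 1 x * a 2 x + b 1 x * b 2 x) / C x", unfolded det', OF ne, folded third[OF xV] G_def]
    have p: "pd 1 f x = g x * a 1 x" "pd 2 f x = g x * a 2 x" using f[OF xV] by (simp_all add: a_def)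
    have e1: "(a 2 x * a 2 x + b 2 x * b 2 x) * a 1 x - (a 1 x * a 2 x + b 1 x * b 2 x) * a 2 x = J x * b 2 x"
      "(a 1 x * a 1 x + b 1 x * b 1 x) * a 2 x - (a 1 x * a 2 x + b 1 x * b 2 x) * a 1 x = - (J x * b 1 x)"
      unfolding Jeq by algebra+
    have "(\<Sum>j\<in>UNIV. matrix_inv (G x) $ i $ j * pd j f x)
      = (if i = 1 then C x / (J x * J x) * (g x * ((a 2 x * a 2 x + b 2 x * b 2 x) * a 1 x - (a 1 x * a 2 x + b 1 x * b 2 x) * a 2 x))
         else C x / (J x * J x) * (g x * ((a 1 x * a 1 x + b 1 x * b 1 x) * a 2 x - (a 1 x * a 2 x + b 1 x * b 2 x) * a 1 x)))"
      using exhaust_2[of i] Jx C[of x] unfolding sum_2 inv p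
      by (auto simp: field_simps power2_eq_square)
    then show ?thesis unfolding sq[OF x] e1 using Jx C[of x] by (simp add: field_simps)
  qed
  note d = pd_pd_component[OF V(1) T V(2)]
  have dgb: "(\<lambda>x. g x * b j x) differentiable at q" for j
    unfolding b_def by (intro differentiable_mult g d(1))
  have pdb: "pd i (\<lambda>x. r * (g x * b j x)) q = r * (g q * pd i (b j) q + pd i g q * b j q)" for i j r
  proof -
    have "pd i (\<lambda>x. r * (g x * b j x)) q = r * pd i (\<lambda>x. g x * b j x) q"
      by (rule pd_component[OF dgb bounded_linear_mult_right])
    also have "pd i (\<lambda>x. g x * b j x) q = g q * pd i (b j) q + pd i g q * b j q"
      using pd_mult[OF g d(1)] by (simp add: b_def[abs_def])
    finally show ?thesis .
  qed
  have "laplace_beltrami G f q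
      = (pd 1 (\<lambda>x. s * (g x * b 2 x)) q + pd 2 (\<lambda>x. (- s) * (g x * b 1 x)) q) / sqrt (det (G q))"
    unfolding laplace_beltrami_def sum_2
    using pd_cong[OF oV' qV' flux] by (simp add: sum_2)
  \<comment> \<open>The mixed second derivatives of u2 cancel.\<close>
  also have "\<dots> = s * (pd 1 g q * b 2 q - pd 2 g q * b 1 q) / (s * J q / C q)"
    unfolding pdb sq[OF qV'] using d(2)[of 1 2 2] by (simp add: b_def[abs_def] algebra_simps)
  also have "\<dots> = (pd 1 g q * b 2 q - pd 2 g q * b 1 q) * C q / J q"
  proof -
    have "s = 1 \<or> s = - 1" using J by (auto simp: s_def J_def sgn_if)
    then show ?thesis using J C[of q] by (auto simp: J_def field_simps)
  qed
  finally show ?thesis by (simp add: G_def b_def C_def J_def)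
qed

section \<open>Gauss coordinates away from the poles of the sphere\<close>

lemma tanh_artanh:
  fixes x :: real
  assumes "\<bar>x\<bar> < 1"
  shows "tanh (artanh x) = x"
proof -
  define y where "y = sqrt ((1 + x) / (1 - x))"
  have pos: "(1 + x) / (1 - x) > 0" using assms by (auto simp: abs_less_iff)
  then have y: "y > 0" "y\<^sup>2 = (1 + x) / (1 - x)" by (simp_all add: y_def)
  have "artanh x = ln y" using pos by (simp add: artanh_def y_def ln_sqrt)
  then have "tanh (artanh x) = (y\<^sup>2 - 1) / (y\<^sup>2 + 1)" using tanh_ln_real[OF y(1)] by simp
  also have "\<dots> = x" unfolding y(2) using assms by (simp add: field_simps)
  finally show ?thesis .
qed

text \<open>Away from the poles the sphere carries the coordinates \<open>u\<^sub>1 = - artanh N\<^sub>3\<close> and \<open>u\<^sub>2\<close>, the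
  longitude, which near the meridian \<open>\<phi>\<close> is \<open>\<phi>\<close> plus an arctangent.\<close>

lemma sphere_chart_lift:
  fixes \<nu> :: "real ^ 2 \<Rightarrow> real ^ 3"
  assumes U: "open U" and \<nu>: "smooth_map_on U \<nu>" and q: "q \<in> U"
    and n1: "\<And>x. x \<in> U \<Longrightarrow> norm (\<nu> x) = 1" and np: "(\<nu> q $ 1, \<nu> q $ 2) \<noteq> (0, 0)"
  obtains V T where "open V" "q \<in> V" "V \<subseteq> U" "Ck_on 2 V T" "\<And>x. x \<in> V \<Longrightarrow> \<nu> x = sphere_chart (T x)"
proof -
  obtain r \<phi> where r: "\<nu> q $ 1 = r * cos \<phi>" "\<nu> q $ 2 = r * sin \<phi>" using polar_Ex by metis
  \<comment> \<open>\<open>polar_Ex\<close> leaves the sign of r open. Adding a half turn for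
    negative r makes \<phi>' the true longitude.\<close>
  define \<phi>' where "\<phi>' = (if r > 0 then \<phi> else \<phi> + pi)"
  have r': "\<nu> q $ 1 = \<bar>r\<bar> * cos \<phi>'" "\<nu> q $ 2 = \<bar>r\<bar> * sin \<phi>'" "r \<noteq> 0"
    using r np by (auto simp: \<phi>'_def)
  \<comment> \<open>(X, Y) is the horizontal part turned by -\<phi>'. Where X > 0, the arctangent of
    Y / X is the longitude relative to \<phi>'.\<close>
  define X where "X x = \<nu> x $ 1 * cos \<phi>' + \<nu> x $ 2 * sin \<phi>'" for x
  define Y where "Y x = \<nu> x $ 2 * cos \<phi>' + \<nu> x $ 1 * (- sin \<phi>')" for x
  have "X q = \<bar>r\<bar> * ((cos \<phi>')\<^sup>2 + (sin \<phi>')\<^sup>2)" unfolding X_def r' by algebra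
  then have Xq: "X q > 0" using r' by simp
  have \<nu>2: "Ck_on 2 U \<nu>" using \<nu> by (simp add: smooth_map_on_def)
  have \<nu>c: "Ck_on 2 U (\<lambda>x. \<nu> x $ i)" for i
    by (rule Ck_on_bounded_linear[OF U bounded_linear_vec_nth \<nu>2])
  have XY: "Ck_on 2 U X" "Ck_on 2 U Y" unfolding X_def[abs_def] Y_def[abs_def]
    by (intro Ck_on_add Ck_on_mult Ck_on_const \<nu>c U)+
  define V where "V = {x \<in> U. X x > 0}"
  have "continuous_on U X" using XY(1) Ck_on_mono[of 0 2 U X] by simp
  moreover have "V = U \<inter> X -` {0<..}" by (auto simp: V_def)
  ultimately have oV: "open V" using continuous_open_preimage[of U X "{0<..}"] U by simp
  have VU: "V \<subseteq> U" by (auto simp: V_def)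
  have sq: "(X x)\<^sup>2 + (Y x)\<^sup>2 + (\<nu> x $ 3)\<^sup>2 = 1" if "x \<in> V" for x
  proof -
    have "(\<nu> x $ 1)\<^sup>2 + (\<nu> x $ 2)\<^sup>2 + (\<nu> x $ 3)\<^sup>2 = 1"
      using n1[of x] that VU by (auto simp: norm_eq_1 inner_vec_def sum_3 power2_eq_square)
    moreover have "(sin \<phi>')\<^sup>2 + (cos \<phi>')\<^sup>2 = 1" by simp
    ultimately show ?thesis unfolding X_def Y_def by algebra
  qed
  have n3: "\<bar>\<nu> x $ 3\<bar> < 1" if "x \<in> V" for x
  proof -
    have "(X x)\<^sup>2 > 0" using that by (simp add: V_def)
    then have "(\<nu> x $ 3)\<^sup>2 < 1" using sq[OF that] zero_le_power2[of "Y x"] by linarith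
    then show ?thesis by (simp add: abs_square_less_1)
  qed
  define u where "u x = (- 1) * artanh (\<nu> x $ 3)" for x
  define \<theta> where "\<theta> x = \<phi>' + arctan (Y x * inverse (X x))" for x
  define T where "T x = u x *\<^sub>R axis 1 1 + \<theta> x *\<^sub>R (axis 2 1 :: real ^ 2)" for x
  have T: "T x $ 1 = u x" "T x $ 2 = \<theta> x" for x by (simp_all add: T_def axis_def)
  have u2: "Ck_on 2 V u" unfolding u_def[abs_def]
    by (intro Ck_on_mult[OF oV Ck_on_const[OF oV]] Ck_on_compose_real[OF oV _ Ck_real_on_artanh]
        Ck_on_subset[OF \<nu>c VU]) (use n3 in \<open>auto simp: abs_less_iff\<close>)
  have \<theta>2: "Ck_on 2 V \<theta>" unfolding \<theta>_def[abs_def]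
    by (intro Ck_on_add[OF oV Ck_on_const[OF oV]] Ck_on_compose_real[OF oV _ Ck_real_on_arctan[of _ UNIV]]
        Ck_on_mult[OF oV] Ck_on_compose_real[OF oV _ Ck_real_on_inverse[of "{0<..}"]]
        Ck_on_subset[OF XY(1) VU] Ck_on_subset[OF XY(2) VU]) (auto simp: V_def)
  have T2: "Ck_on 2 V T" unfolding T_def[abs_def]
    by (intro Ck_on_add[OF oV] Ck_on_bounded_linear[OF oV bounded_linear_scaleR_left] u2 \<theta>2)
  have "\<nu> x = sphere_chart (T x)" if x: "x \<in> V" for x
  proof -
    have X0: "X x > 0" using x by (simp add: V_def)
    have th: "tanh (u x) = - \<nu> x $ 3"
      using tanh_artanh[OF n3[OF x]] by (simp add: u_def)
    define R where "R = 1 / cosh (u x)"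
    have R0: "R > 0" by (simp add: R_def)
    have "R\<^sup>2 = 1 - (tanh (u x))\<^sup>2"
    proof -
      have "(sinh (u x))\<^sup>2 = (cosh (u x))\<^sup>2 - 1" using cosh_square_eq[of "u x"] by simp
      then show ?thesis by (simp add: R_def tanh_def power_divide field_simps)
    qed
    then have R2: "R\<^sup>2 = (X x)\<^sup>2 + (Y x)\<^sup>2" using sq[OF x] by (simp add: th)
    have RX: "R = X x * sqrt (1 + (Y x * inverse (X x))\<^sup>2)"
    proof (rule power2_eq_imp_eq)
      have "(X x * sqrt (1 + (Y x * inverse (X x))\<^sup>2))\<^sup>2 = (X x)\<^sup>2 * (1 + (Y x * inverse (X x))\<^sup>2)"
        by (simp add: power_mult_distrib)
      also have "\<dots> = (X x)\<^sup>2 + (Y x)\<^sup>2" using X0 by (simp add: field_simps power2_eq_square)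
      finally show "R\<^sup>2 = (X x * sqrt (1 + (Y x * inverse (X x))\<^sup>2))\<^sup>2" using R2 by simp
    qed (use R0 X0 in auto)
    define w where "w = sqrt (1 + (Y x * inverse (X x))\<^sup>2)"
    have w0: "w > 0" by (simp add: w_def add_pos_nonneg)
    have ca: "R * cos (arctan (Y x * inverse (X x))) = X x" "R * sin (arctan (Y x * inverse (X x))) = Y x"
      unfolding RX cos_arctan sin_arctan w_def[symmetric] using w0 X0 by (simp_all add: field_simps)
    have sc: "(sin \<phi>')\<^sup>2 + (cos \<phi>')\<^sup>2 = 1" by simp
    have "R * cos (\<theta> x) = (R * cos (arctan (Y x * inverse (X x)))) * cos \<phi>'
        - (R * sin (arctan (Y x * inverse (X x)))) * sin \<phi>'"
      "R * sin (\<theta> x) = (R * cos (arctan (Y x * inverse (X x)))) * sin \<phi>'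
        + (R * sin (arctan (Y x * inverse (X x)))) * cos \<phi>'"
      unfolding \<theta>_def cos_add sin_add by algebra+
    then have "R * cos (\<theta> x) = X x * cos \<phi>' - Y x * sin \<phi>'"
      "R * sin (\<theta> x) = X x * sin \<phi>' + Y x * cos \<phi>'"
      unfolding ca by simp_all
    moreover have "X x * cos \<phi>' - Y x * sin \<phi>' = \<nu> x $ 1" "X x * sin \<phi>' + Y x * cos \<phi>' = \<nu> x $ 2"
      unfolding X_def Y_def using sc by algebra+
    ultimately show ?thesis
      by (simp add: vec_eq_iff forall_3 sphere_chart_def T th R_def[symmetric])
  qed
  moreover have "q \<in> V" using q Xq by (simp add: V_def)
  ultimately show thesis using that[OF oV _ VU T2] by blast
qed

lemma gauss_map_chart:
  assumes N: "oriented_surface S N" and X: "local_parametrization S U X" and q: "q \<in> U"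
    and \<sigma>: "\<sigma> = 1 \<or> \<sigma> = (- 1 :: real)" and np: "(N (X q) $ 1, N (X q) $ 2) \<noteq> (0, 0)"
  obtains V T where "open V" "q \<in> V" "V \<subseteq> U" "Ck_on 2 V T"
    "\<And>x. x \<in> V \<Longrightarrow> N (X x) = \<sigma> *\<^sub>R sphere_chart (T x)"
proof -
  have U: "open U" by (rule local_parametrizationD(1)[OF X])
  define \<nu> where "\<nu> x = \<sigma> *\<^sub>R (N \<circ> X) x" for x
  have "smooth_map_on U \<nu>" unfolding smooth_map_on_def \<nu>_def
    using oriented_surfaceD(3)[OF N X q] unfolding smooth_map_on_def
    by (intro allI Ck_on_bounded_linear[OF U bounded_linear_scaleR_right]) blast
  moreover have "norm (\<nu> x) = 1" if "x \<in> U" for x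
    using oriented_surfaceD(1)[OF N X that] \<sigma> by (auto simp: \<nu>_def)
  moreover have "(\<nu> q $ 1, \<nu> q $ 2) \<noteq> (0, 0)" using np \<sigma> by (auto simp: \<nu>_def)
  ultimately obtain V T where VT: "open V" "q \<in> V" "V \<subseteq> U" "Ck_on 2 V T"
    "\<And>x. x \<in> V \<Longrightarrow> \<nu> x = sphere_chart (T x)"
    using sphere_chart_lift[OF U _ q, of \<nu>] by metis
  have "N (X x) = \<sigma> *\<^sub>R sphere_chart (T x)" if "x \<in> V" for x
    using VT(5)[OF that, symmetric] \<sigma> by (auto simp: \<nu>_def)
  with VT(1-4) show thesis by (rule that)
qed

section \<open>From the parametrization to the surface\<close>

lemma local_parametrization_openin:
  assumes X: "local_parametrization S U X" and W: "open W" "W \<subseteq> U"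
  shows "openin (top_of_set S) (X ` W)"
proof -
  obtain Y where "homeomorphism U (X ` U) X Y" using local_parametrizationD(6)[OF X] by blast
  moreover have "openin (top_of_set U) W" using W unfolding openin_open by blast
  ultimately have "openin (top_of_set (X ` U)) (X ` W)" by (rule homeomorphism_imp_open_map)
  then show ?thesis using openin_trans local_parametrizationD(3)[OF X] by blast
qed

lemma support_function_constant_sign:
  assumes N: "oriented_surface S N" and S: "connected S"
    and nz: "\<And>p. p \<in> S \<Longrightarrow> support_function N p \<noteq> 0"
  obtains \<sigma> :: real where "\<sigma> = 1 \<or> \<sigma> = - 1" "\<And>p. p \<in> S \<Longrightarrow> \<sigma> * support_function N p > 0"
proof -
  have "(\<lambda>p. sgn (support_function N p)) constant_on S"
  proof (rule locally_constant_imp_constant[OF S])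
    fix p assume p: "p \<in> S"
    then obtain U X where X: "local_parametrization S U X" "p \<in> X ` U"
      using N unfolding oriented_surface_def regular_surface_def by blast
    then obtain q where q: "q \<in> U" "p = X q" by blast
    note lp = local_parametrizationD[OF X(1)]
    have "Ck_on 0 U X" "Ck_on 0 U (N \<circ> X)"
      using lp(2) oriented_surfaceD(3)[OF N X(1) q(1)] unfolding smooth_map_on_def by blast+
    then have c: "continuous_on U (\<lambda>x. X x \<bullet> (N \<circ> X) x * support_function N p)"
      by (intro continuous_on_mult continuous_on_inner continuous_on_const) (simp_all add: o_def)
    \<comment> \<open>A positive product with the value at p means the same sign as at p.\<close>
    define W where "W = U \<inter> (\<lambda>x. X x \<bullet> (N \<circ> X) x * support_function N p) -` {0<..}"
    have W: "open W" unfolding W_def by (rule continuous_open_preimage[OF c lp(1)]) simp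
    have "q \<in> W" using q nz[OF p] by (auto simp: W_def support_function_def not_sum_power2_lt_zero
          zero_less_mult_iff linorder_neq_iff)
    moreover have "sgn (support_function N x) = sgn (support_function N p)" if "x \<in> X ` W" for x
      using that by (auto simp: W_def support_function_def zero_less_mult_iff sgn_if)
    moreover have "openin (top_of_set S) (X ` W)"
      by (rule local_parametrization_openin[OF X(1) W]) (simp add: W_def)
    ultimately show "\<exists>T. openin (top_of_set S) T \<and> p \<in> T \<and>
        (\<forall>x\<in>T. sgn (support_function N x) = sgn (support_function N p))"
      using q(2) by blast
  qed
  then obtain s where s: "\<And>p. p \<in> S \<Longrightarrow> sgn (support_function N p) = s"
    unfolding constant_on_def by blast
  show thesis
  proof (cases "S = {}")
    case False
    then obtain p where "p \<in> S" by blast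
    then have s1: "s = 1 \<or> s = - 1" using s[of p] nz[of p] by (auto simp: sgn_real_def split: if_splits)
    moreover have "s * support_function N x > 0" if "x \<in> S" for x
      using nz[OF that] unfolding s[OF that, symmetric] by (simp add: sgn_mult_self_eq abs_sgn[symmetric] mult.commute)
    ultimately show thesis using that by blast
  qed (use that[of 1] in auto)
qed

lemma sphere_chart_eqD:
  assumes "sphere_chart x = sphere_chart y"
  shows "x $ 1 = y $ 1" "cos (x $ 2) = cos (y $ 2)" "sin (x $ 2) = sin (y $ 2)"
proof -
  have "sphere_chart x $ i = sphere_chart y $ i" for i using assms by simp
  note e = this[of 1] this[of 2] this[of 3]
  show 1: "x $ 1 = y $ 1" using e(3) by (metis artanh_tanh_real neg_equal_iff_equal revolve_nth(3) sphere_chart_def)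
  have "cosh (y $ 1) \<noteq> (0::real)" by simp
  then show "cos (x $ 2) = cos (y $ 2)" "sin (x $ 2) = sin (y $ 2)"
    using e(1,2) 1 by (simp_all add: sphere_chart_def)
qed

lemma support_param_cong:
  assumes "sphere_chart x = sphere_chart y"
  shows "support_param \<psi> \<psi>1 x = support_param \<psi> \<psi>1 y"
  using sphere_chart_eqD[OF assms] by (simp add: support_param_def revolve_def)

lemma sphere_chart_normal:
  assumes "v \<bullet> sphere_chart1 x = 0" "v \<bullet> sphere_chart2 x = 0"
  shows "v = (v \<bullet> sphere_chart x) *\<^sub>R sphere_chart x"
proof -
  define t where "t = x $ 1"
  have c0: "cosh t \<noteq> (0::real)" by simp
  have "v \<bullet> e_phi (x $ 2) = 0" using assms(2) by (simp add: sphere_chart2_def)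
  define a where "a = v \<bullet> revolve 1 0 (x $ 2)"
  have v: "v = revolve a (v $ 3) (x $ 2)"
    using revolve_expansion[OF \<open>v \<bullet> e_phi (x $ 2) = 0\<close>] by (simp add: a_def)
  have "v \<bullet> sphere_chart1 x = revolve a (v $ 3) (x $ 2) \<bullet> sphere_chart1 x" using v by simp
  with assms(1) have "a * (- sinh t / (cosh t)\<^sup>2) + v $ 3 * (- 1 / (cosh t)\<^sup>2) = 0"
    by (simp only: sphere_chart1_def inner_revolve t_def)
  then have v3: "v $ 3 = - a * sinh t" using c0 by (simp add: field_simps)
  have "v = (a * cosh t) *\<^sub>R sphere_chart x"
    using v unfolding v3 sphere_chart_def t_def[symmetric] scaleR_revolve
    using c0 by (simp add: tanh_def)
  then show ?thesis by (metis inner_scaleR_left inner_sphere_chart(1) mult.right_neutral)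
qed

text \<open>Writing the support function as \<open>G / cosh\<^sup>2\<close> turns the equation of HQSF-surfaces of rotation
  into \<open>G G'' - G'\<^sup>2 = \<kappa> exp (2 a t) G\<close>.\<close>

definition profile :: "(real \<Rightarrow> real) \<Rightarrow> real \<Rightarrow> real" where
  "profile G t = 2 * exp (2 * t) * G t / (1 + exp (2 * t))"

definition supp :: "(real \<Rightarrow> real) \<Rightarrow> real \<Rightarrow> real" where
  "supp G t = G t / (cosh t)\<^sup>2"

definition supp1 :: "(real \<Rightarrow> real) \<Rightarrow> (real \<Rightarrow> real) \<Rightarrow> real \<Rightarrow> real" where
  "supp1 G G1 t = G1 t / (cosh t)\<^sup>2 - 2 * G t * sinh t / (cosh t) ^ 3"

definition supp2 :: "real \<Rightarrow> real \<Rightarrow> real \<Rightarrow> real \<Rightarrow> real" where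
  "supp2 g g1 g2 t = g2 / (cosh t)\<^sup>2 - 4 * g1 * sinh t / (cosh t) ^ 3
     - 2 * g * (1 / (cosh t)\<^sup>2 - 3 * (sinh t)\<^sup>2 / (cosh t) ^ 4)"

lemma DERIV_supp:
  assumes G: "(G has_real_derivative G1 t) (at t)"
  shows "(supp G has_real_derivative supp1 G G1 t) (at t)"
proof -
  have c0: "cosh t \<noteq> (0::real)" by simp
  have "((\<lambda>t. G t / (cosh t)\<^sup>2) has_real_derivative
      (G1 t * (cosh t)\<^sup>2 - G t * (2 * cosh t * sinh t)) / ((cosh t)\<^sup>2 * (cosh t)\<^sup>2)) (at t)"
    using G by (auto intro!: derivative_eq_intros)
  moreover have "(G1 t * (cosh t)\<^sup>2 - G t * (2 * cosh t * sinh t)) / ((cosh t)\<^sup>2 * (cosh t)\<^sup>2)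
    = supp1 G G1 t"
    using c0 by (simp add: supp1_def field_simps power2_eq_square power3_eq_cube)
  ultimately show ?thesis by (simp add: supp_def[abs_def])
qed

lemma DERIV_supp1:
  assumes G: "(G has_real_derivative G1 t) (at t)" "(G1 has_real_derivative g2) (at t)"
  shows "(supp1 G G1 has_real_derivative supp2 (G t) (G1 t) g2 t) (at t)"
proof -
  have c0: "cosh t \<noteq> (0::real)" by simp
  have "((\<lambda>t. G1 t / (cosh t)\<^sup>2 - 2 * G t * sinh t / (cosh t) ^ 3) has_real_derivative
      (g2 * (cosh t)\<^sup>2 - G1 t * (2 * cosh t * sinh t)) / ((cosh t)\<^sup>2 * (cosh t)\<^sup>2)
      - ((2 * G1 t * sinh t + 2 * G t * cosh t) * (cosh t) ^ 3
        - 2 * G t * sinh t * (3 * (cosh t)\<^sup>2 * sinh t)) / ((cosh t) ^ 3 * (cosh t) ^ 3)) (at t)"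
    using G by (auto intro!: derivative_eq_intros simp: algebra_simps)
  moreover have "(g2 * (cosh t)\<^sup>2 - G1 t * (2 * cosh t * sinh t)) / ((cosh t)\<^sup>2 * (cosh t)\<^sup>2)
      - ((2 * G1 t * sinh t + 2 * G t * cosh t) * (cosh t) ^ 3
        - 2 * G t * sinh t * (3 * (cosh t)\<^sup>2 * sinh t)) / ((cosh t) ^ 3 * (cosh t) ^ 3)
    = supp2 (G t) (G1 t) g2 t"
    using c0 by (simp add: supp2_def divide_simps) algebra
  ultimately show ?thesis by (simp add: supp1_def[abs_def])
qed

text \<open>The second derivative of log(cosh^2) is 2 / cosh^2. Written with the logarithm of the
  support function, passing to G therefore removes exactly the quadratic zeroth-order term.\<close>

lemma supp_equation:
  "(- supp G t * (2 * supp G t + supp2 (G t) (G1 t) g2 t * (cosh t)\<^sup>2) + k * supp G t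
      + (supp1 G G1 t)\<^sup>2 * (cosh t)\<^sup>2) * (cosh t)\<^sup>2
    = (G1 t)\<^sup>2 - G t * g2 + k * G t"
proof -
  have c0: "cosh t \<noteq> (0::real)" by simp
  have s: "(sinh t)\<^sup>2 = (cosh t)\<^sup>2 - 1" using cosh_square_eq[of t] by simp
  show ?thesis using c0 unfolding supp_def supp1_def supp2_def s
    by (simp add: divide_simps) (use s in algebra)
qed

text \<open>The formulas for A and B describe the surface with Gauss map \<open>sphere_chart\<close>
  and support function 2 h / (1 + exp(2t)), which is \<open>supp G\<close> for
  \<open>h = profile G\<close>. The identities become rational in e = exp t.\<close>

lemma rotational_X_profile:
  assumes G: "(G has_real_derivative G1 (x $ 1)) (at (x $ 1))"
  shows "rotational_X (profile G) x = support_param (supp G) (supp1 G G1) x"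
proof -
  define t where "t = x $ 1"
  define e where "e = exp t"
  have e0: "e > 0" by (simp add: e_def)
  have e2: "exp (2 * t) = e\<^sup>2" by (simp add: e_def exp_double)
  have c: "cosh t = (e\<^sup>2 + 1) / (2 * e)" "sinh t = (e\<^sup>2 - 1) / (2 * e)"
    using e0 by (simp_all add: cosh_def sinh_def e_def exp_minus field_simps power2_eq_square)
  have p: "1 + e\<^sup>2 > 0" by (simp add: add_pos_nonneg)
  have "1 + exp (2 * t) \<noteq> 0" using p e2 by simp
  then have d: "(profile G has_real_derivative
      ((4 * exp (2 * t) * G t + 2 * exp (2 * t) * G1 t) * (1 + exp (2 * t))
        - 2 * exp (2 * t) * G t * (2 * exp (2 * t))) / ((1 + exp (2 * t)) * (1 + exp (2 * t)))) (at t)"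
    using G unfolding profile_def[abs_def] t_def[symmetric]
    by (auto intro!: derivative_eq_intros simp: algebra_simps)
  note dd = DERIV_imp_deriv[OF d]
  have A: "profile_A (profile G) t = supp G t / cosh t - supp1 G G1 t * sinh t"
    unfolding profile_A_def dd supp_def supp1_def c e2 profile_def e_def[symmetric]
    using e0 p by (simp add: divide_simps) algebra
  have B: "profile_B (profile G) t = - supp G t * tanh t - supp1 G G1 t"
    unfolding profile_B_def dd supp_def supp1_def tanh_def c e2 profile_def
    using e0 p by (simp add: divide_simps) algebra
  show ?thesis
    unfolding rotational_X_def support_param_def revolve_def using A B by (simp add: t_def)
qed


text \<open>Both radii are nonzero because the parametrization is an immersion, so N and
  \<open>sphere_chart\<close> are normal to the same plane. At this stage the sign may still depend
  on the point.\<close>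

lemma rotational_parametrization_normal:
  assumes N: "oriented_surface S N" and X: "local_parametrization S U (support_param \<psi> \<psi>1)" and q: "q \<in> U"
    and \<psi>: "(\<psi> has_real_derivative \<psi>1 (q $ 1)) (at (q $ 1))" "(\<psi>1 has_real_derivative p2) (at (q $ 1))"
  shows "N (support_param \<psi> \<psi>1 q) = sphere_chart q \<or> N (support_param \<psi> \<psi>1 q) = - sphere_chart q"
    and "radius2 (\<psi> (q $ 1)) (\<psi>1 (q $ 1)) (q $ 1) \<noteq> 0"
proof -
  define v where "v = N (support_param \<psi> \<psi>1 q)"
  note dX = pd_support_param(2,3)[where x=q, OF \<psi>]
  note ind = local_parametrization_independent[OF X q]
  have w1: "radius1 (\<psi> (q $ 1)) (\<psi>1 (q $ 1)) p2 (q $ 1) \<noteq> 0"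
    using ind[of 1 0] dX by auto
  show w2: "radius2 (\<psi> (q $ 1)) (\<psi>1 (q $ 1)) (q $ 1) \<noteq> 0"
    using ind[of 0 1] dX by auto
  note o = oriented_surfaceD[OF N X q, folded v_def]
  have "sphere_chart1 q \<bullet> v = 0" "sphere_chart2 q \<bullet> v = 0"
    using o(2)[of 1] o(2)[of 2] w1 w2 unfolding dX by simp_all
  then have v: "v = (v \<bullet> sphere_chart q) *\<^sub>R sphere_chart q"
    by (intro sphere_chart_normal) (simp_all add: inner_commute)
  have "v \<bullet> v = (v \<bullet> sphere_chart q) * (v \<bullet> sphere_chart q)"
    by (subst (1) v) (simp add: inner_commute)
  then have "(v \<bullet> sphere_chart q)\<^sup>2 = 1" using o(1) by (simp add: dot_square_norm power2_eq_square)
  then have "v \<bullet> sphere_chart q = 1 \<or> v \<bullet> sphere_chart q = - 1" by (simp add: power2_eq_1_iff)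
  then show "N (support_param \<psi> \<psi>1 q) = sphere_chart q \<or> N (support_param \<psi> \<psi>1 q) = - sphere_chart q"
    using v unfolding v_def[symmetric] by auto
qed

section \<open>Recognizing surfaces of revolution\<close>

lemma sin_or_cos_nonzero: "sin y \<noteq> 0 \<or> cos y \<noteq> (0::real)"
  by (metis sin_cos_squared_add zero_power2 add_0 zero_neq_one)

text \<open>Closeness of two longitudes modulo full turns can thus be tested by a cosine, which is
  an open condition on points of space.\<close>

lemma cos_gt_cosD:
  assumes d: "0 < d" "d \<le> pi" and "cos y > cos d"
  obtains y' where "\<bar>y'\<bar> < d" "cos y' = cos y" "sin y' = sin y"
proof -
  have "(cos y)\<^sup>2 + (sin y)\<^sup>2 = 1" by simp
  then obtain z where z: "0 \<le> z" "z < 2 * pi" "cos y = cos z" "sin y = sin z"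
    using sincos_total_2pi by metis
  define y' where "y' = (if z \<le> pi then z else z - 2 * pi)"
  have "cos y' = cos y" "sin y' = sin y" using z by (auto simp: y'_def cos_diff sin_diff)
  moreover have "\<bar>y'\<bar> \<le> pi" using z by (auto simp: y'_def)
  moreover have "cos \<bar>y'\<bar> > cos d" using assms(3) \<open>cos y' = cos y\<close> by simp
  ultimately show thesis
    using that[of y'] cos_mono_less_eq[of d "\<bar>y'\<bar>"] d by auto
qed

lemma rotation_x3_revolve: "rotation_x3 \<theta> (revolve a b \<phi>) = revolve a b (\<phi> + \<theta>)"
  by (simp add: rotation_x3_def revolve_def cos_add sin_add algebra_simps)

text \<open>M is swept out by full turns of a short piece of the profile curve, whereas S is only
  known to contain the image of a small box W of parameters. V confines M to the longitudes of W,
  and confines S to the relatively open image of W.\<close>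

lemma surface_of_revolution_if_parametrized:
  assumes X: "\<And>p. p \<in> S \<Longrightarrow> \<exists>U. local_parametrization S U (\<lambda>x. revolve (a (x $ 1)) (b (x $ 1)) (x $ 2)) \<and> p \<in> (\<lambda>x. revolve (a (x $ 1)) (b (x $ 1)) (x $ 2)) ` U"
    and a0: "\<And>U q. local_parametrization S U (\<lambda>x. revolve (a (x $ 1)) (b (x $ 1)) (x $ 2)) \<Longrightarrow> q \<in> U \<Longrightarrow> a (q $ 1) \<noteq> 0"
    and ca: "\<And>t. isCont a t"
  shows "surface_of_revolution S"
  unfolding surface_of_revolution_def
proof (intro conjI ballI)
  define X where "X x = revolve (a (x $ 1)) (b (x $ 1)) (x $ 2)" for x :: "real ^ 2"
  fix p assume p: "p \<in> S"
  obtain U q where lp: "local_parametrization S U X" and q: "q \<in> U" "p = X q"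
    using X[OF p] unfolding X_def by blast
  have aq: "a (q $ 1) \<noteq> 0" using a0[of U q] lp q unfolding X_def by blast
  show "(p $ 1, p $ 2) \<noteq> (0, 0)" using aq sin_or_cos_nonzero[of "q $ 2"] by (auto simp: q X_def)
  have "open U" using local_parametrizationD[OF lp] by blast
  then obtain e where e: "e > 0" "ball q e \<subseteq> U" using q openE by blast
  \<comment> \<open>The radial coordinate may be negative, and then the point lies opposite to the
    direction u2; s corrects this.\<close>
  define s where "s = sgn (a (q $ 1))"
  have s: "s * a (q $ 1) > 0" "s * s = 1" using aq by (auto simp: s_def sgn_real_def)
  have "isCont (\<lambda>t. s * a t) (q $ 1)" by (intro continuous_intros ca)
  then have "\<forall>\<^sub>F t in at (q $ 1). s * a t > 0" using s(1)
    unfolding isCont_def by (rule order_tendstoD)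
  then obtain d1 where d1: "d1 > 0" "\<And>t. t \<noteq> q $ 1 \<Longrightarrow> dist t (q $ 1) < d1 \<Longrightarrow> s * a t > 0"
    unfolding eventually_at by auto
  define d where "d = min (e / 2) (min d1 (pi / 2))"
  have d: "d > 0" "2 * d \<le> e" "d \<le> d1" "d \<le> pi / 2" using e d1 by (auto simp: d_def min_def)
  have d1': "s * a t > 0" if "\<bar>t - q $ 1\<bar> < d" for t
    using d1(2)[of t] that s(1) d by (cases "t = q $ 1") (auto simp: dist_real_def)
  define W where "W = {x :: real ^ 2. \<bar>x $ 1 - q $ 1\<bar> < d \<and> \<bar>x $ 2 - q $ 2\<bar> < d}"
  have "open W" unfolding W_def by (intro open_Collect_conj open_Collect_less continuous_intros)
  have "W \<subseteq> ball q e"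
  proof
    fix x assume x: "x \<in> W"
    have "norm (x - q) \<le> (\<Sum>i\<in>UNIV. \<bar>(x - q) $ i\<bar>)" by (rule norm_le_l1_cart)
    also have "\<dots> < 2 * d" using x by (simp add: sum_2 W_def)
    finally show "x \<in> ball q e" using d by (simp add: dist_norm norm_minus_commute)
  qed
  then have "W \<subseteq> U" using e by blast
  obtain V' where V': "open V'" "X ` W = S \<inter> V'"
    using local_parametrization_openin[OF lp \<open>open W\<close> \<open>W \<subseteq> U\<close>] by (auto simp: openin_open)
  \<comment> \<open>With r the distance to the axis, the inequality compares r times the cosine of
    the angle to p with r cos d. It cuts out an open sector of half-angle d about the meridian of
    p.\<close>
  define V where "V = V' \<inter> {p :: real ^ 3. s * (p $ 1 * cos (q $ 2) + p $ 2 * sin (q $ 2))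
      > cos d * sqrt ((p $ 1)\<^sup>2 + (p $ 2)\<^sup>2)}"
  define M where "M = {revolve (a t) (b t) \<phi> |t \<phi>. \<bar>t - q $ 1\<bar> < d}"
  have "open V" unfolding V_def
    by (intro open_Int V'(1) open_Collect_less continuous_intros)
  have rad: "s * (revolve (a t) (b t) \<phi> $ 1 * cos (q $ 2) + revolve (a t) (b t) \<phi> $ 2 * sin (q $ 2))
      = (s * a t) * cos (\<phi> - q $ 2)"
    "sqrt ((revolve (a t) (b t) \<phi> $ 1)\<^sup>2 + (revolve (a t) (b t) \<phi> $ 2)\<^sup>2) = s * a t"
    if "\<bar>t - q $ 1\<bar> < d" for t \<phi>
  proof -
    show "s * (revolve (a t) (b t) \<phi> $ 1 * cos (q $ 2) + revolve (a t) (b t) \<phi> $ 2 * sin (q $ 2))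
      = (s * a t) * cos (\<phi> - q $ 2)" by (simp add: cos_diff algebra_simps)
    have "(revolve (a t) (b t) \<phi> $ 1)\<^sup>2 + (revolve (a t) (b t) \<phi> $ 2)\<^sup>2 = (a t)\<^sup>2 * ((cos \<phi>)\<^sup>2 + (sin \<phi>)\<^sup>2)"
      by (simp only: revolve_nth) algebra
    also have "\<dots> = (s * a t)\<^sup>2" using s(2) by (simp add: power_mult_distrib power2_eq_square[of s])
    finally show "sqrt ((revolve (a t) (b t) \<phi> $ 1)\<^sup>2 + (revolve (a t) (b t) \<phi> $ 2)\<^sup>2) = s * a t"
      using d1'[OF that] by (simp only: real_sqrt_abs abs_of_pos)
  qed
  have "q \<in> W" using d by (simp add: W_def)
  then have "p \<in> V'" using V' q by blast
  moreover have "cos d < 1" using d cos_monotone_0_pi[of 0 d] pi_gt_zero by simp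
  moreover have "\<bar>q $ 1 - q $ 1\<bar> < d" using d by simp
  note r = rad[OF this, of "q $ 2"]
  have "cos d * sqrt ((p $ 1)\<^sup>2 + (p $ 2)\<^sup>2) < s * (p $ 1 * cos (q $ 2) + p $ 2 * sin (q $ 2))"
    unfolding q(2) X_def r using mult_strict_right_mono[OF \<open>cos d < 1\<close> s(1)] by simp
  ultimately have pV: "p \<in> V" by (simp add: V_def)
  have XW: "X ` W \<subseteq> M"
  proof
    fix y assume "y \<in> X ` W"
    then obtain x where "x \<in> W" "y = X x" by blast
    then show "y \<in> M" unfolding M_def W_def X_def by blast
  qed
  have "M \<inter> V \<subseteq> X ` W"
  proof
    fix m assume m: "m \<in> M \<inter> V"
    then obtain t \<phi> where t: "\<bar>t - q $ 1\<bar> < d" "m = revolve (a t) (b t) \<phi>" by (auto simp: M_def)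
    have "(s * a t) * cos (\<phi> - q $ 2) > cos d * (s * a t)"
      using m rad[OF t(1), of \<phi>] by (simp add: V_def t(2) del: revolve_nth)
    then have "(s * a t) * cos d < (s * a t) * cos (\<phi> - q $ 2)" by (simp only: mult.commute)
    then have "cos (\<phi> - q $ 2) > cos d" using d1'[OF t(1)] by (rule mult_left_less_imp_less[OF _ less_imp_le])
    moreover have "d \<le> pi" using d pi_gt_zero by linarith
    ultimately obtain y where y: "\<bar>y\<bar> < d" "cos y = cos (\<phi> - q $ 2)" "sin y = sin (\<phi> - q $ 2)"
      using cos_gt_cosD[of d "\<phi> - q $ 2"] d by blast
    have "cos (y + q $ 2) = cos (\<phi> - q $ 2 + q $ 2)" "sin (y + q $ 2) = sin (\<phi> - q $ 2 + q $ 2)"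
      unfolding cos_add[of y] sin_add[of y] y by (simp_all only: cos_add sin_add)
    then have "m = X (vector [t, y + q $ 2])" by (simp add: t(2) X_def revolve_def)
    moreover have "vector [t, y + q $ 2] \<in> W" using t y by (simp add: W_def)
    ultimately show "m \<in> X ` W" by blast
  qed
  moreover have "S \<inter> V \<subseteq> X ` W" using V' by (auto simp: V_def)
  ultimately have eq: "S \<inter> V = M \<inter> V" using XW V'(2) by blast
  have rot: "rotation_x3 \<theta> ` M = M" for \<theta>
  proof
    show "rotation_x3 \<theta> ` M \<subseteq> M"
    proof
      fix m assume "m \<in> rotation_x3 \<theta> ` M"
      then obtain t \<phi> where "\<bar>t - q $ 1\<bar> < d" "m = revolve (a t) (b t) (\<phi> + \<theta>)"
        by (auto simp: M_def rotation_x3_revolve)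
      then show "m \<in> M" unfolding M_def by blast
    qed
    show "M \<subseteq> rotation_x3 \<theta> ` M"
    proof
      fix m assume "m \<in> M"
      then obtain t \<phi> where t: "\<bar>t - q $ 1\<bar> < d" "m = revolve (a t) (b t) \<phi>" by (auto simp: M_def)
      have "m = rotation_x3 \<theta> (revolve (a t) (b t) (\<phi> - \<theta>))" by (simp add: rotation_x3_revolve t)
      moreover have "revolve (a t) (b t) (\<phi> - \<theta>) \<in> M" using t unfolding M_def by blast
      ultimately show "m \<in> rotation_x3 \<theta> ` M" by blast
    qed
  qed
  show "\<exists>V M. open V \<and> p \<in> V \<and> (\<forall>\<theta>. rotation_x3 \<theta> ` M = M) \<and> S \<inter> V = M \<inter> V"
    using \<open>open V\<close> pV rot eq by blast
qed

theorem HQSF_surface_of_rotation_if_parametrized: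
  assumes N: "oriented_surface S N" and S: "connected S"
    and par: "locally_parametrized_by S (rotational_X (profile G))"
    and G: "\<And>t. (G has_real_derivative G1 t) (at t)" "\<And>t. (G1 has_real_derivative G2 t) (at t)"
    and pos: "\<And>t. G t \<ge> 0"
    and eq: "\<And>t. G t * G2 t - (G1 t)\<^sup>2 = \<kappa> * exp (2 * a * t) * G t"
  shows "HQSF_surface_of_rotation S N"
proof -
  define \<psi> where "\<psi> = supp G"
  define \<psi>1 where "\<psi>1 = supp1 G G1"
  define \<psi>2 where "\<psi>2 t = supp2 (G t) (G1 t) (G2 t) t" for t
  have d\<psi>: "(\<psi> has_real_derivative \<psi>1 t) (at t)" "(\<psi>1 has_real_derivative \<psi>2 t) (at t)" for t
    using DERIV_supp[of G G1 t] DERIV_supp1[of G G1 t "G2 t"] G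
    by (simp_all add: \<psi>_def \<psi>1_def \<psi>2_def)
  have c0: "cosh t \<noteq> (0::real)" for t by simp
  have rX: "rotational_X (profile G) = support_param \<psi> \<psi>1"
    using rotational_X_profile[of G G1] G(1) by (simp add: fun_eq_iff \<psi>_def \<psi>1_def)
  have ex: "\<exists>U q. local_parametrization S U (support_param \<psi> \<psi>1) \<and> q \<in> U \<and> p = support_param \<psi> \<psi>1 q"
    if "p \<in> S" for p
    using par that unfolding locally_parametrized_by_def rX by blast
  \<comment> \<open>G is only nonnegative, but at a zero of G the equation forces G1 = 0. Then
    \<psi> and its derivative vanish there, and so does \<open>radius2\<close>, which an immersion
    excludes.\<close>
  have \<psi>pos: "\<psi> (q $ 1) > 0" if "local_parametrization S U (support_param \<psi> \<psi>1)" "q \<in> U" for U q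
  proof (rule ccontr)
    assume "\<not> ?thesis"
    moreover have "\<psi> (q $ 1) \<ge> 0" using pos by (simp add: \<psi>_def supp_def)
    ultimately have 0: "\<psi> (q $ 1) = 0" by simp
    then have "G (q $ 1) = 0" using c0 by (simp add: \<psi>_def supp_def)
    then have "G1 (q $ 1) = 0" using eq[of "q $ 1"] by simp
    then have "\<psi>1 (q $ 1) = 0" using \<open>G (q $ 1) = 0\<close> by (simp add: \<psi>1_def supp1_def)
    with 0 rotational_parametrization_normal(2)[OF N that d\<psi>] show False by (simp add: radius2_def)
  qed
  have nz: "support_function N p \<noteq> 0" if p: "p \<in> S" for p
  proof -
    obtain U q where q: "local_parametrization S U (support_param \<psi> \<psi>1)" "q \<in> U" "p = support_param \<psi> \<psi>1 q"
      using ex[OF p] by blast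
    show ?thesis
      using rotational_parametrization_normal(1)[OF N q(1,2) d\<psi>] \<psi>pos[OF q(1,2)]
      by (auto simp: support_function_def q(3) support_param_inner)
  qed
  obtain \<sigma> :: real where \<sigma>: "\<sigma> = 1 \<or> \<sigma> = - 1" "\<And>p. p \<in> S \<Longrightarrow> \<sigma> * support_function N p > 0"
    using support_function_constant_sign[OF N S nz] by blast
  have \<sigma>2: "\<sigma> * \<sigma> = 1" using \<sigma>(1) by auto
  have gauss: "\<exists>q. p = support_param \<psi> \<psi>1 q \<and> \<sigma> *\<^sub>R N p = sphere_chart q \<and> \<psi> (q $ 1) > 0" if p: "p \<in> S" for p
  proof -
    obtain U q where q: "local_parametrization S U (support_param \<psi> \<psi>1)" "q \<in> U" "p = support_param \<psi> \<psi>1 q"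
      using ex[OF p] by blast
    show ?thesis
      using rotational_parametrization_normal(1)[OF N q(1,2) d\<psi>] \<psi>pos[OF q(1,2)] \<sigma>(1) \<sigma>(2)[OF p]
      by (intro exI[of _ q]) (auto simp: support_function_def q(3) support_param_inner)
  qed
  have n3: "\<bar>\<sigma> * N p $ 3\<bar> < 1" if p: "p \<in> S" for p
  proof -
    obtain q where q: "\<sigma> *\<^sub>R N p = sphere_chart q" using gauss[OF p] by blast
    have "\<sigma> * N p $ 3 = (\<sigma> *\<^sub>R N p) $ 3" by simp
    then have "\<sigma> * N p $ 3 = - tanh (q $ 1)" unfolding q by (simp add: sphere_chart_def)
    then show ?thesis by (simp add: abs_less_iff tanh_real_lt_1 tanh_real_gt_neg1 minus_less_iff)
  qed
  \<comment> \<open>The coordinate u1 is a function of the normal alone, so \<mu> = a u1 is defined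
    on all of S without reference to charts.\<close>
  define \<mu> where "\<mu> p = a * artanh ((- \<sigma>) * N p $ 3)" for p
  \<comment> \<open>Any local parametrization factors near q through Gauss coordinates. The
    longitude in \<open>T x\<close> may differ by full turns from that of the parameter y found by
    \<open>gauss\<close>, but \<open>support_param\<close> takes the same value at both.\<close>
  have chart: "\<exists>V T. open V \<and> q \<in> V \<and> V \<subseteq> U \<and> Ck_on 2 V T \<and>
      (\<forall>x\<in>V. N (X x) = \<sigma> *\<^sub>R sphere_chart (T x) \<and> X x = support_param \<psi> \<psi>1 (T x) \<and> \<mu> (X x) = a * T x $ 1
         \<and> \<psi> (T x $ 1) > 0)"
    if lp: "local_parametrization S U X" and q: "q \<in> U" for U X q
  proof -
    note lpD = local_parametrizationD[OF lp]
    obtain y where y: "\<sigma> *\<^sub>R N (X q) = sphere_chart y" using gauss[of "X q"] lpD(4) q by blast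
    have "(\<sigma> *\<^sub>R N (X q)) $ i = sphere_chart y $ i" for i unfolding y ..
    from this[of 1] this[of 2] have "(N (X q) $ 1, N (X q) $ 2) \<noteq> (0, 0)"
      using sin_or_cos_nonzero[of "y $ 2"] c0[of "y $ 1"] by (auto simp: sphere_chart_def)
    then obtain V T where VT: "open V" "q \<in> V" "V \<subseteq> U" "Ck_on 2 V T"
      "\<And>x. x \<in> V \<Longrightarrow> N (X x) = \<sigma> *\<^sub>R sphere_chart (T x)"
      using gauss_map_chart[OF N lp q \<sigma>(1)] by metis
    have "N (X x) = \<sigma> *\<^sub>R sphere_chart (T x) \<and> X x = support_param \<psi> \<psi>1 (T x) \<and> \<mu> (X x) = a * T x $ 1
        \<and> \<psi> (T x $ 1) > 0"
      if x: "x \<in> V" for x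
    proof -
      have "X x \<in> S" using x VT(3) lpD(4) by blast
      from gauss[OF this] obtain y where y: "X x = support_param \<psi> \<psi>1 y" "\<sigma> *\<^sub>R N (X x) = sphere_chart y"
        "\<psi> (y $ 1) > 0" by blast
      have Nx: "\<sigma> *\<^sub>R N (X x) = sphere_chart (T x)" using VT(5)[OF x] \<sigma>2 by simp
      have yT: "sphere_chart y = sphere_chart (T x)" using y(2) Nx by simp
      have "\<mu> (X x) = a * T x $ 1"
      proof -
        have "(- \<sigma>) * N (X x) $ 3 = - ((\<sigma> *\<^sub>R N (X x)) $ 3)" by simp
        also have "\<dots> = tanh (T x $ 1)" unfolding Nx by (simp add: sphere_chart_def)
        finally show ?thesis unfolding \<mu>_def by (simp only: artanh_tanh_real)
      qed
      then show ?thesis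
        using support_param_cong[OF yT] sphere_chart_eqD(1)[OF yT] y(1,3) VT(5)[OF x] by simp
    qed
    with VT show ?thesis by blast
  qed
  have "harmonic_III S N \<mu>"
    unfolding harmonic_III_def
  proof (intro allI impI conjI ballI)
    fix U X assume lp: "local_parametrization S U X"
    note lpD = local_parametrizationD[OF lp]
    show "Ck_on 2 U (\<mu> \<circ> X)"
    proof (cases "U = {}")
      case False
      then have "Ck_on 2 U (N \<circ> X)"
        using oriented_surfaceD(3)[OF N lp] unfolding smooth_map_on_def by blast
      then have "Ck_on 2 U (\<lambda>x. (N \<circ> X) x $ 3)"
        by (rule Ck_on_bounded_linear[OF lpD(1) bounded_linear_vec_nth])
      then have "Ck_on 2 U (\<lambda>x. a * artanh ((- \<sigma>) * (N \<circ> X) x $ 3))"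
        using n3 lpD(4)
        by (intro Ck_on_mult[OF lpD(1) Ck_on_const[OF lpD(1)]]
            Ck_on_compose_real[OF lpD(1) _ Ck_real_on_artanh]) (auto simp: abs_less_iff)
      then show ?thesis by (simp add: o_def \<mu>_def)
    next
      case True
      have "Ck_on k {} f" for k and f :: "real ^ 2 \<Rightarrow> real"
        by (induction k arbitrary: f) (auto simp: differentiable_on_def)
      then show ?thesis using True by simp
    qed
    fix q assume q: "q \<in> U"
    obtain V T where VT: "open V" "q \<in> V" "V \<subseteq> U" "Ck_on 2 V T"
      "\<And>x. x \<in> V \<Longrightarrow> N (X x) = \<sigma> *\<^sub>R sphere_chart (T x)"
      "\<And>x. x \<in> V \<Longrightarrow> X x = support_param \<psi> \<psi>1 (T x)" "\<And>x. x \<in> V \<Longrightarrow> \<mu> (X x) = a * T x $ 1"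
      using chart[OF lp q] by blast
    have dT: "T differentiable at x" if "x \<in> V" for x
      using Ck_on_differentiable[of 1 V T x] VT(1,4) that by (simp add: numeral_2_eq_2)
    have J: "jacobian T q \<noteq> 0"
      using curvature_support_param(1)[OF lp VT(1,3,2) dT[OF VT(2)] \<sigma>2 VT(5,6) d\<psi>] by blast
    have "pd j (\<mu> \<circ> X) x = a * pd j T x $ 1" if x: "x \<in> V" for x j
    proof -
      have "pd j (\<mu> \<circ> X) x = pd j (\<lambda>x. a * T x $ 1) x"
        by (rule pd_cong[OF VT(1) x]) (simp add: VT(7))
      also have "\<dots> = a * pd j T x $ 1"
        by (rule pd_component[OF dT[OF x]])
          (intro bounded_linear_const_mult bounded_linear_vec_nth)
      finally show ?thesis .
    qed
    \<comment> \<open>In Gauss coordinates \<mu> has the constant gradient (a, 0), so g is constant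
      and its derivatives vanish.\<close>
    from laplace_beltrami_third_form[where g="\<lambda>x. a" and X=X and N=N, OF VT(1,2,4) \<sigma>2 VT(5) J this]
    show "laplace_beltrami (third_form N X) (\<mu> \<circ> X) q = 0" by (simp add: pd_const)
  qed
  \<comment> \<open>The HQSF constant is \<sigma> \<kappa>: its \<sigma> cancels the one in the
    support function.\<close>
  moreover have "\<forall>U X. local_parametrization S U X \<longrightarrow>
      (\<forall>q\<in>U. let p = X q; \<Psi> = support_function N p; \<Lambda> = quadratic_distance p;
                 H = mean_curvature N X q; K = gauss_curvature N X q
             in 2 * \<Psi> * H + (\<sigma> * \<kappa> * \<Psi> * exp (2 * \<mu> p) + \<Lambda> - \<Psi>\<^sup>2) * K = 0)"
  proof (intro allI impI ballI)
    fix U X q assume lp: "local_parametrization S U X" and q: "q \<in> U"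
    obtain V T where VT: "open V" "q \<in> V" "V \<subseteq> U" "Ck_on 2 V T"
      "\<And>x. x \<in> V \<Longrightarrow> N (X x) = \<sigma> *\<^sub>R sphere_chart (T x)"
      "\<And>x. x \<in> V \<Longrightarrow> X x = support_param \<psi> \<psi>1 (T x)" "\<And>x. x \<in> V \<Longrightarrow> \<mu> (X x) = a * T x $ 1"
      "\<psi> (T q $ 1) > 0"
      using chart[OF lp q] by metis
    have dT: "T differentiable at q"
      using Ck_on_differentiable[of 1 V T q] VT(1,2,4) by (simp add: numeral_2_eq_2)
    define t where "t = T q $ 1"
    note c = curvature_support_param[OF lp VT(1,3,2) dT \<sigma>2 VT(5,6) d\<psi>, folded t_def]
    have "support_function N (X q) = \<sigma> * \<psi> t"
      unfolding support_function_def VT(5)[OF VT(2)]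
      by (simp add: VT(6)[OF VT(2)] support_param_inner t_def)
    moreover have "quadratic_distance (X q) = (\<psi> t)\<^sup>2 + (\<psi>1 t)\<^sup>2 * (cosh t)\<^sup>2"
      by (simp add: quadratic_distance_def VT(6)[OF VT(2)] support_param_inner t_def)
    moreover have "\<mu> (X q) = a * t" using VT(7)[OF VT(2)] by (simp add: t_def)
    moreover have "- \<psi> t * (2 * \<psi> t + \<psi>2 t * (cosh t)\<^sup>2) + (\<sigma> * (\<sigma> * \<kappa>)) * \<psi> t * exp (2 * (a * t))
        + (\<psi>1 t)\<^sup>2 * (cosh t)\<^sup>2 = 0"
    proof -
      have "(- \<psi> t * (2 * \<psi> t + \<psi>2 t * (cosh t)\<^sup>2) + (\<kappa> * exp (2 * a * t)) * \<psi> t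
        + (\<psi>1 t)\<^sup>2 * (cosh t)\<^sup>2) * (cosh t)\<^sup>2 = 0"
        unfolding \<psi>_def \<psi>1_def \<psi>2_def supp_equation using eq[of t] by simp
      then have "- \<psi> t * (2 * \<psi> t + \<psi>2 t * (cosh t)\<^sup>2) + (\<kappa> * exp (2 * a * t)) * \<psi> t
        + (\<psi>1 t)\<^sup>2 * (cosh t)\<^sup>2 = 0" using c0[of t] by (metis mult_eq_0_iff power_not_zero)
      moreover have "\<sigma> * (\<sigma> * \<kappa>) = \<kappa>" unfolding mult.assoc[symmetric] \<sigma>2 by simp
      ultimately show ?thesis by (simp only:) (simp add: mult_ac)
    qed
    ultimately show "let p = X q; \<Psi> = support_function N p; \<Lambda> = quadratic_distance p;
                 H = mean_curvature N X q; K = gauss_curvature N X q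
             in 2 * \<Psi> * H + (\<sigma> * \<kappa> * \<Psi> * exp (2 * \<mu> p) + \<Lambda> - \<Psi>\<^sup>2) * K = 0"
      using HQSF_equation_support_param[OF \<sigma>2 c(2,3) refl refl, of "\<sigma> * \<kappa>" "exp (2 * (a * t))"]
      by (simp only: Let_def c(4,5))
  qed
  ultimately have "HQSF_surface S N" unfolding HQSF_surface_def using N by blast
  moreover have "surface_of_revolution S"
  proof (rule surface_of_revolution_if_parametrized)
    have sp: "support_param \<psi> \<psi>1 = (\<lambda>x. revolve ((\<lambda>t. \<psi> t / cosh t - \<psi>1 t * sinh t) (x $ 1))
        ((\<lambda>t. - \<psi> t * tanh t - \<psi>1 t) (x $ 1)) (x $ 2))"
      by (simp add: fun_eq_iff support_param_def)
    show "\<exists>U. local_parametrization S U (\<lambda>x. revolve ((\<lambda>t. \<psi> t / cosh t - \<psi>1 t * sinh t) (x $ 1))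
        ((\<lambda>t. - \<psi> t * tanh t - \<psi>1 t) (x $ 1)) (x $ 2)) \<and> p \<in> (\<lambda>x. revolve ((\<lambda>t. \<psi> t / cosh t - \<psi>1 t * sinh t) (x $ 1))
        ((\<lambda>t. - \<psi> t * tanh t - \<psi>1 t) (x $ 1)) (x $ 2)) ` U" if "p \<in> S" for p
      unfolding sp[symmetric] using ex[OF that] by blast
    \<comment> \<open>The radial coordinate is \<open>radius2\<close> divided by cosh.\<close>
    show "\<psi> (q $ 1) / cosh (q $ 1) - \<psi>1 (q $ 1) * sinh (q $ 1) \<noteq> 0"
      if "local_parametrization S U (\<lambda>x. revolve ((\<lambda>t. \<psi> t / cosh t - \<psi>1 t * sinh t) (x $ 1))
        ((\<lambda>t. - \<psi> t * tanh t - \<psi>1 t) (x $ 1)) (x $ 2))" "q \<in> U" for U q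
    proof -
      have "radius2 (\<psi> (q $ 1)) (\<psi>1 (q $ 1)) (q $ 1) \<noteq> 0"
        using rotational_parametrization_normal(2)[OF N that(1)[folded sp] that(2) d\<psi>] .
      then show ?thesis using c0[of "q $ 1"] by (simp add: radius2_def field_simps)
    qed
    show "isCont (\<lambda>t. \<psi> t / cosh t - \<psi>1 t * sinh t) t" for t
      by (intro continuous_intros DERIV_isCont[OF d\<psi>(1)] DERIV_isCont[OF d\<psi>(2)] c0)
  qed
  ultimately show ?thesis by (simp add: HQSF_surface_of_rotation_def)
qed

section \<open>The profile functions\<close>

text \<open>Both implications of the theorem are reduced to this class of functions, in which the
  constants are quantified away.\<close>

definition admissible :: "(real \<Rightarrow> real) \<Rightarrow> bool" where
  "admissible h \<longleftrightarrow> (\<exists>c c1 c2 z1. c \<noteq> 0 \<and> z1 \<noteq> 0 \<and>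
     (Omega c c1 c2 z1 > 0 \<and> (\<exists>a1 a2. h = h1 c c1 c2 z1 a1 a2) \<or>
      Omega c c1 c2 z1 < 0 \<and> (\<exists>b1 b2. h = h2 c c1 c2 z1 b1 b2) \<or>
      Omega c c1 c2 z1 = 0 \<and> (\<exists>a1 a2. h = h3 c c1 c2 z1 a1 a2)))"

lemma admissibleI:
  assumes "c \<noteq> 0" "z1 \<noteq> 0"
  shows "Omega c c1 c2 z1 > 0 \<Longrightarrow> admissible (h1 c c1 c2 z1 a1 a2)"
    "Omega c c1 c2 z1 < 0 \<Longrightarrow> admissible (h2 c c1 c2 z1 b1 b2)"
    "Omega c c1 c2 z1 = 0 \<Longrightarrow> admissible (h3 c c1 c2 z1 a1 a2)"
  using assms unfolding admissible_def by blast+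

text \<open>The common form of \<open>h1\<close>, \<open>h2\<close> and \<open>h3\<close>, with
  \<alpha> = c2 / c + c1 and F a solution of F'' = l F. Only the square of F enters, so F may be
  replaced by -F.\<close>

definition square_profile :: "real \<Rightarrow> (real \<Rightarrow> real) \<Rightarrow> real \<Rightarrow> real" where
  "square_profile \<alpha> F t = exp (2 * \<alpha> * t) * (F t)\<^sup>2 / (1 + exp (2 * t))"

lemma profile_square: "profile (\<lambda>t. exp (2 * a * t) * (F t)\<^sup>2 / 2) = square_profile (a + 1) F"
proof
  fix t
  have "exp (2 * t) * exp (2 * a * t) = exp (2 * (a + 1) * t)"
    by (simp add: exp_add[symmetric] algebra_simps)
  then show "profile (\<lambda>t. exp (2 * a * t) * (F t)\<^sup>2 / 2) t = square_profile (a + 1) F t"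
    by (simp add: profile_def square_profile_def mult.assoc[symmetric])
qed

lemma square_profile_uminus: "square_profile \<alpha> (\<lambda>t. - F t) = square_profile \<alpha> F"
  by (simp add: square_profile_def fun_eq_iff)

text \<open>With d = c c1 - c2, the coefficients of the two exponentials in \<open>h1\<close> are
  nonnegative multiples of \<Omega> + d sqrt \<Omega> and \<Omega> - d sqrt \<Omega>, whose product
  is 4 c \<Omega> |z1|^2. Hence c > 0 realizes P and Q of equal signs and c < 0 those of opposite
  signs, up to replacing F by -F.\<close>

lemma admissible_exp:
  assumes r: "r > 0"
  shows "admissible (square_profile \<alpha> (\<lambda>t. P * exp (r * t) + Q * exp (- r * t)))"
proof -
  have e2: "exp (2 * t) + 1 \<noteq> (0::real)" for t using exp_gt_zero[of "2 * t"] by linarith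
  define z where "z = complex_of_real (r / 2)"
  have z: "z \<noteq> 0" "cmod z = r / 2" using r by (auto simp: z_def)
  have same: "admissible (square_profile \<alpha> (\<lambda>t. P * exp (r * t) + Q * exp (- r * t)))"
    if "P \<ge> 0" "Q \<ge> 0" for P Q
  proof -
    \<comment> \<open>With c = 1 and c1 = c2 the difference d is 0. As |z1| = r / 2, both
      coefficients are \<Omega> = r^2.\<close>
    have O: "Omega 1 (\<alpha> / 2) (\<alpha> / 2) z = r\<^sup>2" by (simp add: Omega_def z power2_eq_square)
    have "h1 1 (\<alpha> / 2) (\<alpha> / 2) z (sqrt (Q / 2)) (sqrt (P / 2)) t
        = square_profile \<alpha> (\<lambda>t. P * exp (r * t) + Q * exp (- r * t)) t" for t
    proof -
      define e where "e = exp (r * t)"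
      have e: "e \<noteq> 0" "exp (2 * (r * t)) = e\<^sup>2" "exp (- r * t) = 1 / e"
        by (simp_all add: e_def exp_double exp_minus inverse_eq_divide)
      have "2 * (\<alpha> - r) * t = 2 * \<alpha> * t - 2 * (r * t)" by (simp add: algebra_simps)
      then have e': "exp (2 * (\<alpha> - r) * t) = exp (2 * \<alpha> * t) / e\<^sup>2" using e by (simp add: exp_diff)
      have s: "(sqrt (Q / 2))\<^sup>2 = Q / 2" "(sqrt (P / 2))\<^sup>2 = P / 2" using that by simp_all
      have "h1 1 (\<alpha> / 2) (\<alpha> / 2) z (sqrt (Q / 2)) (sqrt (P / 2)) t
        = exp (2 * (\<alpha> - r) * t) * (Q / 2 * r\<^sup>2 + P / 2 * exp (2 * (r * t)) * r\<^sup>2)\<^sup>2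
          / (4 * (exp (2 * t) + 1) * (r / 2) ^ 4)"
        unfolding h1_def O Let_def s z using r by (simp add: mult.assoc)
      also have "\<dots> = exp (2 * \<alpha> * t) * (P * e + Q * (1 / e))\<^sup>2 / (1 + exp (2 * t))"
        unfolding e' e(2) using r e(1) e2[of t]
        by (simp add: divide_simps add.commute[of 1]) algebra
      finally show ?thesis unfolding square_profile_def e(3) e_def[symmetric] .
    qed
    then have "h1 1 (\<alpha> / 2) (\<alpha> / 2) z (sqrt (Q / 2)) (sqrt (P / 2))
      = square_profile \<alpha> (\<lambda>t. P * exp (r * t) + Q * exp (- r * t))" by (rule ext)
    moreover have "admissible (h1 1 (\<alpha> / 2) (\<alpha> / 2) z (sqrt (Q / 2)) (sqrt (P / 2)))"
      by (rule admissibleI(1)) (use O r z in simp_all)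
    ultimately show ?thesis by (simp only:)
  qed
  have opp: "admissible (square_profile \<alpha> (\<lambda>t. P * exp (r * t) + Q * exp (- r * t)))"
    if "P \<ge> 0" "Q \<le> 0" for P Q
  proof -
    \<comment> \<open>For c = -1, \<Omega> = d^2 - r^2. The choice d = w r gives \<Omega> = r^2
      again, with coefficients r^2 (1 + w) and r^2 (1 - w) of opposite signs; a1 and a2 scale them
      to P and Q.\<close>
    define w where "w = sqrt (2::real)"
    have w: "w\<^sup>2 = 2" "w > 1" by (simp_all add: w_def)
    define a1 where "a1 = sqrt (P / (2 * (1 + w)))"
    define a2 where "a2 = sqrt (- Q / (2 * (w - 1)))"
    have s: "a1\<^sup>2 = P / (2 * (1 + w))" "a2\<^sup>2 = - Q / (2 * (w - 1))"
    proof -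
      have "0 \<le> P / (2 * (1 + w))" "0 \<le> - Q / (2 * (w - 1))"
        by (rule divide_nonneg_pos; use that w in simp)+
      then show "a1\<^sup>2 = P / (2 * (1 + w))" "a2\<^sup>2 = - Q / (2 * (w - 1))"
        unfolding a1_def a2_def by (simp_all only: real_sqrt_pow2)
    qed
    \<comment> \<open>The solution of -c1 - c2 = w r and c1 - c2 = \<alpha>.\<close>
    define c1 where "c1 = (\<alpha> - w * r) / 2"
    define c2 where "c2 = (- \<alpha> - w * r) / 2"
    have d: "(- 1) * c1 - c2 = w * r" "(- 1) * c1 + c2 = - \<alpha>" by (simp_all add: c1_def c2_def field_simps)
    have O: "Omega (- 1) c1 c2 z = r\<^sup>2" unfolding Omega_def d z
      by (simp add: power_mult_distrib w power_divide)
    have "h1 (- 1) c1 c2 z a1 a2 t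
        = square_profile \<alpha> (\<lambda>t. P * exp (r * t) + Q * exp (- r * t)) t" for t
    proof -
      define e where "e = exp (r * t)"
      have e: "e \<noteq> 0" "exp (- r * t) = 1 / e" "exp (2 * (r * t)) = e\<^sup>2"
        by (simp_all add: e_def exp_double exp_minus inverse_eq_divide)
      have "2 * r * t / - 1 = - (2 * (r * t))"
        "2 * (- \<alpha> - r) * t / - 1 = 2 * \<alpha> * t + 2 * (r * t)" by (simp_all add: algebra_simps)
      then have e': "exp (2 * r * t / - 1) = 1 / e\<^sup>2"
        "exp (2 * (- \<alpha> - r) * t / - 1) = exp (2 * \<alpha> * t) * e\<^sup>2"
        using e by (simp_all only: exp_minus exp_add inverse_eq_divide)
      have sr: "sqrt (r\<^sup>2) = r" using r by simp
      have 1: "a1\<^sup>2 * (r\<^sup>2 + w * r * r) = P * r\<^sup>2 / 2" "a2\<^sup>2 * X * (r\<^sup>2 - w * r * r) = Q * X * r\<^sup>2 / 2" for X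
        unfolding s using w by (simp_all add: field_simps power2_eq_square)
      have "h1 (- 1) c1 c2 z a1 a2 t = exp (2 * \<alpha> * t) * e\<^sup>2 * (P * r\<^sup>2 / 2 + Q * (1 / e\<^sup>2) * r\<^sup>2 / 2)\<^sup>2
        / (4 * (exp (2 * t) + 1) * (r / 2) ^ 4)"
        unfolding h1_def O Let_def z d sr e' 1 by simp
      also have "\<dots> = exp (2 * \<alpha> * t) * (P * e + Q * (1 / e))\<^sup>2 / (1 + exp (2 * t))"
        using r e(1) e2[of t] by (simp add: divide_simps add.commute[of 1]) algebra
      finally show ?thesis unfolding square_profile_def e(2) e_def[symmetric] .
    qed
    then have "h1 (- 1) c1 c2 z a1 a2
      = square_profile \<alpha> (\<lambda>t. P * exp (r * t) + Q * exp (- r * t))" by (rule ext)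
    moreover have "admissible (h1 (- 1) c1 c2 z a1 a2)"
      by (rule admissibleI(1)) (use O r z in simp_all)
    ultimately show ?thesis by (simp only:)
  qed
  have neg: "square_profile \<alpha> (\<lambda>t. P * exp (r * t) + Q * exp (- r * t))
      = square_profile \<alpha> (\<lambda>t. (- P) * exp (r * t) + (- Q) * exp (- r * t))"
    by (subst square_profile_uminus[symmetric]) (simp add: algebra_simps)
  have "P \<ge> 0 \<and> Q \<ge> 0 \<or> - P \<ge> 0 \<and> - Q \<ge> 0 \<or> P \<ge> 0 \<and> Q \<le> 0 \<or> - P \<ge> 0 \<and> - Q \<le> 0" by linarith
  then show ?thesis unfolding neg using same[of "- P" "- Q"] opp[of "- P" "- Q"]
    using same[of P Q, unfolded neg] opp[of P Q, unfolded neg] by blast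
qed

lemma admissible_trig:
  assumes r: "r > 0"
  shows "admissible (square_profile \<alpha> (\<lambda>t. P * cos (r * t) + Q * sin (r * t)))"
proof -
  define z where "z = complex_of_real (r / 2)"
  have z: "z \<noteq> 0" "cmod z = r / 2" using r by (auto simp: z_def)
  \<comment> \<open>b1 and b2 enter \<open>h2\<close> through b1^2 - b2^2 and 2 b1 b2, the real and
    imaginary parts of (b1 + i b2)^2. A complex square root therefore attains every pair of
    coefficients.\<close>
  define b where "b = csqrt (Complex P (- Q))"
  have "b\<^sup>2 = Complex P (- Q)" by (simp add: b_def)
  then have b: "(Re b)\<^sup>2 - (Im b)\<^sup>2 = P" "2 * Re b * Im b = - Q"
    by (auto simp: complex_eq_iff power2_eq_square algebra_simps)
  have O: "Omega (- 1) (\<alpha> / 2) (- \<alpha> / 2) z = - (r\<^sup>2)" by (simp add: Omega_def z power2_eq_square)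
  have "h2 (- 1) (\<alpha> / 2) (- \<alpha> / 2) z (Re b) (Im b) t
      = square_profile \<alpha> (\<lambda>t. P * cos (r * t) + Q * sin (r * t)) t" for t
  proof -
    have e2: "exp (2 * t) + 1 \<noteq> (0::real)" using exp_gt_zero[of "2 * t"] by linarith
    have sr: "sqrt (- (- (r\<^sup>2))) = r" using r by simp
    have "h2 (- 1) (\<alpha> / 2) (- \<alpha> / 2) z (Re b) (Im b) t
      = r\<^sup>2 * exp (2 * \<alpha> * t) / (16 * (exp (2 * t) + 1) * (r / 2) ^ 4)
        * ((- Q * r) * sin (- (r * t)) + (P * r) * cos (- (r * t)))\<^sup>2"
      unfolding h2_def O Let_def z sr b by simp
    also have "\<dots> = square_profile \<alpha> (\<lambda>t. P * cos (r * t) + Q * sin (r * t)) t"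
      unfolding square_profile_def sin_minus cos_minus using r e2
      by (simp add: divide_simps add.commute[of 1]) algebra
    finally show ?thesis .
  qed
  then have "h2 (- 1) (\<alpha> / 2) (- \<alpha> / 2) z (Re b) (Im b)
      = square_profile \<alpha> (\<lambda>t. P * cos (r * t) + Q * sin (r * t))" by (rule ext)
  moreover have "admissible (h2 (- 1) (\<alpha> / 2) (- \<alpha> / 2) z (Re b) (Im b))"
    by (rule admissibleI(2)) (use O r z in simp_all)
  ultimately show ?thesis by (simp only:)
qed

text \<open>With \<open>a\<^sub>2 = 0\<close> the function \<open>h\<^sub>3\<close> vanishes, so the constants are obtained from \<open>h\<^sub>1\<close> instead.\<close>

lemma admissible_linear: "admissible (square_profile \<alpha> (\<lambda>t. P + Q * t))"
proof -
  have neg: "admissible (square_profile \<alpha> (\<lambda>t. P + Q * t))" if "Q < 0" for P Q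
  proof -
    \<comment> \<open>Take c = -1, z1 = 1 and c c1 - c2 = 2, so that \<Omega> = 0. The expression
      squared in \<open>h3\<close> is then -2 a2^2 t - 2 a1 a2 - a2^2; comparison with P + Q t
      determines a2 and a1 and explains Q < 0.\<close>
    define a2 where "a2 = sqrt (- Q / 2)"
    have a2: "a2\<^sup>2 = - Q / 2" "a2 \<noteq> 0" using that by (simp_all add: a2_def)
    define a1 where "a1 = - (P + a2\<^sup>2) / (2 * a2)"
    have a1: "2 * a2 * a1 = - (P + a2\<^sup>2)" using a2 by (simp add: a1_def)
    define c1 where "c1 = (\<alpha> - 2) / 2"
    define c2 where "c2 = (- \<alpha> - 2) / 2"
    have d: "c2 - (- 1) * c1 = - 2" "(- 1) * c1 - c2 = 2" "c2 / - 1 + c1 = \<alpha>"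
      by (simp_all add: c1_def c2_def field_simps)
    have O: "Omega (- 1) c1 c2 1 = 0" unfolding Omega_def d by simp
    have "h3 (- 1) c1 c2 1 a1 a2 t = square_profile \<alpha> (\<lambda>t. P + Q * t) t" for t
    proof -
      have "a2 * ((a1 + a2 * t) * (- 2) + a2 * - 1) = - (2 * a2 * a1) - 2 * a2\<^sup>2 * t - a2\<^sup>2" by algebra
      also have "\<dots> = P + Q * t" unfolding a1 by (simp add: a2)
      finally show ?thesis unfolding h3_def d square_profile_def by (simp add: add.commute mult_ac)
    qed
    then have "h3 (- 1) c1 c2 1 a1 a2 = square_profile \<alpha> (\<lambda>t. P + Q * t)" by (rule ext)
    moreover have "admissible (h3 (- 1) c1 c2 1 a1 a2)"
      by (rule admissibleI(3)) (use O in simp_all)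
    ultimately show ?thesis by (simp only:)
  qed
  consider "Q < 0" | "Q > 0" | "Q = 0" by linarith
  then show ?thesis
  proof cases
    case 1
    then show ?thesis by (rule neg)
  next
    case 2
    have "square_profile \<alpha> (\<lambda>t. P + Q * t) = square_profile \<alpha> (\<lambda>t. (- P) + (- Q) * t)"
      by (subst square_profile_uminus[symmetric]) (simp add: algebra_simps)
    with neg[of "- Q" "- P"] 2 show ?thesis by simp
  next
    case 3
    \<comment> \<open>The constant P is exp(t) times P exp(-t), and raising \<alpha> by 1 absorbs
      the factor exp(t).\<close>
    have "square_profile \<alpha> (\<lambda>t. P + Q * t) t
        = square_profile (\<alpha> + 1) (\<lambda>t. 0 * exp (1 * t) + P * exp (- 1 * t)) t" for t
    proof -
      have "exp (2 * (\<alpha> + 1) * t) * (exp (- t))\<^sup>2 = exp (2 * \<alpha> * t)"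
        by (simp add: exp_double[symmetric] exp_add[symmetric] algebra_simps)
      then show ?thesis by (simp add: square_profile_def power_mult_distrib 3 mult.left_commute)
    qed
    then have "square_profile \<alpha> (\<lambda>t. P + Q * t)
        = square_profile (\<alpha> + 1) (\<lambda>t. 0 * exp (1 * t) + P * exp (- 1 * t))" by (rule ext)
    with admissible_exp[of 1 "\<alpha> + 1" 0 P] show ?thesis by (simp only: zero_less_one)
  qed
qed

section \<open>Differential equations for the profile\<close>

lemma derivative_zero_constant:
  fixes f :: "real \<Rightarrow> real"
  assumes "convex I" "\<And>t. t \<in> I \<Longrightarrow> (f has_real_derivative 0) (at t)"
  shows "\<exists>k. \<forall>t\<in>I. f t = k"
  using has_field_derivative_zero_constant[OF assms(1)] assms(2) has_field_derivative_at_within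
  by blast

text \<open>In each case two first integrals, such as (F' - r F) exp(rt) for l = r^2, have
  derivative 0, and F is recovered from their constant values.\<close>

lemma second_order_linear_admissible:
  assumes I: "convex I"
    and F: "\<And>t. t \<in> I \<Longrightarrow> (F has_real_derivative F1 t) (at t)"
    and F1: "\<And>t. t \<in> I \<Longrightarrow> (F1 has_real_derivative l * F t) (at t)"
  shows "\<exists>h. admissible h \<and> (\<forall>t\<in>I. square_profile \<alpha> F t = h t)"
proof -
  note const = derivative_zero_constant[OF I]
  have cong: "square_profile \<alpha> F t = square_profile \<alpha> F' t" if "F t = F' t" for F' t
    using that by (simp add: square_profile_def)
  consider "l > 0" | "l < 0" | "l = 0" by linarith
  then show ?thesis
  proof cases
    case 1
    define r where "r = sqrt l"
    have r: "r > 0" "r * r = l" using 1 by (simp_all add: r_def)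
    have "((\<lambda>t. (F1 t - r * F t) * exp (r * t)) has_real_derivative 0) (at t)" if "t \<in> I" for t
      using F[OF that] F1[OF that]
      by (auto intro!: derivative_eq_intros simp: r(2)[symmetric] algebra_simps)
    then obtain k1 where k1: "\<And>t. t \<in> I \<Longrightarrow> (F1 t - r * F t) * exp (r * t) = k1"
      using const[of "\<lambda>t. (F1 t - r * F t) * exp (r * t)"] by blast
    have "((\<lambda>t. (F1 t + r * F t) * exp (- r * t)) has_real_derivative 0) (at t)" if "t \<in> I" for t
      using F[OF that] F1[OF that]
      by (auto intro!: derivative_eq_intros simp: r(2)[symmetric] algebra_simps)
    then obtain k2 where k2: "\<And>t. t \<in> I \<Longrightarrow> (F1 t + r * F t) * exp (- r * t) = k2"
      using const[of "\<lambda>t. (F1 t + r * F t) * exp (- r * t)"] by blast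
    have "F t = (k2 / (2 * r)) * exp (r * t) + (- k1 / (2 * r)) * exp (- r * t)" if "t \<in> I" for t
      unfolding k1[OF that, symmetric] k2[OF that, symmetric] using r(1)
      by (simp add: field_simps exp_minus)
    then have "\<forall>t\<in>I. square_profile \<alpha> F t
      = square_profile \<alpha> (\<lambda>t. (k2 / (2 * r)) * exp (r * t) + (- k1 / (2 * r)) * exp (- r * t)) t"
      by (intro ballI cong)
    then show ?thesis using admissible_exp[OF r(1), of \<alpha> "k2 / (2 * r)" "- k1 / (2 * r)"] by blast
  next
    case 2
    define r where "r = sqrt (- l)"
    have r: "r > 0" "l = - (r * r)" using 2 by (simp_all add: r_def)
    have "((\<lambda>t. r * F t * cos (r * t) - F1 t * sin (r * t)) has_real_derivative 0) (at t)" if "t \<in> I" for t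
      using F[OF that] F1[OF that] unfolding r(2)
      by (auto intro!: derivative_eq_intros simp: algebra_simps)
    then obtain k1 where k1: "\<And>t. t \<in> I \<Longrightarrow> r * F t * cos (r * t) - F1 t * sin (r * t) = k1"
      using const[of "\<lambda>t. r * F t * cos (r * t) - F1 t * sin (r * t)"] by blast
    have "((\<lambda>t. r * F t * sin (r * t) + F1 t * cos (r * t)) has_real_derivative 0) (at t)" if "t \<in> I" for t
      using F[OF that] F1[OF that] unfolding r(2)
      by (auto intro!: derivative_eq_intros simp: algebra_simps)
    then obtain k2 where k2: "\<And>t. t \<in> I \<Longrightarrow> r * F t * sin (r * t) + F1 t * cos (r * t) = k2"
      using const[of "\<lambda>t. r * F t * sin (r * t) + F1 t * cos (r * t)"] by blast
    have "F t = (k1 / r) * cos (r * t) + (k2 / r) * sin (r * t)" if "t \<in> I" for t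
    proof -
      have "k1 * cos (r * t) + k2 * sin (r * t) = r * F t * ((sin (r * t))\<^sup>2 + (cos (r * t))\<^sup>2)"
        unfolding k1[OF that, symmetric] k2[OF that, symmetric] by algebra
      then have "k1 * cos (r * t) + k2 * sin (r * t) = r * F t" by simp
      then show ?thesis using r(1) by (simp add: field_simps)
    qed
    then have "\<forall>t\<in>I. square_profile \<alpha> F t
      = square_profile \<alpha> (\<lambda>t. (k1 / r) * cos (r * t) + (k2 / r) * sin (r * t)) t"
      by (intro ballI cong)
    then show ?thesis using admissible_trig[OF r(1), of \<alpha> "k1 / r" "k2 / r"] by blast
  next
    case 3
    have "(F1 has_real_derivative 0) (at t)" if "t \<in> I" for t using F1[OF that] 3 by simp
    then obtain k1 where k1: "\<And>t. t \<in> I \<Longrightarrow> F1 t = k1" using const[of F1] by blast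
    have "((\<lambda>t. F t - k1 * t) has_real_derivative 0) (at t)" if "t \<in> I" for t
      using F[OF that] k1[OF that] by (auto intro!: derivative_eq_intros)
    then obtain k2 where "\<And>t. t \<in> I \<Longrightarrow> F t - k1 * t = k2"
      using const[of "\<lambda>t. F t - k1 * t"] by blast
    then have "F t = k2 + k1 * t" if "t \<in> I" for t using that by (metis add.commute diff_add_cancel)
    then have "\<forall>t\<in>I. square_profile \<alpha> F t = square_profile \<alpha> (\<lambda>t. k2 + k1 * t) t"
      by (intro ballI cong)
    then show ?thesis using admissible_linear[of \<alpha> k2 k1] by blast
  qed
qed

text \<open>Put \<open>F = exp (- a t) sqrt (2 G)\<close>. Then \<open>L = F' / F\<close> satisfies \<open>L' = \<kappa> / F\<^sup>2\<close>, hence \<open>\<kappa> / F\<^sup>2 + L\<^sup>2\<close>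
  is a constant \<open>l\<close> and \<open>F'' = l F\<close>.\<close>

lemma Liouville_equation_admissible:
  assumes I: "convex I"
    and G: "\<And>t. t \<in> I \<Longrightarrow> (G has_real_derivative G1 t) (at t)"
    and G1: "\<And>t. t \<in> I \<Longrightarrow> (G1 has_real_derivative G2 t) (at t)"
    and pos: "\<And>t. t \<in> I \<Longrightarrow> G t > 0"
    and eq: "\<And>t. t \<in> I \<Longrightarrow> G t * G2 t - (G1 t)\<^sup>2 = \<kappa> * exp (2 * a * t) * G t"
  shows "\<exists>h. admissible h \<and> (\<forall>t\<in>I. profile G t = h t)"
proof -
  define F where "F t = exp (- a * t) * sqrt (2 * G t)" for t
  define L where "L t = G1 t / (2 * G t) - a" for t
  have F0: "F t > 0" if "t \<in> I" for t using pos[OF that] by (simp add: F_def)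
  have FG: "exp (2 * a * t) * (F t)\<^sup>2 / 2 = G t" if "t \<in> I" for t
  proof -
    have "exp (2 * a * t) * (exp (- a * t))\<^sup>2 = 1"
      by (simp add: exp_double[symmetric] exp_add[symmetric] algebra_simps)
    moreover have "exp (2 * a * t) * (F t)\<^sup>2 = (exp (2 * a * t) * (exp (- a * t))\<^sup>2) * (2 * G t)"
      using pos[OF that] by (simp add: F_def power_mult_distrib)
    ultimately show ?thesis by simp
  qed
  have dF: "(F has_real_derivative L t * F t) (at t)" if t: "t \<in> I" for t
  proof -
    have s: "sqrt (2 * G t) \<noteq> 0" "G t = sqrt (2 * G t) * sqrt (2 * G t) / 2" using pos[OF t] by simp_all
    have e: "inverse (sqrt (2 * G t)) / 2 * (2 * G1 t) = G1 t / (2 * G t) * sqrt (2 * G t)"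
      using s by (simp add: field_simps)
    have "((\<lambda>t. sqrt (2 * G t)) has_real_derivative inverse (sqrt (2 * G t)) / 2 * (2 * G1 t)) (at t)"
      using pos[OF t] by (intro DERIV_chain2[OF DERIV_real_sqrt] DERIV_cmult G t) simp
    then have d: "((\<lambda>t. sqrt (2 * G t)) has_real_derivative G1 t / (2 * G t) * sqrt (2 * G t)) (at t)"
      unfolding e .
    have "((\<lambda>t. exp (- a * t) * sqrt (2 * G t)) has_real_derivative L t * F t) (at t)"
      unfolding L_def F_def by (rule derivative_eq_intros d refl | simp)+ (simp add: algebra_simps)
    then show ?thesis by (simp add: F_def[abs_def])
  qed
  have dL: "(L has_real_derivative \<kappa> / (F t)\<^sup>2) (at t)" if t: "t \<in> I" for t
  proof -
    have G0: "G t \<noteq> 0" using pos[OF t] by simp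
    have "(L has_real_derivative (G2 t * (2 * G t) - G1 t * (2 * G1 t)) / (2 * G t * (2 * G t))) (at t)"
      unfolding L_def[abs_def] using G[OF t] G1[OF t] G0 by (auto intro!: derivative_eq_intros)
    moreover have "(G2 t * (2 * G t) - G1 t * (2 * G1 t)) / (2 * G t * (2 * G t))
        = (G t * G2 t - (G1 t)\<^sup>2) / (2 * (G t)\<^sup>2)"
      using G0 by (simp add: field_simps power2_eq_square)
    moreover have "(G t * G2 t - (G1 t)\<^sup>2) / (2 * (G t)\<^sup>2) = \<kappa> * exp (2 * a * t) / (2 * G t)"
      unfolding eq[OF t] using G0 by (simp add: field_simps power2_eq_square)
    moreover have "\<kappa> * exp (2 * a * t) / (2 * G t) = \<kappa> / (F t)\<^sup>2"
      unfolding FG[OF t, symmetric] using F0[OF t] by simp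
    ultimately show ?thesis by simp
  qed
  have "((\<lambda>t. \<kappa> / (F t)\<^sup>2 + (L t)\<^sup>2) has_real_derivative 0) (at t)" if t: "t \<in> I" for t
  proof -
    have "((\<lambda>t. \<kappa> / (F t)\<^sup>2 + (L t)\<^sup>2) has_real_derivative
      (0 * (F t)\<^sup>2 - \<kappa> * (2 * F t * (L t * F t))) / ((F t)\<^sup>2 * (F t)\<^sup>2) + 2 * L t * (\<kappa> / (F t)\<^sup>2)) (at t)"
    proof -
      have "((\<lambda>t. (F t)\<^sup>2) has_real_derivative 2 * F t * (L t * F t)) (at t)"
        "((\<lambda>t. (L t)\<^sup>2) has_real_derivative 2 * L t * (\<kappa> / (F t)\<^sup>2)) (at t)"
        using dF[OF t] dL[OF t] by (auto intro!: derivative_eq_intros)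
      moreover have "(F t)\<^sup>2 \<noteq> 0" using F0[OF t] by simp
      ultimately show ?thesis by (intro DERIV_add DERIV_divide DERIV_const)
    qed
    moreover have "(0 * (F t)\<^sup>2 - \<kappa> * (2 * F t * (L t * F t))) / ((F t)\<^sup>2 * (F t)\<^sup>2) + 2 * L t * (\<kappa> / (F t)\<^sup>2) = 0"
      using F0[OF t] by (simp add: field_simps power2_eq_square)
    ultimately show ?thesis by simp
  qed
  then obtain l where l: "\<And>t. t \<in> I \<Longrightarrow> \<kappa> / (F t)\<^sup>2 + (L t)\<^sup>2 = l"
    using derivative_zero_constant[OF I, of "\<lambda>t. \<kappa> / (F t)\<^sup>2 + (L t)\<^sup>2"] by blast
  have "((\<lambda>t. L t * F t) has_real_derivative l * F t) (at t)" if t: "t \<in> I" for t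
  proof -
    have "((\<lambda>t. L t * F t) has_real_derivative \<kappa> / (F t)\<^sup>2 * F t + L t * F t * L t) (at t)"
      using DERIV_mult[OF dL[OF t] dF[OF t]] .
    then show ?thesis unfolding l[OF t, symmetric] by (simp add: algebra_simps power2_eq_square)
  qed
  from second_order_linear_admissible[OF I dF this, of "a + 1"]
  obtain h where h: "admissible h" "\<And>t. t \<in> I \<Longrightarrow> square_profile (a + 1) F t = h t" by blast
  have "profile G t = h t" if "t \<in> I" for t
    using h(2)[OF that] FG[OF that] unfolding profile_square[symmetric] by (simp add: profile_def)
  with h(1) show ?thesis by blast
qed

section \<open>Normal form and analyticity of the profile functions\<close>

text \<open>The entire extension E of F serves the identity theorem in
  \<open>admissible_eq_if_eq_near\<close>.\<close>

lemma admissible_square_profile: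
  assumes "admissible h"
  obtains \<alpha> F F1 l E where "h = square_profile \<alpha> F"
    "\<And>t. (F has_real_derivative F1 t) (at t)" "\<And>t. (F1 has_real_derivative l * F t) (at t)"
    "E holomorphic_on UNIV" "\<And>t. E (complex_of_real t) = complex_of_real (F t)"
proof -
  obtain c c1 c2 z1 where c: "c \<noteq> 0" and z: "z1 \<noteq> 0" and h:
    "Omega c c1 c2 z1 > 0 \<and> (\<exists>a1 a2. h = h1 c c1 c2 z1 a1 a2) \<or>
     Omega c c1 c2 z1 < 0 \<and> (\<exists>b1 b2. h = h2 c c1 c2 z1 b1 b2) \<or>
     Omega c c1 c2 z1 = 0 \<and> (\<exists>a1 a2. h = h3 c c1 c2 z1 a1 a2)"
    using assms unfolding admissible_def by blast
  define \<alpha> where "\<alpha> = c2 / c + c1"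
  define W where "W = Omega c c1 c2 z1"
  define d where "d = c * c1 - c2"
  define n where "n = cmod z1"
  have n: "n \<noteq> 0" using z by (simp add: n_def)
  have e2: "exp (2 * t) + 1 \<noteq> (0::real)" for t using exp_gt_zero[of "2 * t"] by linarith
  from h consider (1) a1 a2 where "W > 0" "h = h1 c c1 c2 z1 a1 a2"
    | (2) b1 b2 where "W < 0" "h = h2 c c1 c2 z1 b1 b2" | (3) a1 a2 where "h = h3 c c1 c2 z1 a1 a2"
    unfolding W_def by blast
  then show thesis
  proof cases
    case 1
    \<comment> \<open>The rate s has the sign of c. Pulling exp(-2 s t) into the square and dividing
      by 2 c n^2, a root of 4 c^2 n^4, gives A and B.\<close>
    define s where "s = sqrt W / c"
    define A where "A = a1\<^sup>2 * (W + d * sqrt W) / (2 * c * n\<^sup>2)"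
    define B where "B = a2\<^sup>2 * (W - d * sqrt W) / (2 * c * n\<^sup>2)"
    have "h t = square_profile \<alpha> (\<lambda>t. A * exp (- (s * t)) + B * exp (s * t)) t" for t
    proof -
      define e where "e = exp (s * t)"
      have e: "e \<noteq> 0" "exp (- (s * t)) = 1 / e" "exp (2 * (s * t)) = e\<^sup>2"
        by (simp_all add: e_def exp_double exp_minus inverse_eq_divide)
      have "2 * sqrt W * t / c = 2 * (s * t)"
        "2 * (c * c1 + c2 - sqrt W) * t / c = 2 * \<alpha> * t - 2 * (s * t)"
        using c by (simp_all add: s_def \<alpha>_def field_simps)
      then have e': "exp (2 * sqrt W * t / c) = e\<^sup>2"
        "exp (2 * (c * c1 + c2 - sqrt W) * t / c) = exp (2 * \<alpha> * t) / e\<^sup>2"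
        using e by (simp_all only: exp_diff)
      have "h t = exp (2 * \<alpha> * t) / e\<^sup>2 * (a1\<^sup>2 * (W + d * sqrt W) + a2\<^sup>2 * e\<^sup>2 * (W - d * sqrt W))\<^sup>2
          / (4 * c\<^sup>2 * (exp (2 * t) + 1) * n ^ 4)"
        unfolding 1(2) h1_def Let_def W_def[symmetric] d_def[symmetric] n_def[symmetric] e' ..
      also have "\<dots> = exp (2 * \<alpha> * t) * (A * (1 / e) + B * e)\<^sup>2 / (1 + exp (2 * t))"
        unfolding A_def B_def using c n e(1) e2[of t]
        by (simp add: divide_simps add.commute[of 1]) algebra
      finally show ?thesis unfolding square_profile_def e(2) e_def[symmetric] .
    qed
    then have hs: "h = square_profile \<alpha> (\<lambda>t. A * exp (- (s * t)) + B * exp (s * t))" by (rule ext)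
    show thesis
    proof (rule that[OF hs])
      show "((\<lambda>t. A * exp (- (s * t)) + B * exp (s * t)) has_real_derivative
        (s * (B * exp (s * t)) - s * (A * exp (- (s * t))))) (at t)" for t
        by (auto intro!: derivative_eq_intros)
      show "((\<lambda>t. s * (B * exp (s * t)) - s * (A * exp (- (s * t)))) has_real_derivative
        (s * s) * (A * exp (- (s * t)) + B * exp (s * t))) (at t)" for t
        by (auto intro!: derivative_eq_intros simp: algebra_simps)
      show "(\<lambda>z. complex_of_real A * exp (- (complex_of_real s * z)) + complex_of_real B * exp (complex_of_real s * z)) holomorphic_on UNIV"
        by (intro holomorphic_intros)
      show "complex_of_real A * exp (- (complex_of_real s * complex_of_real t))
          + complex_of_real B * exp (complex_of_real s * complex_of_real t)
        = complex_of_real (A * exp (- (s * t)) + B * exp (s * t))" for t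
        by (simp add: exp_of_real[symmetric])
    qed
  next
    case 2
    define w where "w = sqrt (- W)"
    have w: "w * w = - W" using 2 by (simp add: w_def)
    define s where "s = w / c"
    \<comment> \<open>The prefactor -\<Omega> is w^2, so w goes into the square, divided by the root
      4 c n^2 of 16 c^2 n^4.\<close>
    define A where "A = ((b1\<^sup>2 - b2\<^sup>2) * d + 2 * b1 * b2 * w) * w / (4 * c * n\<^sup>2)"
    define B where "B = ((b1\<^sup>2 - b2\<^sup>2) * w - 2 * b1 * b2 * d) * w / (4 * c * n\<^sup>2)"
    have "h t = square_profile \<alpha> (\<lambda>t. A * sin (s * t) + B * cos (s * t)) t" for t
    proof -
      have st: "w * t / c = s * t" by (simp add: s_def)
      have "h t = (w * w * exp (2 * \<alpha> * t)) / (16 * c\<^sup>2 * (exp (2 * t) + 1) * n ^ 4)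
          * (((b1\<^sup>2 - b2\<^sup>2) * d + 2 * b1 * b2 * w) * sin (s * t)
            + ((b1\<^sup>2 - b2\<^sup>2) * w - 2 * b1 * b2 * d) * cos (s * t))\<^sup>2"
        unfolding 2(2) h2_def Let_def W_def[symmetric] d_def[symmetric] n_def[symmetric] w_def[symmetric]
          st w \<alpha>_def ..
      also have "\<dots> = square_profile \<alpha> (\<lambda>t. A * sin (s * t) + B * cos (s * t)) t"
        unfolding square_profile_def A_def B_def using c n e2[of t]
        by (simp add: divide_simps add.commute[of 1]) algebra
      finally show ?thesis .
    qed
    then have hs: "h = square_profile \<alpha> (\<lambda>t. A * sin (s * t) + B * cos (s * t))" by (rule ext)
    show thesis
    proof (rule that[OF hs])
      show "((\<lambda>t. A * sin (s * t) + B * cos (s * t)) has_real_derivative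
        (s * (A * cos (s * t)) - s * (B * sin (s * t)))) (at t)" for t
        by (auto intro!: derivative_eq_intros)
      show "((\<lambda>t. s * (A * cos (s * t)) - s * (B * sin (s * t))) has_real_derivative
        (- (s * s)) * (A * sin (s * t) + B * cos (s * t))) (at t)" for t
        by (auto intro!: derivative_eq_intros simp: algebra_simps)
      show "(\<lambda>z. complex_of_real A * sin (complex_of_real s * z) + complex_of_real B * cos (complex_of_real s * z)) holomorphic_on UNIV"
        by (intro holomorphic_intros)
      show "complex_of_real A * sin (complex_of_real s * complex_of_real t)
          + complex_of_real B * cos (complex_of_real s * complex_of_real t)
        = complex_of_real (A * sin (s * t) + B * cos (s * t))" for t
        by (simp add: sin_of_real[symmetric] cos_of_real[symmetric])
    qed
  next
    case 3
    define A where "A = a2 * (a1 * (- d) + a2 * c) / n\<^sup>2"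
    define B where "B = a2 * a2 * (- d) / n\<^sup>2"
    have "h t = square_profile \<alpha> (\<lambda>t. A + B * t) t" for t
    proof -
      have "c2 - c * c1 = - d" by (simp add: d_def)
      then have "h t = exp (2 * \<alpha> * t) * (a2 * ((a1 + a2 * t) * (- d) + a2 * c))\<^sup>2 / ((exp (2 * t) + 1) * n ^ 4)"
        by (simp only: 3 h3_def n_def[symmetric] \<alpha>_def)
      also have "\<dots> = square_profile \<alpha> (\<lambda>t. A + B * t) t"
        unfolding square_profile_def A_def B_def using n e2[of t]
        by (simp add: divide_simps add.commute[of 1]) algebra
      finally show ?thesis .
    qed
    then have hs: "h = square_profile \<alpha> (\<lambda>t. A + B * t)" by (rule ext)
    show thesis
    proof (rule that[OF hs])
      show "((\<lambda>t. A + B * t) has_real_derivative B) (at t)" for t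
        by (auto intro!: derivative_eq_intros)
      show "((\<lambda>t. B) has_real_derivative 0 * (A + B * t)) (at t)" for t by simp
      show "(\<lambda>z. complex_of_real A + complex_of_real B * z) holomorphic_on UNIV"
        by (intro holomorphic_intros)
    qed simp
  qed
qed

text \<open>A profile function extends meromorphically, with possible poles where exp(2z) = -1.
  Multiplied by 1 + exp(2t) it extends to an entire function, and the identity theorem applies to
  two of these agreeing on an interval of the real line.\<close>

lemma admissible_eq_if_eq_near:
  assumes h: "admissible h" "admissible h'" and d: "d > 0"
    and eq: "\<And>t. \<bar>t - t0\<bar> < d \<Longrightarrow> h t = h' t"
  shows "h = h'"
proof -
  have cplx: "\<exists>H. H holomorphic_on UNIV \<and> (\<forall>t. H (complex_of_real t) = complex_of_real (h t * (1 + exp (2 * t))))"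
    if h: "admissible h" for h
  proof -
    obtain \<alpha> F F1 l E where E: "h = square_profile \<alpha> F" "E holomorphic_on UNIV"
      "\<And>t. E (complex_of_real t) = complex_of_real (F t)"
      using admissible_square_profile[OF h] by metis
    have p: "1 + exp (2 * t) \<noteq> (0::real)" for t using exp_gt_zero[of "2 * t"] by linarith
    define H where "H z = exp (2 * complex_of_real \<alpha> * z) * (E z)\<^sup>2" for z
    have "H holomorphic_on UNIV" unfolding H_def[abs_def] by (intro holomorphic_intros E(2))
    moreover have "H (complex_of_real t) = complex_of_real (h t * (1 + exp (2 * t)))" for t
      unfolding H_def E(1,3) square_profile_def using p[of t] by (simp add: exp_of_real[symmetric])
    ultimately show ?thesis by blast
  qed
  obtain H H' where H: "H holomorphic_on UNIV" "\<And>t. H (complex_of_real t) = complex_of_real (h t * (1 + exp (2 * t)))"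
    "H' holomorphic_on UNIV" "\<And>t. H' (complex_of_real t) = complex_of_real (h' t * (1 + exp (2 * t)))"
    using cplx[OF h(1)] cplx[OF h(2)] by blast
  define U where "U = complex_of_real ` {t. \<bar>t - t0\<bar> < d}"
  have lim: "complex_of_real t0 islimpt U"
    unfolding islimpt_approachable
  proof (intro allI impI)
    fix e :: real assume e: "e > 0"
    define t where "t = t0 + min d e / 2"
    have t: "\<bar>t - t0\<bar> < d" "t \<noteq> t0" "\<bar>t - t0\<bar> < e" using d e by (auto simp: t_def)
    then have "complex_of_real t \<in> U" unfolding U_def by blast
    with t show "\<exists>x\<in>U. x \<noteq> complex_of_real t0 \<and> dist x (complex_of_real t0) < e"
      by (intro bexI[of _ "complex_of_real t"]) (auto simp: dist_norm norm_of_real simp flip: of_real_diff)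
  qed
  have "H w - H' w = 0" for w
    by (rule analytic_continuation[of "\<lambda>w. H w - H' w" UNIV U "complex_of_real t0"])
      (auto simp: U_def H eq intro!: holomorphic_intros H(1,3) lim[unfolded U_def])
  then have "complex_of_real (h t * (1 + exp (2 * t))) = complex_of_real (h' t * (1 + exp (2 * t)))" for t
    unfolding H(2,4)[symmetric] by simp
  then have "h t * (1 + exp (2 * t)) = h' t * (1 + exp (2 * t))" for t by (simp only: of_real_eq_iff)
  moreover have "1 + exp (2 * t) \<noteq> (0::real)" for t using exp_gt_zero[of "2 * t"] by linarith
  ultimately have "h t = h' t" for t by (metis mult_right_cancel)
  then show ?thesis by (rule ext)
qed

text \<open>This reverses \<open>Liouville_equation_admissible\<close>: if F'' = l F, then l F^2 -
  F'^2 is constant, and this constant is \<kappa>. The shift a = \<alpha> - 1 accounts for the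
  factor exp(2t) in \<open>profile\<close>.\<close>

lemma admissible_profile:
  assumes "admissible h"
  obtains G G1 G2 \<kappa> a where "h = profile G"
    "\<And>t. (G has_real_derivative G1 t) (at t)" "\<And>t. (G1 has_real_derivative G2 t) (at t)"
    "\<And>t. G t \<ge> 0" "\<And>t. G t * G2 t - (G1 t)\<^sup>2 = \<kappa> * exp (2 * a * t) * G t"
proof -
  obtain \<alpha> F F1 l where h: "h = square_profile \<alpha> F"
    and F: "\<And>t. (F has_real_derivative F1 t) (at t)" "\<And>t. (F1 has_real_derivative l * F t) (at t)"
    using admissible_square_profile[OF assms] by metis
  define a where "a = \<alpha> - 1"
  have "((\<lambda>t. l * (F t)\<^sup>2 - (F1 t)\<^sup>2) has_real_derivative 0) (at t)" for t
    using F[of t] by (auto intro!: derivative_eq_intros)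
  then obtain \<kappa> where \<kappa>: "\<And>t. l * (F t)\<^sup>2 - (F1 t)\<^sup>2 = \<kappa>"
    using derivative_zero_constant[of UNIV "\<lambda>t. l * (F t)\<^sup>2 - (F1 t)\<^sup>2"] by auto
  define e where "e t = exp (2 * a * t)" for t
  have e: "(e has_real_derivative 2 * a * e t) (at t)" for t
    unfolding e_def[abs_def] by (auto intro!: derivative_eq_intros)
  define G where "G t = e t * (F t)\<^sup>2 / 2" for t
  define G1 where "G1 t = e t * (a * (F t)\<^sup>2 + F t * F1 t)" for t
  define G2 where "G2 t = 2 * a * e t * (a * (F t)\<^sup>2 + F t * F1 t)
    + e t * (2 * a * F t * F1 t + F1 t * F1 t + F t * (l * F t))" for t
  show thesis
  proof (rule that[of G G1 G2 \<kappa> a])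
    show "h = profile G" using profile_square[of a F] h by (simp add: a_def G_def[abs_def] e_def)
    show "(G has_real_derivative G1 t) (at t)" for t
      unfolding G_def[abs_def] G1_def using F[of t] e[of t]
      by (auto intro!: derivative_eq_intros simp: algebra_simps power2_eq_square)
    show "(G1 has_real_derivative G2 t) (at t)" for t
      unfolding G1_def[abs_def] G2_def using F[of t] e[of t]
      by (auto intro!: derivative_eq_intros simp: algebra_simps)
    show "G t \<ge> 0" for t by (simp add: G_def e_def)
    show "G t * G2 t - (G1 t)\<^sup>2 = \<kappa> * exp (2 * a * t) * G t" for t
      unfolding \<kappa>[of t, symmetric] G_def G1_def G2_def e_def[symmetric]
      by (simp add: field_simps power2_eq_square)
  qed
qed

section \<open>From the surface to the parametrization\<close>

lemma rotation_x3_velocity: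
  "((\<lambda>t. rotation_x3 t p) has_vector_derivative vector [- p $ 2, p $ 1, 0]) (at 0)"
proof -
  have "((\<lambda>t. vector [p $ 1 * cos t - p $ 2 * sin t, p $ 1 * sin t + p $ 2 * cos t, p $ 3] :: real ^ 3)
      has_derivative (\<lambda>h. vector [- (p $ 2 * h), p $ 1 * h, 0])) (at 0)"
    by (rule has_derivative_vector_3) (auto intro!: derivative_eq_intros)
  moreover have "(\<lambda>h. vector [- (p $ 2 * h), p $ 1 * h, 0] :: real ^ 3) = (\<lambda>h. h *\<^sub>R vector [- p $ 2, p $ 1, 0])"
    by (simp add: fun_eq_iff vec_eq_iff forall_3 mult.commute)
  ultimately show ?thesis by (simp add: has_vector_derivative_def rotation_x3_def[abs_def])
qed

text \<open>Rotations preserve M, and S agrees with M near p, so S contains an arc of the parallel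
  through p. Its velocity (-p2, p1, 0) is tangent to S.\<close>

lemma normal_orthogonal_parallels:
  assumes N: "oriented_surface S N" and R: "surface_of_revolution S"
    and X: "local_parametrization S U X" and q: "q \<in> U"
  shows "X q $ 1 * N (X q) $ 2 = X q $ 2 * N (X q) $ 1"
proof -
  define p where "p = X q"
  have p: "p \<in> S" using local_parametrizationD(4)[OF X] q by (auto simp: p_def)
  obtain V M where VM: "open V" "p \<in> V" "\<And>\<theta>. rotation_x3 \<theta> ` M = M" "S \<inter> V = M \<inter> V"
    using R p unfolding surface_of_revolution_def by metis
  have r0: "rotation_x3 0 p = p" by (simp add: rotation_x3_def vec_eq_iff forall_3)
  have "((\<lambda>t. rotation_x3 t p) \<longlongrightarrow> p) (at 0)"
    using has_vector_derivative_continuous[OF rotation_x3_velocity[of p]] r0 by (simp add: continuous_at)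
  from topological_tendstoD[OF this VM(1,2)]
  have ev: "\<forall>\<^sub>F t in at 0. rotation_x3 t p \<in> S"
  proof eventually_elim
    case (elim t)
    have "p \<in> M" using p VM by blast
    then have "rotation_x3 t p \<in> M" using VM(3)[of t] by blast
    then show ?case using elim VM(4) by blast
  qed
  have "vector [- p $ 2, p $ 1, 0] \<bullet> N (X q) = 0"
    by (rule curve_velocity_orthogonal[OF X q _ _ rotation_x3_velocity ev])
      (use r0 oriented_surfaceD(2)[OF N X q] in \<open>simp_all add: p_def\<close>)
  then show ?thesis by (simp add: p_def inner_vec_def sum_3)
qed

text \<open>Differentiating p1 N2 = p2 N1 at a point with N1 = N2 = 0 gives p1 dN2 = p2 dN1, and N .
  dN = 0 gives dN3 = 0. As p is off the axis, dN has rank at most one, contrary to nonzero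
  curvature.\<close>

lemma Gauss_map_not_pole:
  assumes N: "oriented_surface S N" and R: "surface_of_revolution S"
    and X: "local_parametrization S U X" and q: "q \<in> U" and K: "gauss_curvature N X q \<noteq> 0"
  shows "(N (X q) $ 1, N (X q) $ 2) \<noteq> (0, 0)"
proof
  assume "(N (X q) $ 1, N (X q) $ 2) = (0, 0)"
  then have n: "N (X q) $ 1 = 0" "N (X q) $ 2 = 0" by simp_all
  define \<nu> where "\<nu> = N \<circ> X"
  note d = oriented_surfaceD[OF N X q, folded \<nu>_def]
  note lp = local_parametrizationD[OF X]
  have dX: "X differentiable at q" using lp(7) q by blast
  have comp: "(\<lambda>x. f x $ i) differentiable at q" if "f differentiable at q" for f :: "real ^ 2 \<Rightarrow> real ^ 3" and i
    using that bounded_linear.has_derivative[OF bounded_linear_vec_nth] unfolding differentiable_def by blast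
  have zero: "X q $ 1 * pd j \<nu> q $ 2 = X q $ 2 * pd j \<nu> q $ 1" for j
  proof -
    have "pd j (\<lambda>x. X x $ 1 * \<nu> x $ 2) q = pd j (\<lambda>x. X x $ 2 * \<nu> x $ 1) q"
      by (rule pd_cong[OF lp(1) q]) (simp add: \<nu>_def normal_orthogonal_parallels[OF N R X])
    moreover have "\<nu> q $ 1 = 0" "\<nu> q $ 2 = 0" using n by (simp_all add: \<nu>_def)
    ultimately show ?thesis
      by (simp add: pd_mult[OF comp[OF dX] comp[OF d(4)]] pd_vec_nth[OF d(4)] pd_vec_nth[OF dX])
  qed
  have n3: "N (X q) $ 3 \<noteq> 0"
    using d(1) n by (auto simp: norm_eq_1 inner_vec_def sum_3)
  have z3: "pd j \<nu> q $ 3 = 0" for j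
    using d(5)[of j] n n3 by (simp add: inner_vec_def sum_3)
  have "X q \<in> S" using lp(4) q by blast
  then have "(X q $ 1, X q $ 2) \<noteq> (0, 0)" using R unfolding surface_of_revolution_def by blast
  then consider "X q $ 1 \<noteq> 0" | "X q $ 2 \<noteq> 0" by auto
  \<comment> \<open>The index of a horizontal component of dN that determines the other two.\<close>
  then obtain k :: 3 where k: "\<And>i j. pd 2 \<nu> q $ k * pd 1 \<nu> q $ i = pd 1 \<nu> q $ k * pd 2 \<nu> q $ i"
    and k0: "\<And>j. pd j \<nu> q $ k = 0 \<Longrightarrow> pd j \<nu> q = 0"
  proof cases
    case 1
    have e: "pd j \<nu> q $ 2 = X q $ 2 / X q $ 1 * pd j \<nu> q $ 1" for j using zero[of j] 1 by (simp add: field_simps)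
    show thesis
    proof (rule that[of 1])
      show "pd 2 \<nu> q $ 1 * pd 1 \<nu> q $ i = pd 1 \<nu> q $ 1 * pd 2 \<nu> q $ i" for i
        using exhaust_3[of i] e z3 by auto
      show "pd j \<nu> q = 0" if "pd j \<nu> q $ 1 = 0" for j
        using that e[of j] z3 by (simp add: vec_eq_iff forall_3)
    qed
  next
    case 2
    have e: "pd j \<nu> q $ 1 = X q $ 1 / X q $ 2 * pd j \<nu> q $ 2" for j using zero[of j] 2 by (simp add: field_simps)
    show thesis
    proof (rule that[of 2])
      show "pd 2 \<nu> q $ 2 * pd 1 \<nu> q $ i = pd 1 \<nu> q $ 2 * pd 2 \<nu> q $ i" for i
        using exhaust_3[of i] e z3 by auto
      show "pd j \<nu> q = 0" if "pd j \<nu> q $ 2 = 0" for j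
        using that e[of j] z3 by (simp add: vec_eq_iff forall_3)
    qed
  qed
  note ind = gauss_image_independent[OF N X q K, folded \<nu>_def]
  have "pd 2 \<nu> q $ k *\<^sub>R pd 1 \<nu> q + (- pd 1 \<nu> q $ k) *\<^sub>R pd 2 \<nu> q = 0"
    using k by (simp add: vec_eq_iff)
  from ind(2)[OF this] have "pd 1 \<nu> q = 0" using k0[of 1] by simp
  then show False using ind(1)[of 1 0] by simp
qed

text \<open>Where the support function vanishes, the equation reduces to \<Lambda> K = 0, so p is
  the origin, which lies on the axis.\<close>

lemma HQSF_support_nonzero:
  assumes H: "2 * \<Psi> * H + (c * \<Psi> * m + quadratic_distance p - \<Psi>\<^sup>2) * K = (0::real)" and K: "K \<noteq> 0"
    and p: "(p $ 1, p $ 2) \<noteq> (0, 0)"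
  shows "\<Psi> \<noteq> 0"
proof
  assume "\<Psi> = 0"
  then have "p = 0" using H K by (simp add: quadratic_distance_def)
  then show False using p by simp
qed

section \<open>Smoothness of the explicit parametrizations\<close>

lemma Ck_real_on_exp_mult: "Ck_real_on k UNIV (\<lambda>t. exp (a * t))"
proof -
  have "Ck_real_on k UNIV (\<lambda>t. a * t)" by (intro Ck_real_on_mult Ck_real_on_const Ck_real_on_id)
  from Ck_real_on_compose[OF this Ck_real_on_exp[of _ UNIV]] show ?thesis by simp
qed

lemma Ck_real_on_inverse_one_plus_exp: "Ck_real_on k UNIV (\<lambda>t. inverse (1 + exp (2 * t)))"
proof -
  have "Ck_real_on k UNIV (\<lambda>t. 1 + exp (2 * t))"
    by (intro Ck_real_on_add Ck_real_on_const Ck_real_on_exp_mult)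
  from Ck_real_on_compose[OF this Ck_real_on_inverse[of "{0<..}"]] show ?thesis
    by (simp add: image_subset_iff add_pos_pos)
qed

lemma admissible_Ck_real:
  assumes "admissible h"
  shows "Ck_real_on k UNIV h"
proof -
  obtain \<alpha> F F1 l where h: "h = square_profile \<alpha> F"
    and F: "\<And>t. (F has_real_derivative F1 t) (at t)" "\<And>t. (F1 has_real_derivative l * F t) (at t)"
    using admissible_square_profile[OF assms] by metis
  \<comment> \<open>Up to the factor l, F and F1 are derivatives of each other, so their regularity
    is raised simultaneously.\<close>
  have FF: "Ck_real_on k UNIV F \<and> Ck_real_on k UNIV F1" for k
  proof (induction k)
    case 0
    show ?case using F by (auto intro!: continuous_at_imp_continuous_on DERIV_isCont)
  next
    case (Suc k)
    then have "Ck_real_on k UNIV (\<lambda>t. l * F t)" by (intro Ck_real_on_mult Ck_real_on_const) blast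
    with Suc show ?case
      using Ck_real_on_SucI[of UNIV F F1 k] Ck_real_on_SucI[of UNIV F1 "\<lambda>t. l * F t" k] F by blast
  qed
  note e = Ck_real_on_exp_mult and i = Ck_real_on_inverse_one_plus_exp
  have "Ck_real_on k UNIV (\<lambda>t. exp ((2 * \<alpha>) * t) * (F t * F t) * inverse (1 + exp (2 * t)))"
    using FF[of k] by (intro Ck_real_on_mult e i) auto
  then show ?thesis
    by (rule Ck_real_on_cong) (simp add: h square_profile_def power2_eq_square divide_inverse)
qed

lemma smooth_rotational_X:
  assumes h: "admissible h" and U: "open U"
  shows "smooth_map_on U (rotational_X h)"
  unfolding smooth_map_on_def
proof
  fix k
  have hk: "Ck_real_on k UNIV h" "Ck_real_on k UNIV (deriv h)"
    using admissible_Ck_real[OF h] Ck_real_on_deriv by blast+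
  note e = Ck_real_on_exp_mult and i = Ck_real_on_inverse_one_plus_exp
  have "Ck_real_on k UNIV (\<lambda>t. ((1 + (- 1) * exp (2 * t)) * deriv h t + 2 * exp (2 * t) * h t)
      * (exp ((- 1) * t) * inverse (1 + exp (2 * t))))"
    by (intro Ck_real_on_mult Ck_real_on_add Ck_real_on_const e i hk)
  then have A: "Ck_real_on k UNIV (profile_A h)"
    by (rule Ck_real_on_cong) (simp add: profile_A_def divide_inverse exp_minus)
  have "Ck_real_on k UNIV (\<lambda>t. (- 2) * (deriv h t + (- 1) * h t) * inverse (1 + exp (2 * t)))"
    by (intro Ck_real_on_mult Ck_real_on_add Ck_real_on_const i hk)
  then have B: "Ck_real_on k UNIV (profile_B h)"
    by (rule Ck_real_on_cong) (simp add: profile_B_def divide_inverse)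
  have c: "Ck_on k U (\<lambda>x. x $ i)" for i :: 2
    by (rule Ck_on_linear[OF U bounded_linear_vec_nth])
  have sc: "Ck_on k U (\<lambda>x. cos (x $ i))" "Ck_on k U (\<lambda>x. sin (x $ i))" for i :: 2
    using Ck_on_compose_real[OF U c Ck_real_on_sin_cos[of k UNIV 0 1]]
      Ck_on_compose_real[OF U c Ck_real_on_sin_cos[of k UNIV 1 0]] by simp_all
  have eq: "rotational_X h = (\<lambda>x. (profile_A h (x $ 1) * cos (x $ 2)) *\<^sub>R axis 1 1
      + (profile_A h (x $ 1) * sin (x $ 2)) *\<^sub>R axis 2 1 + profile_B h (x $ 1) *\<^sub>R axis 3 1)"
    by (simp add: fun_eq_iff rotational_X_def vec_eq_iff forall_3 axis_def)
  show "Ck_on k U (rotational_X h)" unfolding eq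
    by (intro Ck_on_add[OF U] Ck_on_bounded_linear[OF U bounded_linear_scaleR_left] Ck_on_mult[OF U]
        sc Ck_on_compose_real[OF U c A] Ck_on_compose_real[OF U c B]) auto
qed

section \<open>Functions of the first coordinate on a box\<close>

lemma differentiable_cong_open:
  assumes "open W" "x \<in> W" "\<And>y. y \<in> W \<Longrightarrow> f y = g y" "g differentiable at x"
  shows "f differentiable at x"
proof -
  obtain g' where "(g has_derivative g') (at x)" using assms(4) by (auto simp: differentiable_def)
  then have "(f has_derivative g') (at x)"
    using has_derivative_transform_within_open[OF _ assms(1,2)] assms(3) by metis
  then show ?thesis by (auto simp: differentiable_def)
qed

lemma pd_2_eq_0:
  fixes f :: "real ^ 2 \<Rightarrow> real"
  assumes D: "open D" "y \<in> D" and f: "f differentiable at y"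
    and const: "\<And>z. z \<in> D \<Longrightarrow> z $ 1 = y $ 1 \<Longrightarrow> f z = f y"
  shows "pd 2 f y = 0"
proof -
  define J where "J = (\<lambda>s. y + s *\<^sub>R axis 2 (1::real)) -` D"
  have "open J" unfolding J_def by (rule open_vimage[OF D(1)]) (intro continuous_intros)
  moreover have "0 \<in> J" using D by (simp add: J_def)
  moreover have "f (y + s *\<^sub>R axis 2 1) = f y" if "s \<in> J" for s
    using that by (intro const) (auto simp: J_def axis_def)
  moreover have "((\<lambda>s. f (y + s *\<^sub>R axis 2 1)) has_real_derivative pd 2 f y) (at 0)"
    using DERIV_pd[of f y 0 2] f by simp
  ultimately have "((\<lambda>s. f y) has_real_derivative pd 2 f y) (at 0)"
    using has_field_derivative_transform_within_open[of "\<lambda>s. f (y + s *\<^sub>R axis 2 1)" _ 0 J "\<lambda>s. f y"] by blast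
  then show ?thesis using DERIV_unique[OF _ DERIV_const] by blast
qed

text \<open>A product of intervals, so that lines parallel to the axes meet it in convex
  sets.\<close>

definition plane_box :: "real \<Rightarrow> real \<Rightarrow> real \<Rightarrow> (real ^ 2) set" where
  "plane_box u v d = {y. y $ 1 \<in> {u - d<..<u + d} \<and> y $ 2 \<in> {v - d<..<v + d}}"

lemma open_plane_box: "open (plane_box u v d)"
  unfolding plane_box_def greaterThanLessThan_iff
  by (intro open_Collect_conj open_Collect_less continuous_intros)

lemma plane_box_subset_ball: "plane_box (q $ 1) (q $ 2) (e / 2) \<subseteq> ball q e"
proof
  fix x assume x: "x \<in> plane_box (q $ 1) (q $ 2) (e / 2)"
  have "norm (x - q) \<le> (\<Sum>i\<in>UNIV. \<bar>(x - q) $ i\<bar>)" by (rule norm_le_l1_cart)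
  also have "\<dots> < e" using x by (auto simp: sum_2 plane_box_def abs_if)
  finally show "x \<in> ball q e" by (simp add: dist_norm norm_minus_commute)
qed

lemma constant_along_2:
  fixes f :: "real ^ 2 \<Rightarrow> real"
  assumes f: "\<And>y. y \<in> plane_box u v d \<Longrightarrow> f differentiable at y"
    and pd: "\<And>y. y \<in> plane_box u v d \<Longrightarrow> pd 2 f y = 0" and y: "y \<in> plane_box u v d"
  shows "f y = f (vector [y $ 1, v])"
proof -
  have e: "(vector [y $ 1, s] :: real ^ 2) = vector [y $ 1, 0] + s *\<^sub>R axis 2 1" for s
    by (simp add: vec_eq_iff forall_2 axis_def)
  have "((\<lambda>s. f (vector [y $ 1, s])) has_real_derivative 0) (at s)" if "s \<in> {v - d<..<v + d}" for s
  proof -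
    have "vector [y $ 1, s] \<in> plane_box u v d" using y that by (simp add: plane_box_def)
    then show ?thesis
      using DERIV_pd[of f "vector [y $ 1, 0]" s 2, folded e, OF f] pd by metis
  qed
  moreover have "convex {v - d<..<v + d}" by (simp add: convex_real_interval)
  ultimately obtain k where k: "\<And>s. s \<in> {v - d<..<v + d} \<Longrightarrow> f (vector [y $ 1, s]) = k"
    using derivative_zero_constant[of "{v - d<..<v + d}" "\<lambda>s. f (vector [y $ 1, s])"] by blast
  have "y = vector [y $ 1, y $ 2]" by (simp add: vec_eq_iff forall_2)
  then have "f y = k" using k[of "y $ 2"] y by (simp add: plane_box_def)
  also have "\<dots> = f (vector [y $ 1, v])" using k[of v] y by (auto simp: plane_box_def)
  finally show ?thesis .
qed

lemma DERIV_along_1: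
  fixes f :: "real ^ 2 \<Rightarrow> real"
  assumes "f differentiable at (vector [t, v])"
  shows "((\<lambda>t. f (vector [t, v])) has_real_derivative pd 1 f (vector [t, v])) (at t)"
proof -
  have e: "(vector [s, v] :: real ^ 2) = vector [0, v] + s *\<^sub>R axis 1 1" for s
    by (simp add: vec_eq_iff forall_2 axis_def)
  show ?thesis using DERIV_pd[of f "vector [0, v]" t 1, folded e, OF assms] .
qed

lemma pd_1_of_first_coordinate:
  fixes f :: "real ^ 2 \<Rightarrow> real"
  assumes D: "open D" "y \<in> D" and f: "\<And>z. z \<in> D \<Longrightarrow> f z = g (z $ 1)"
    and g: "(g has_real_derivative g') (at (y $ 1))"
  shows "pd 1 f y = g'"
proof -
  have c: "((\<lambda>z. z $ 1) has_derivative (\<lambda>v. v $ 1)) (at y)"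
    by (rule bounded_linear_imp_has_derivative[OF bounded_linear_vec_nth])
  have "pd 1 f y = pd 1 (\<lambda>z. g (z $ 1)) y" by (rule pd_cong[OF D f])
  also have "\<dots> = g' * pd 1 (\<lambda>z. z $ 1) y"
    using pd_compose_real(1)[of "\<lambda>z. z $ 1" y g g'] g c by (auto simp: differentiable_def)
  also have "pd 1 (\<lambda>z. z $ 1) y = 1" using pd_eqI[OF c, of 1] by (simp add: axis_def)
  finally show ?thesis by simp
qed

text \<open>A singular T' would make the derivatives of N dependent. This is for the stage before X
  is known to have the form \<open>support_param\<close>, where
  \<open>curvature_support_param\<close> does not apply yet.\<close>

lemma jacobian_nonzero:
  assumes N: "oriented_surface S N" and X: "local_parametrization S U X" and q: "q \<in> U"
    and K: "gauss_curvature N X q \<noteq> 0" and V: "open V" "q \<in> V" and T: "T differentiable at q"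
    and NT: "\<And>x. x \<in> V \<Longrightarrow> N (X x) = \<sigma> *\<^sub>R sphere_chart (T x)"
  shows "jacobian T q \<noteq> 0"
proof
  assume J: "jacobian T q = 0"
  define a where "a j = pd j T q $ 1" for j
  define b where "b j = pd j T q $ 2" for j
  have J': "a 1 * b 2 = a 2 * b 1" using J by (simp add: jacobian_def a_def b_def)
  have dN: "pd j (N \<circ> X) q = \<sigma> *\<^sub>R (a j *\<^sub>R sphere_chart1 (T q) + b j *\<^sub>R sphere_chart2 (T q))" for j
    unfolding a_def b_def by (rule pd_gauss_map[where V=V and N=N and X=X, OF V T NT])
  note ind = gauss_image_independent[OF N X q K]
  have "b 2 *\<^sub>R pd 1 (N \<circ> X) q + (- b 1) *\<^sub>R pd 2 (N \<circ> X) q = (\<sigma> * (a 1 * b 2 - a 2 * b 1)) *\<^sub>R sphere_chart1 (T q)"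
    "a 2 *\<^sub>R pd 1 (N \<circ> X) q + (- a 1) *\<^sub>R pd 2 (N \<circ> X) q = (\<sigma> * (a 2 * b 1 - a 1 * b 2)) *\<^sub>R sphere_chart2 (T q)"
    unfolding dN by (simp_all add: algebra_simps)
  then have "b 1 = 0" "a 1 = 0"
    using ind(2)[of "b 2" "- b 1"] ind(2)[of "a 2" "- a 1"] J' by simp_all
  then have "pd 1 (N \<circ> X) q = 0" unfolding dN by simp
  then show False using ind(1)[of 1 0] by simp
qed

text \<open>Under the third fundamental form the conformal factor of the metric cancels, so a harmonic
  function that depends on \<open>u\<^sub>1\<close> alone is affine in \<open>u\<^sub>1\<close>.\<close>

lemma harmonic_first_coordinate_affine:
  assumes X: "local_parametrization S U X" and \<mu>: "harmonic_III S N \<mu>"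
    and W: "open W" "W \<subseteq> U" and T: "Ck_on 2 W T" and \<sigma>: "\<sigma> * \<sigma> = (1::real)"
    and NT: "\<And>x. x \<in> W \<Longrightarrow> N (X x) = \<sigma> *\<^sub>R sphere_chart (T x)"
    and J: "\<And>x. x \<in> W \<Longrightarrow> jacobian T x \<noteq> 0"
    and TW: "\<And>x. x \<in> W \<Longrightarrow> T x \<in> plane_box u v d \<and> \<kappa> (T x) = x"
    and \<kappa>: "\<And>y. y \<in> plane_box u v d \<Longrightarrow> \<kappa> differentiable at y \<and> \<kappa> y \<in> W \<and> T (\<kappa> y) = y"
    and first: "\<And>y z. \<lbrakk>y \<in> plane_box u v d; z \<in> plane_box u v d; y $ 1 = z $ 1\<rbrakk> \<Longrightarrow> \<mu> (X (\<kappa> y)) = \<mu> (X (\<kappa> z))"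
  shows "\<exists>a b. \<forall>y\<in>plane_box u v d. \<mu> (X (\<kappa> y)) = a * y $ 1 + b"
proof (cases "d > 0")
  case False
  then have "plane_box u v d = {}" by (auto simp: plane_box_def)
  then show ?thesis by simp
next
  case d: True
  define D where "D = plane_box u v d"
  have oD: "open D" by (simp add: D_def open_plane_box)
  define f where "f = \<mu> \<circ> X"
  define m where "m y = f (\<kappa> y)" for y
  define k where "k = pd 1 m"
  define g where "g x = k (T x)" for x
  note oU = local_parametrizationD(1)[OF X]
  have T2: "Ck_on (Suc (Suc 0)) W T" using T by (simp only: numeral_2_eq_2)
  note dT = Ck_on_differentiable[OF T2 W(1)]
  have "Ck_on 2 U f" using \<mu> X by (simp add: harmonic_III_def f_def)
  then have f2: "Ck_on (Suc (Suc 0)) U f" by (simp only: numeral_2_eq_2)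
  have df: "f differentiable at x" "pd j f differentiable at x" if "x \<in> W" for x j
    using Ck_on_differentiable[OF f2 oU] Ck_on_differentiable[OF Ck_on_pd[OF f2] oU] W(2) that by blast+
  have \<kappa>D: "\<kappa> differentiable at y" "\<kappa> y \<in> W" "T (\<kappa> y) = y" if "y \<in> D" for y
    using \<kappa> that by (auto simp: D_def)
  have TD: "T x \<in> D" "\<kappa> (T x) = x" if "x \<in> W" for x using TW that by (auto simp: D_def)
  have dm: "m differentiable at y" if "y \<in> D" for y
    unfolding m_def[abs_def] using pd_compose_plane(2)[OF df(1)[OF \<kappa>D(2)] \<kappa>D(1)] that by blast
  have m1: "m y = m z" if "y \<in> D" "z \<in> D" "y $ 1 = z $ 1" for y z
    using first[of y z] that by (simp add: m_def f_def D_def)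
  have m2: "pd 2 m y = 0" if "y \<in> D" for y
    by (rule pd_2_eq_0[OF oD that dm[OF that]]) (rule m1[OF _ that])
  have L: "vector [t, v] \<in> D" if "t \<in> {u - d<..<u + d}" for t
    using that d by (simp add: D_def plane_box_def)
  have L': "vector [y $ 1, v] \<in> D" "y $ 1 \<in> {u - d<..<u + d}" if "y \<in> D" for y
    using that L by (auto simp: D_def plane_box_def)
  have kL: "k y = k (vector [y $ 1, v])" if y: "y \<in> D" for y
    unfolding k_def
  proof (rule pd_1_of_first_coordinate[OF oD y, of _ "\<lambda>t. m (vector [t, v])"])
    show "m z = m (vector [z $ 1, v])" if "z \<in> D" for z using m1[OF that L'(1)[OF that]] by simp
    show "((\<lambda>t. m (vector [t, v])) has_real_derivative pd 1 m (vector [y $ 1, v])) (at (y $ 1))"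
      by (rule DERIV_along_1[OF dm[OF L'(1)[OF y]]])
  qed
  have pf: "pd j f x = g x * pd j T x $ 1" if x: "x \<in> W" for x j
  proof -
    have "pd j f x = pd j (\<lambda>x. m (T x)) x"
      by (rule pd_cong[OF W(1) x]) (simp add: m_def TD)
    then show ?thesis
      using pd_compose_plane(1)[OF dm[OF TD(1)[OF x]] dT[OF x]] m2[OF TD(1)[OF x]] by (simp add: g_def k_def)
  qed
  \<comment> \<open>g = k o T involves a derivative of \<mu> o X o \<kappa>, and \<kappa> is only
    known to be differentiable once. Cramer's rule applied to \<open>pf\<close> expresses g by first
    derivatives of f and T, which are differentiable.\<close>
  have dg: "g differentiable at x" if x: "x \<in> W" for x
  proof (rule differentiable_cong_open[OF W(1) x])
    show "g x = (pd 1 f x * pd 2 T x $ 2 - pd 2 f x * pd 1 T x $ 2) / jacobian T x" if "x \<in> W" for x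
      using J[OF that] by (simp add: pf[OF that] field_simps) (simp add: jacobian_def algebra_simps)
    note dd = pd_pd_component(1)[OF W(1) T x]
    show "(\<lambda>x. (pd 1 f x * pd 2 T x $ 2 - pd 2 f x * pd 1 T x $ 2) / jacobian T x) differentiable at x"
      unfolding jacobian_def using J[OF x, unfolded jacobian_def]
      by (intro differentiable_divide differentiable_diff differentiable_mult dd df(2)[OF x])
  qed
  have dk: "k differentiable at y" if y: "y \<in> D" for y
  proof (rule differentiable_cong_open[OF oD y])
    show "k y = g (\<kappa> y)" if "y \<in> D" for y using that by (simp add: g_def \<kappa>D)
    show "(\<lambda>y. g (\<kappa> y)) differentiable at y"
      using pd_compose_plane(2)[OF dg[OF \<kappa>D(2)] \<kappa>D(1)] y by blast
  qed
  have k2: "pd 2 k y = 0" if y: "y \<in> D" for y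
  proof (rule pd_2_eq_0[OF oD y dk[OF y]])
    show "k z = k y" if "z \<in> D" "z $ 1 = y $ 1" for z
      unfolding kL[OF that(1)] kL[OF y] that(2) ..
  qed
  have k1: "pd 1 k y = 0" if y: "y \<in> D" for y
  proof -
    define x where "x = \<kappa> y"
    have x: "x \<in> W" "T x = y" using \<kappa>D[OF y] by (auto simp: x_def)
    have "laplace_beltrami (third_form N X) f x = 0"
      using \<mu> X x(1) W(2) unfolding harmonic_III_def f_def by blast
    then have "(pd 1 g x * pd 2 T x $ 2 - pd 2 g x * pd 1 T x $ 2) * (cosh (T x $ 1))\<^sup>2 / jacobian T x = 0"
      using laplace_beltrami_third_form[where N=N and X=X, OF W(1) x(1) T \<sigma> NT J[OF x(1)] pf dg[OF x(1)]] by simp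
    then have 0: "pd 1 g x * pd 2 T x $ 2 - pd 2 g x * pd 1 T x $ 2 = 0"
      using J[OF x(1)] by simp
    have "pd j g x = pd j T x $ 1 * pd 1 k y" for j
      using pd_compose_plane(1)[of k T x j] dk[OF y] dT[OF x(1)] k2[OF y] x(2)
      by (simp add: g_def[abs_def])
    \<comment> \<open>As k depends on u1 only, its derivative factors out of the Laplace equation
      and leaves the Jacobian.\<close>
    then have "pd 1 k y * jacobian T x = 0" using 0 by (simp add: jacobian_def algebra_simps)
    then show ?thesis using J[OF x(1)] by simp
  qed
  define I where "I = {u - d<..<u + d}"
  have cI: "convex I" by (simp add: I_def convex_real_interval)
  have "((\<lambda>t. k (vector [t, v])) has_real_derivative 0) (at t)" if "t \<in> I" for t
    using DERIV_along_1[OF dk[OF L[OF that[unfolded I_def]]]] k1[OF L[OF that[unfolded I_def]]] by simp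
  from derivative_zero_constant[OF cI this] obtain a where a: "\<And>t. t \<in> I \<Longrightarrow> k (vector [t, v]) = a" by blast
  have "((\<lambda>t. m (vector [t, v]) - a * t) has_real_derivative 0) (at t)" if "t \<in> I" for t
    using DERIV_diff[OF DERIV_along_1[OF dm[OF L[OF that[unfolded I_def]]]] DERIV_cmult_Id[of a]] a[OF that]
    by (simp add: k_def)
  from derivative_zero_constant[OF cI this] obtain b where b: "\<And>t. t \<in> I \<Longrightarrow> m (vector [t, v]) - a * t = b" by blast
  have "\<mu> (X (\<kappa> y)) = a * y $ 1 + b" if y: "y \<in> D" for y
  proof -
    have "m y = m (vector [y $ 1, v])" using m1[OF y L'(1)[OF y]] by simp
    then show ?thesis using b[of "y $ 1"] L'(2)[OF y] by (simp add: m_def f_def I_def)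
  qed
  then show ?thesis unfolding D_def by blast
qed

text \<open>\<open>\<kappa>\<close> comes from the inverse function theorem as a differentiable map
  only. Smoothness of X o \<kappa> is therefore assumed, to be taken from an explicit formula, and
  injectivity of its differential is derived from the radii.\<close>

lemma local_parametrization_support_param:
  assumes X: "local_parametrization S U X" and W: "open W" "W \<subseteq> U" and D: "open D"
    and hom: "homeomorphism D W \<kappa> T" and Y: "smooth_map_on D Y"
    and eq: "\<And>y. y \<in> D \<Longrightarrow> Y y = X (\<kappa> y)" "\<And>y. y \<in> D \<Longrightarrow> Y y = support_param \<psi> \<psi>1 y"
    and \<psi>: "\<And>y. y \<in> D \<Longrightarrow> (\<psi> has_real_derivative \<psi>1 (y $ 1)) (at (y $ 1))"
      "\<And>y. y \<in> D \<Longrightarrow> (\<psi>1 has_real_derivative \<psi>2 (y $ 1)) (at (y $ 1))"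
    and W0: "\<And>y. y \<in> D \<Longrightarrow> radius1 (\<psi> (y $ 1)) (\<psi>1 (y $ 1)) (\<psi>2 (y $ 1)) (y $ 1) \<noteq> 0"
      "\<And>y. y \<in> D \<Longrightarrow> radius2 (\<psi> (y $ 1)) (\<psi>1 (y $ 1)) (y $ 1) \<noteq> 0"
  shows "local_parametrization S D Y"
  unfolding local_parametrization_def
proof (intro conjI ballI)
  show "open D" "smooth_map_on D Y" by fact+
  have "\<kappa> ` D = W" using hom by (simp add: homeomorphism_def)
  then have im: "Y ` D = X ` W" using eq(1) by (metis (no_types, lifting) image_cong image_image)
  show "openin (top_of_set S) (Y ` D)"
    unfolding im by (rule local_parametrization_openin[OF X W])
  obtain g where g: "homeomorphism U (X ` U) X g" using local_parametrizationD(6)[OF X] by blast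
  have "homeomorphism W (X ` W) X g"
    by (rule homeomorphism_of_subsets[OF g W(2) _ refl]) (use W(2) in blast)
  from homeomorphism_compose[OF hom this]
  have "homeomorphism D (X ` W) (X \<circ> \<kappa>) (T \<circ> g)" .
  then have "homeomorphism D (Y ` D) Y (T \<circ> g)"
    by (rule homeomorphism_cong) (use im eq(1) in auto)
  then show "\<exists>g. homeomorphism D (Y ` D) Y g" by blast
  fix y assume y: "y \<in> D"
  have "Ck_on (Suc 0) D Y" using Y unfolding smooth_map_on_def by blast
  then have dY: "Y differentiable at y" using Ck_on_differentiable[OF _ D y] by blast
  have pY: "pd j Y y = pd j (support_param \<psi> \<psi>1) y" for j
    by (rule pd_cong[OF D y eq(2)])
  note p = pd_support_param(2,3)[where x=y, OF \<psi>[OF y]]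
  have f: "frechet_derivative Y (at y) = (\<lambda>v. v $ 1 *\<^sub>R pd 1 Y y + v $ 2 *\<^sub>R pd 2 Y y)"
    using frechet_derivative_at[OF has_derivative_pd[OF dY]] by simp
  have lin: "linear (frechet_derivative Y (at y))"
    using dY by (rule linear_frechet_derivative)
  show "inj (frechet_derivative Y (at y))"
    unfolding linear_injective_0[OF lin]
  proof (intro allI impI)
    fix v assume "frechet_derivative Y (at y) v = 0"
    then have "(v $ 1 * radius1 (\<psi> (y $ 1)) (\<psi>1 (y $ 1)) (\<psi>2 (y $ 1)) (y $ 1)) *\<^sub>R sphere_chart1 y
        + (v $ 2 * radius2 (\<psi> (y $ 1)) (\<psi>1 (y $ 1)) (y $ 1)) *\<^sub>R sphere_chart2 y = 0"
      unfolding f pY p by simp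
    from sphere_chart_independent[OF this] W0[OF y] show "v = 0"
      by (simp add: vec_eq_iff forall_2)
  qed
qed

lemma rotational_X_eq_near:
  assumes "open I" "x $ 1 \<in> I" "\<And>t. t \<in> I \<Longrightarrow> profile G t = h t"
    and "(G has_real_derivative G1 (x $ 1)) (at (x $ 1))"
  shows "rotational_X h x = support_param (supp G) (supp1 G G1) x"
proof -
  have "\<forall>\<^sub>F t in nhds (x $ 1). profile G t = h t"
    using assms(1-3) by (auto simp: eventually_nhds)
  then have "deriv (profile G) (x $ 1) = deriv h (x $ 1)" by (rule deriv_cong_ev) simp
  moreover have "profile G (x $ 1) = h (x $ 1)" using assms(2,3) by blast
  ultimately have "rotational_X h x = rotational_X (profile G) x"
    by (simp add: rotational_X_def profile_A_def profile_B_def)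
  then show ?thesis using rotational_X_profile[of G G1 x] assms(4) by simp
qed

lemma profile_eq_supp: "2 * profile G t / (1 + exp (2 * t)) = supp G t"
proof -
  define e where "e = exp t"
  have e: "e > 0" "exp (2 * t) = e\<^sup>2" by (simp_all add: e_def exp_double)
  have c: "cosh t = (1 + e\<^sup>2) / (2 * e)"
    using e(1) by (simp add: cosh_def e_def exp_minus field_simps power2_eq_square)
  have "1 + e\<^sup>2 > 0" by (simp add: add_pos_nonneg)
  then show ?thesis unfolding profile_def supp_def c e(2) using e(1)
    by (simp add: field_simps power2_eq_square)
qed

text \<open>The Gauss image and the support function appear in the conclusion because they pin h
  down: from a point of the surface they give u1 and h(u1).\<close>

lemma HQSF_rotation_local:
  fixes c :: real
  assumes N: "oriented_surface S N" and R: "surface_of_revolution S"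
    and K: "nonzero_gauss_curvature S N" and \<mu>: "harmonic_III S N \<mu>"
    and eqn: "\<And>U X q. \<lbrakk>local_parametrization S U X; q \<in> U\<rbrakk> \<Longrightarrow>
      2 * support_function N (X q) * mean_curvature N X q
        + (c * support_function N (X q) * exp (2 * \<mu> (X q)) + quadratic_distance (X q)
            - (support_function N (X q))\<^sup>2) * gauss_curvature N X q = 0"
    and \<sigma>: "\<sigma> = 1 \<or> \<sigma> = - 1" and \<sigma>pos: "\<And>p. p \<in> S \<Longrightarrow> \<sigma> * support_function N p > 0"
    and p: "p \<in> S"
  shows "\<exists>h D. admissible h \<and> local_parametrization S D (rotational_X h) \<and> p \<in> rotational_X h ` D \<and>
    (\<forall>y\<in>D. \<sigma> *\<^sub>R N (rotational_X h y) = sphere_chart y \<and>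
        rotational_X h y \<bullet> sphere_chart y = 2 * h (y $ 1) / (1 + exp (2 * y $ 1)))"
proof -
  have \<sigma>2: "\<sigma> * \<sigma> = 1" using \<sigma> by auto
  obtain U X where X: "local_parametrization S U X" and "p \<in> X ` U"
    using N p unfolding oriented_surface_def regular_surface_def by blast
  then obtain q where q: "q \<in> U" "p = X q" by blast
  note lp = local_parametrizationD[OF X]
  have KX: "gauss_curvature N X x \<noteq> 0" if "x \<in> U" for x
    using K X that unfolding nonzero_gauss_curvature_def by blast
  obtain V T where VT: "open V" "q \<in> V" "V \<subseteq> U" "Ck_on 2 V T"
    and NT: "\<And>x. x \<in> V \<Longrightarrow> N (X x) = \<sigma> *\<^sub>R sphere_chart (T x)"
    using gauss_map_chart[OF N X q(1) \<sigma> Gauss_map_not_pole[OF N R X q(1) KX[OF q(1)]]] by metis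
  have T2: "Ck_on (Suc (Suc 0)) V T" using VT(4) by (simp only: numeral_2_eq_2)
  note dT = Ck_on_differentiable[OF T2 VT(1)]
  have J: "jacobian T x \<noteq> 0" if "x \<in> V" for x
    by (rule jacobian_nonzero[OF N X _ KX VT(1) that dT[OF that] NT]) (use that VT(3) in auto)
  have "Ck_on 1 V T" using Ck_on_SucD[OF T2] by simp
  then obtain V' D0 \<kappa> where V': "open V'" "V' \<subseteq> V" "q \<in> V'" "open D0" "homeomorphism V' D0 T \<kappa>"
    "\<And>y. y \<in> D0 \<Longrightarrow> \<kappa> differentiable at y"
    using local_inverse_plane[OF VT(1) _ VT(2) J[OF VT(2), unfolded jacobian_def]] by metis
  have T\<kappa>: "T (\<kappa> y) = y" "\<kappa> y \<in> V'" if "y \<in> D0" for y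
    using V'(5) that unfolding homeomorphism_def by blast+
  have \<kappa>T: "\<kappa> (T x) = x" "T x \<in> D0" if "x \<in> V'" for x
    using V'(5) that unfolding homeomorphism_def by blast+
  define u where "u = T q $ 1"
  define v where "v = T q $ 2"
  obtain e where e: "e > 0" "ball (T q) e \<subseteq> D0" using V'(4) \<kappa>T(2)[OF V'(3)] openE by blast
  define d where "d = e / 2"
  have d: "d > 0" using e by (simp add: d_def)
  define D where "D = plane_box u v d"
  have oD: "open D" and DD0: "D \<subseteq> D0"
    using open_plane_box plane_box_subset_ball[of "T q" e] e(2) by (auto simp: D_def u_def v_def d_def)
  define W where "W = V' \<inter> T -` D"
  have "continuous_on V' T" using V'(5) by (simp add: homeomorphism_def)
  then have oW: "open W" unfolding W_def using V'(1) oD by (rule continuous_open_preimage)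
  have WV: "W \<subseteq> V" "W \<subseteq> U" using V'(2) VT(3) by (auto simp: W_def)
  have TqD: "T q \<in> D" using d by (simp add: D_def plane_box_def u_def v_def)
  have qW: "q \<in> W" using V'(3) TqD by (simp add: W_def)
  have \<kappa>W: "\<kappa> y \<in> W" "T (\<kappa> y) = y" "\<kappa> differentiable at y" if "y \<in> D" for y
    using that DD0 T\<kappa> V'(6) by (auto simp: W_def)
  have TW: "T x \<in> D" "\<kappa> (T x) = x" if "x \<in> W" for x using that \<kappa>T by (auto simp: W_def)
  have hom: "homeomorphism D W \<kappa> T"
  proof (rule homeomorphism_of_subsets[OF homeomorphism_symD[OF V'(5)] DD0])
    show "W \<subseteq> V'" by (auto simp: W_def)
    show "\<kappa> ` D = W" using \<kappa>W(1) TW by (auto simp: image_iff) (metis TW)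
  qed
  have NT': "N (X x) = \<sigma> *\<^sub>R sphere_chart (T x)" if "x \<in> W" for x using NT WV that by blast
  define Z where "Z y = X (\<kappa> y)" for y
  have NZ: "N (Z y) = \<sigma> *\<^sub>R sphere_chart y" if "y \<in> D" for y
    using NT'[OF \<kappa>W(1)[OF that]] \<kappa>W(2)[OF that] by (simp add: Z_def)
  have ZS: "Z y \<in> S" if "y \<in> D" for y using \<kappa>W(1)[OF that] WV lp(4) by (auto simp: Z_def)
  have dX: "X differentiable at x" if "x \<in> W" for x using lp(7) WV that by blast
  have dZ: "Z differentiable at y" if "y \<in> D" for y
    unfolding Z_def[abs_def] using pd_compose_plane(2)[OF dX[OF \<kappa>W(1)] \<kappa>W(3)] that by blast
  have pZ: "pd j Z y \<bullet> sphere_chart y = 0" if y: "y \<in> D" for j y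
  proof -
    have "pd i X (\<kappa> y) \<bullet> N (X (\<kappa> y)) = 0" for i
      using oriented_surfaceD(2)[OF N X] \<kappa>W(1)[OF y] WV by blast
    then have o: "pd i X (\<kappa> y) \<bullet> sphere_chart y = 0" for i
      using NZ[OF y] \<sigma> by (auto simp: Z_def)
    show ?thesis unfolding Z_def[abs_def] pd_compose_plane(1)[OF dX[OF \<kappa>W(1)[OF y]] \<kappa>W(3)[OF y]]
      by (simp add: inner_add_left o)
  qed
  have Ze: "Z y \<bullet> e_phi (y $ 2) = 0" if y: "y \<in> D" for y
  proof -
    have "Z y $ 1 * N (Z y) $ 2 = Z y $ 2 * N (Z y) $ 1"
      unfolding Z_def using normal_orthogonal_parallels[OF N R X] \<kappa>W(1)[OF y] WV by blast
    then have "Z y $ 1 * sin (y $ 2) = Z y $ 2 * cos (y $ 2)"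
      unfolding NZ[OF y] using \<sigma> by (auto simp: sphere_chart_def field_simps)
    then show ?thesis by (simp add: inner_vec_def sum_3)
  qed
  define P where "P y = Z y \<bullet> sphere_chart y" for y
  define Q where "Q y = Z y \<bullet> sphere_chart1 y" for y
  define \<psi> where "\<psi> t = P (vector [t, v])" for t
  define \<psi>1 where "\<psi>1 t = Q (vector [t, v])" for t
  \<comment> \<open>Z is only known to be differentiable once. But Q, which turns out to be the
    u1-derivative of P, is an inner product with Z itself and so can be differentiated
    again.\<close>
  define \<psi>2 where "\<psi>2 t = pd 1 Q (vector [t, v])" for t
  have dn: "sphere_chart1 differentiable at y" for y
  proof -
    have c: "((\<lambda>t. (cosh t)\<^sup>2) has_real_derivative 2 * cosh (y $ 1) * sinh (y $ 1)) (at (y $ 1))"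
      and s: "((\<lambda>t. - sinh t) has_real_derivative - cosh (y $ 1)) (at (y $ 1))"
      by (auto intro!: derivative_eq_intros)
    have c0: "(cosh (y $ 1))\<^sup>2 \<noteq> (0::real)" by simp
    show ?thesis unfolding sphere_chart1_def[abs_def]
      by (rule pd_revolve(1)[OF DERIV_divide[OF s c c0] DERIV_divide[OF DERIV_const c c0]])
  qed
  have dP: "P differentiable at y" and dQ: "Q differentiable at y" if "y \<in> D" for y
    unfolding P_def[abs_def] Q_def[abs_def]
    by (intro differentiable_inner dZ[OF that] pd_sphere_chart(1) dn)+
  \<comment> \<open>The derivative of Z is tangent and contributes nothing. The u2-derivative of the
    normal points along the parallel, to which Z is orthogonal by \<open>Ze\<close>.\<close>
  have pP: "pd 1 P y = Q y" "pd 2 P y = 0" if y: "y \<in> D" for y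
    unfolding P_def[abs_def] Q_def pd_inner[OF dZ[OF y] pd_sphere_chart(1)] pZ[OF y]
    using Ze[OF y] by (simp_all add: pd_sphere_chart sphere_chart2_def)
  have L: "vector [t, v] \<in> D" if "t \<in> {u - d<..<u + d}" for t
    using that d by (simp add: D_def plane_box_def)
  have DI: "y $ 1 \<in> {u - d<..<u + d}" if "y \<in> D" for y using that by (simp add: D_def plane_box_def)
  have d\<psi>: "(\<psi> has_real_derivative \<psi>1 t) (at t)" "(\<psi>1 has_real_derivative \<psi>2 t) (at t)"
    if "t \<in> {u - d<..<u + d}" for t
    using DERIV_along_1[OF dP[OF L[OF that]]] DERIV_along_1[OF dQ[OF L[OF that]]] pP(1)[OF L[OF that]]
    by (simp_all add: \<psi>_def[abs_def] \<psi>1_def[abs_def] \<psi>2_def)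
  have P\<psi>: "P y = \<psi> (y $ 1)" if "y \<in> D" for y
    unfolding \<psi>_def using constant_along_2[of u v d P y] dP pP(2) that unfolding D_def by blast
  have Q\<psi>: "Q y = \<psi>1 (y $ 1)" if y: "y \<in> D" for y
    using pd_1_of_first_coordinate[OF oD y P\<psi> d\<psi>(1)[OF DI[OF y]]] pP(1)[OF y] by simp
  have Zs: "Z y = support_param \<psi> \<psi>1 y" if y: "y \<in> D" for y
    by (rule eq_support_param) (use P\<psi>[OF y] Q\<psi>[OF y] Ze[OF y] in \<open>simp_all add: P_def Q_def\<close>)
  have XT: "X x = support_param \<psi> \<psi>1 (T x)" if "x \<in> W" for x
    using Zs[OF TW(1)[OF that]] TW(2)[OF that] by (simp add: Z_def)
  define eqs where "eqs y t \<longleftrightarrow> - \<psi> t * (2 * \<psi> t + \<psi>2 t * (cosh t)\<^sup>2)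
      + (\<sigma> * c) * \<psi> t * exp (2 * \<mu> (Z y)) + (\<psi>1 t)\<^sup>2 * (cosh t)\<^sup>2 = 0" for y t
  have curv: "radius1 (\<psi> t) (\<psi>1 t) (\<psi>2 t) t \<noteq> 0" "radius2 (\<psi> t) (\<psi>1 t) t \<noteq> 0" "eqs y t"
    if y: "y \<in> D" and t: "t = y $ 1" for y t
  proof -
    define x where "x = \<kappa> y"
    have x: "x \<in> W" "T x = y" using \<kappa>W[OF y] by (auto simp: x_def)
    have xT: "T x $ 1 \<in> {u - d<..<u + d}" using DI[OF y] x by simp
    have dTx: "T differentiable at x" using dT x(1) WV(1) by blast
    define w1 where "w1 = radius1 (\<psi> t) (\<psi>1 t) (\<psi>2 t) t"
    define w2 where "w2 = radius2 (\<psi> t) (\<psi>1 t) t"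
    note cv = curvature_support_param[OF X oW WV(2) x(1) dTx \<sigma>2 NT' XT d\<psi>[OF xT], unfolded x(2) t[symmetric],
        folded w1_def w2_def]
    have w: "w1 \<noteq> 0" "w2 \<noteq> 0" by (rule cv(2), assumption+) (rule cv(3), assumption+)
    then show "radius1 (\<psi> t) (\<psi>1 t) (\<psi>2 t) t \<noteq> 0" "radius2 (\<psi> t) (\<psi>1 t) t \<noteq> 0"
      by (simp_all add: w1_def w2_def)
    have HK: "mean_curvature N X x = - \<sigma> * (1 / w1 + 1 / w2) / 2" "gauss_curvature N X x = 1 / (w1 * w2)"
      by (rule cv(4), assumption+) (rule cv(5), assumption+)
    have s: "support_function N (X x) = \<sigma> * \<psi> t"
      unfolding support_function_def NT'[OF x(1)]
      by (simp add: XT[OF x(1)] support_param_inner x(2) t)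
    have l: "quadratic_distance (X x) = (\<psi> t)\<^sup>2 + (\<psi>1 t)\<^sup>2 * (cosh t)\<^sup>2"
      by (simp add: quadratic_distance_def XT[OF x(1)] support_param_inner x(2) t)
    have "x \<in> U" using x WV by blast
    from eqn[OF X this, unfolded s l HK] show "eqs y t"
      unfolding HQSF_equation_support_param[OF \<sigma>2 w w1_def w2_def] eqs_def Z_def x_def .
  qed
  have \<psi>pos: "\<psi> (y $ 1) > 0" if y: "y \<in> D" for y
  proof -
    have "\<sigma> * support_function N (Z y) = P y"
      unfolding support_function_def NZ[OF y] P_def using \<sigma>2 by (simp add: mult.assoc[symmetric])
    then show ?thesis using \<sigma>pos[OF ZS[OF y]] P\<psi>[OF y] by simp
  qed
  have "\<exists>a \<kappa>'. \<forall>y\<in>D. \<sigma> * c * exp (2 * \<mu> (Z y)) = \<kappa>' * exp (2 * a * y $ 1)"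
  \<comment> \<open>For c = 0 the equation does not restrict \<mu>, and \<kappa>' = 0
    serves.\<close>
  proof (cases "c = 0")
    case True
    then show ?thesis by (intro exI[of _ 0]) simp
  next
    case False
    \<comment> \<open>As c \<psi> is nonzero, the equation can be solved for exp(2 \<mu>), with all
      other terms depending on u1 only.\<close>
    have "\<mu> (Z y) = \<mu> (Z z)" if "y \<in> D" "z \<in> D" "y $ 1 = z $ 1" for y z
    proof -
      have "(\<sigma> * c) * \<psi> (y $ 1) * exp (2 * \<mu> (Z y)) = (\<sigma> * c) * \<psi> (y $ 1) * exp (2 * \<mu> (Z z))"
        using curv(3)[OF that(1) refl] curv(3)[OF that(2) refl] unfolding eqs_def that(3) by linarith
      then show ?thesis using False \<sigma> \<psi>pos[OF that(1)] by auto
    qed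
    note first = this
    have "\<exists>a b. \<forall>y\<in>plane_box u v d. \<mu> (X (\<kappa> y)) = a * y $ 1 + b"
    proof (rule harmonic_first_coordinate_affine[OF X \<mu> oW WV(2) Ck_on_subset[OF VT(4) WV(1)] \<sigma>2 NT'])
      show "jacobian T x \<noteq> 0" if "x \<in> W" for x using J WV(1) that by blast
      show "T x \<in> plane_box u v d \<and> \<kappa> (T x) = x" if "x \<in> W" for x
        using TW[OF that] by (simp add: D_def)
      show "\<kappa> differentiable at y \<and> \<kappa> y \<in> W \<and> T (\<kappa> y) = y" if "y \<in> plane_box u v d" for y
        using \<kappa>W[OF that[folded D_def]] by blast
      show "\<mu> (X (\<kappa> y)) = \<mu> (X (\<kappa> z))"
        if "y \<in> plane_box u v d" "z \<in> plane_box u v d" "y $ 1 = z $ 1" for y z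
        using first[OF that[folded D_def]] by (simp only: Z_def)
    qed assumption+
    then obtain a b where ab: "\<And>y. y \<in> D \<Longrightarrow> \<mu> (Z y) = a * y $ 1 + b"
      unfolding D_def Z_def by blast
    have "\<sigma> * c * exp (2 * \<mu> (Z y)) = (\<sigma> * c * exp (2 * b)) * exp (2 * a * y $ 1)" if "y \<in> D" for y
      unfolding ab[OF that] by (simp add: exp_add[symmetric] algebra_simps)
    then show ?thesis by blast
  qed
  then obtain a \<kappa>' where a: "\<And>y. y \<in> D \<Longrightarrow> \<sigma> * c * exp (2 * \<mu> (Z y)) = \<kappa>' * exp (2 * a * y $ 1)" by blast
  define I where "I = {u - d<..<u + d}"
  \<comment> \<open>This G inverts \<open>supp\<close>; G1 and G2 are its derivatives expressed by
    those of \<psi>.\<close>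
  define G where "G t = \<psi> t * (cosh t)\<^sup>2" for t
  define G1 where "G1 t = \<psi>1 t * (cosh t)\<^sup>2 + 2 * \<psi> t * sinh t * cosh t" for t
  define G2 where "G2 t = \<psi>2 t * (cosh t)\<^sup>2 + 4 * \<psi>1 t * sinh t * cosh t
    + 2 * \<psi> t * ((cosh t)\<^sup>2 + (sinh t)\<^sup>2)" for t
  have c0: "cosh t \<noteq> (0::real)" for t by simp
  have dG: "(G has_real_derivative G1 t) (at t)" "(G1 has_real_derivative G2 t) (at t)" if "t \<in> I" for t
    unfolding G_def[abs_def] G1_def[abs_def] G2_def using d\<psi>[OF that[unfolded I_def]]
    by (auto intro!: derivative_eq_intros simp: algebra_simps power2_eq_square)
  have Gpos: "G t > 0" if "t \<in> I" for t
    using \<psi>pos[OF L[OF that[unfolded I_def]]] c0[of t] by (simp add: G_def)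
  have "G t * G2 t - (G1 t)\<^sup>2 = \<kappa>' * exp (2 * a * t) * G t" if t: "t \<in> I" for t
  proof -
    have yD: "vector [t, v] \<in> D" using L t by (simp add: I_def)
    have s: "(sinh t)\<^sup>2 = (cosh t)\<^sup>2 - 1" using cosh_square_eq[of t] by simp
    have t1: "(vector [t, v] :: real ^ 2) $ 1 = t" by simp
    have "(\<sigma> * c) * \<psi> t * exp (2 * \<mu> (Z (vector [t, v]))) = (\<sigma> * c * exp (2 * \<mu> (Z (vector [t, v])))) * \<psi> t"
      by simp
    then have "- \<psi> t * (2 * \<psi> t + \<psi>2 t * (cosh t)\<^sup>2) + (\<kappa>' * exp (2 * a * t)) * \<psi> t + (\<psi>1 t)\<^sup>2 * (cosh t)\<^sup>2 = 0"
      using curv(3)[OF yD t1[symmetric]] unfolding eqs_def a[OF yD, unfolded t1] by linarith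
    then show ?thesis unfolding G_def G1_def G2_def using s by algebra
  qed
  from Liouville_equation_admissible[of I, OF _ dG Gpos this]
  obtain h where h: "admissible h" "\<And>t. t \<in> I \<Longrightarrow> profile G t = h t"
    by (auto simp: I_def convex_real_interval)
  have supp: "supp G t = \<psi> t" "supp1 G G1 t = \<psi>1 t" for t
    using c0[of t] by (simp_all add: supp_def supp1_def G_def G1_def field_simps power2_eq_square power3_eq_cube)
  have Xh: "rotational_X h y = support_param \<psi> \<psi>1 y" if y: "y \<in> D" for y
  proof -
    have "y $ 1 \<in> I" using DI[OF y] by (simp add: I_def)
    then have "rotational_X h y = support_param (supp G) (supp1 G G1) y"
      by (intro rotational_X_eq_near[of I] h(2) dG(1)) (auto simp: I_def)
    then show ?thesis by (simp add: support_param_def supp)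
  qed
  have "local_parametrization S D (rotational_X h)"
  proof (rule local_parametrization_support_param[where ?\<psi>2.0=\<psi>2, OF X oW WV(2) oD hom smooth_rotational_X[OF h(1) oD] _ Xh])
    show "rotational_X h y = X (\<kappa> y)" if "y \<in> D" for y
      using Xh[OF that] Zs[OF that] by (simp add: Z_def)
  qed (use d\<psi>[OF DI] curv(1,2)[OF _ refl] in blast)+
  moreover have "p \<in> rotational_X h ` D"
  proof -
    have "rotational_X h (T q) = p" using Xh[OF TqD] XT[OF qW] q(2) by simp
    then show ?thesis using TqD by blast
  qed
  moreover have "\<sigma> *\<^sub>R N (rotational_X h y) = sphere_chart y \<and>
      rotational_X h y \<bullet> sphere_chart y = 2 * h (y $ 1) / (1 + exp (2 * y $ 1))" if y: "y \<in> D" for y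
  proof
    have "rotational_X h y = Z y" using Xh[OF y] Zs[OF y] by simp
    then show "\<sigma> *\<^sub>R N (rotational_X h y) = sphere_chart y" using NZ[OF y] \<sigma>2 by simp
    have "2 * h (y $ 1) / (1 + exp (2 * y $ 1)) = supp G (y $ 1)"
      using profile_eq_supp[of G "y $ 1"] h(2)[of "y $ 1"] DI[OF y] by (simp add: I_def)
    then show "rotational_X h y \<bullet> sphere_chart y = 2 * h (y $ 1) / (1 + exp (2 * y $ 1))"
      unfolding Xh[OF y] by (simp add: support_param_inner supp)
  qed
  ultimately show ?thesis using h(1) by blast
qed

section \<open>Uniqueness of the profile and passage to the whole surface\<close>

text \<open>A common point has one Gauss image, which yields u1, and one support value, which yields
  the profile at u1. Varying u1 alone inside the overlap shows that the two profiles agree on an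
  interval.\<close>

lemma local_profile_unique:
  assumes h: "admissible h" "local_parametrization S D (rotational_X h)" "p \<in> rotational_X h ` D"
    "\<And>y. y \<in> D \<Longrightarrow> \<nu> (rotational_X h y) = sphere_chart y"
    "\<And>y. y \<in> D \<Longrightarrow> rotational_X h y \<bullet> sphere_chart y = 2 * h (y $ 1) / (1 + exp (2 * y $ 1))"
    and h': "admissible h'" "local_parametrization S D' (rotational_X h')" "p \<in> rotational_X h' ` D'"
    "\<And>y. y \<in> D' \<Longrightarrow> \<nu> (rotational_X h' y) = sphere_chart y"
    "\<And>y. y \<in> D' \<Longrightarrow> rotational_X h' y \<bullet> sphere_chart y = 2 * h' (y $ 1) / (1 + exp (2 * y $ 1))"
  shows "h = h'"
proof -
  obtain y where y: "y \<in> D" "p = rotational_X h y" using h(3) by blast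
  note lp = local_parametrizationD[OF h(2)]
  obtain V where V: "open V" "rotational_X h' ` D' = S \<inter> V"
    using local_parametrizationD(3)[OF h'(2)] by (auto simp: openin_open)
  have "Ck_on 0 D (rotational_X h)" using lp(2) unfolding smooth_map_on_def by blast
  then have "continuous_on D (rotational_X h)" by simp
  then have o: "open (D \<inter> rotational_X h -` V)" using lp(1) V(1) by (rule continuous_open_preimage)
  have "y \<in> D \<inter> rotational_X h -` V" using y h'(3) V(2) by auto
  then obtain e where e: "e > 0" "ball y e \<subseteq> D \<inter> rotational_X h -` V" using o openE by blast
  show ?thesis
  proof (rule admissible_eq_if_eq_near[OF h(1) h'(1) e(1), of "y $ 1"])
    fix t assume t: "\<bar>t - y $ 1\<bar> < e"
    define z :: "real ^ 2" where "z = y + (t - y $ 1) *\<^sub>R axis 1 1"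
    have z1: "z $ 1 = t" by (simp add: z_def axis_def)
    have "z \<in> ball y e" using t by (simp add: z_def dist_norm)
    then have z: "z \<in> D" "rotational_X h z \<in> V" using e(2) by auto
    then have "rotational_X h z \<in> rotational_X h' ` D'" using V(2) lp(4) by blast
    then obtain w where w: "w \<in> D'" "rotational_X h z = rotational_X h' w" by blast
    have n: "sphere_chart z = sphere_chart w" using h(4)[OF z(1)] h'(4)[OF w(1)] w(2) by simp
    have w1: "w $ 1 = t" using sphere_chart_eqD(1)[OF n] z1 by simp
    have "rotational_X h' w \<bullet> sphere_chart w = 2 * h t / (1 + exp (2 * t))"
      using h(5)[OF z(1)] by (simp only: w(2) n z1)
    then have "2 * h t / (1 + exp (2 * t)) = 2 * h' t / (1 + exp (2 * t))"
      using h'(5)[OF w(1)] by (simp only: w1)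
    moreover have "1 + exp (2 * t) \<noteq> 0" using exp_gt_zero[of "2 * t"] by linarith
    ultimately show "h t = h' t" by simp
  qed
qed

lemma HQSF_surface_of_rotation_parametrized:
  assumes N: "oriented_surface S N" and S: "connected S" and K: "nonzero_gauss_curvature S N"
    and H: "HQSF_surface_of_rotation S N"
  shows "\<exists>h. admissible h \<and> locally_parametrized_by S (rotational_X h)"
proof -
  have R: "surface_of_revolution S" using H by (simp add: HQSF_surface_of_rotation_def)
  obtain c \<mu> where \<mu>: "harmonic_III S N \<mu>" and eqn: "\<And>U X q. \<lbrakk>local_parametrization S U X; q \<in> U\<rbrakk> \<Longrightarrow>
      2 * support_function N (X q) * mean_curvature N X q
        + (c * support_function N (X q) * exp (2 * \<mu> (X q)) + quadratic_distance (X q)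
            - (support_function N (X q))\<^sup>2) * gauss_curvature N X q = 0"
    using H unfolding HQSF_surface_of_rotation_def HQSF_surface_def Let_def by blast
  have nz: "support_function N p \<noteq> 0" if p: "p \<in> S" for p
  proof -
    obtain U X where X: "local_parametrization S U X" and "p \<in> X ` U"
      using N p unfolding oriented_surface_def regular_surface_def by blast
    then obtain q where q: "q \<in> U" "p = X q" by blast
    have "gauss_curvature N X q \<noteq> 0" using K X q unfolding nonzero_gauss_curvature_def by blast
    moreover have "(p $ 1, p $ 2) \<noteq> (0, 0)" using R p unfolding surface_of_revolution_def by blast
    ultimately show ?thesis using HQSF_support_nonzero[OF eqn[OF X q(1)]] q(2) by simp
  qed
  obtain \<sigma> :: real where \<sigma>: "\<sigma> = 1 \<or> \<sigma> = - 1" "\<And>p. p \<in> S \<Longrightarrow> \<sigma> * support_function N p > 0"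
    using support_function_constant_sign[OF N S nz] by blast
  define \<nu> where "\<nu> p = \<sigma> *\<^sub>R N p" for p
  \<comment> \<open>Normal and support function are included so that at most one profile is good at
    a given point; this makes the choice \<open>f\<close> locally constant.\<close>
  define good where "good p h \<longleftrightarrow> (\<exists>D. admissible h \<and> local_parametrization S D (rotational_X h)
      \<and> p \<in> rotational_X h ` D
      \<and> (\<forall>y\<in>D. \<nu> (rotational_X h y) = sphere_chart y \<and>
          rotational_X h y \<bullet> sphere_chart y = 2 * h (y $ 1) / (1 + exp (2 * y $ 1))))" for p h
  have ex: "\<exists>h. good p h" if "p \<in> S" for p
    using HQSF_rotation_local[OF N R K \<mu> eqn \<sigma> that] unfolding good_def \<nu>_def by simp
  have uniq: "h = h'" if "good p h" "good p h'" for p h h'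
    using that unfolding good_def by (elim exE conjE) (rule local_profile_unique, assumption+, auto)
  define f where "f p = (SOME h. good p h)" for p
  have f: "good p (f p)" if "p \<in> S" for p unfolding f_def by (rule someI_ex[OF ex[OF that]])
  have "f constant_on S"
  proof (rule locally_constant_imp_constant[OF S])
    fix p assume p: "p \<in> S"
    obtain D where D: "admissible (f p)" "local_parametrization S D (rotational_X (f p))"
      "p \<in> rotational_X (f p) ` D"
      "\<forall>y\<in>D. \<nu> (rotational_X (f p) y) = sphere_chart y \<and>
          rotational_X (f p) y \<bullet> sphere_chart y = 2 * f p (y $ 1) / (1 + exp (2 * y $ 1))"
      using f[OF p] unfolding good_def by blast
    have "f x = f p" if x: "x \<in> rotational_X (f p) ` D" for x
    proof (rule uniq)
      show "good x (f x)" using f x local_parametrizationD(4)[OF D(2)] by blast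
      show "good x (f p)" using D x unfolding good_def by blast
    qed
    then show "\<exists>T. openin (top_of_set S) T \<and> p \<in> T \<and> (\<forall>x\<in>T. f x = f p)"
      using local_parametrizationD(3)[OF D(2)] D(3) by blast
  qed
  then obtain h where h: "\<And>p. p \<in> S \<Longrightarrow> f p = h" unfolding constant_on_def by blast
  show ?thesis
  proof (cases "S = {}")
    case True
    \<comment> \<open>For the empty surface any admissible function will do, here the zero
      function.\<close>
    then show ?thesis using admissible_linear[of 0 0 0]
      unfolding locally_parametrized_by_def by blast
  next
    case False
    then obtain p where p: "p \<in> S" by blast
    have g: "good x h" if "x \<in> S" for x using f[OF that] h[OF that] by simp
    have "admissible h" using g[OF p] unfolding good_def by blast
    moreover have "locally_parametrized_by S (rotational_X h)"
      unfolding locally_parametrized_by_def using g unfolding good_def by blast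
    ultimately show ?thesis by blast
  qed
qed

theorem theorem3:
  fixes S :: "(real ^ 3) set" and N :: "real ^ 3 \<Rightarrow> real ^ 3"
  assumes "oriented_surface S N" and "connected S" and "nonzero_gauss_curvature S N"
  shows "HQSF_surface_of_rotation S N \<longleftrightarrow>
    (\<exists>(c::real) (c1::real) (c2::real) (z1::complex).
       c \<noteq> 0 \<and> z1 \<noteq> 0 \<and>
       (Omega c c1 c2 z1 > 0 \<longrightarrow>
          (\<exists>a1 a2. locally_parametrized_by S (rotational_X (h1 c c1 c2 z1 a1 a2)))) \<and>
       (Omega c c1 c2 z1 < 0 \<longrightarrow>
          (\<exists>b1 b2. locally_parametrized_by S (rotational_X (h2 c c1 c2 z1 b1 b2)))) \<and>
       (Omega c c1 c2 z1 = 0 \<longrightarrow>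
          (\<exists>a1 a2. locally_parametrized_by S (rotational_X (h3 c c1 c2 z1 a1 a2)))))"
    (is "?L \<longleftrightarrow> ?R")
proof
  assume ?L
  then obtain h where h: "admissible h" "locally_parametrized_by S (rotational_X h)"
    using HQSF_surface_of_rotation_parametrized[OF assms] by blast
  then obtain c c1 c2 z1 where "c \<noteq> 0" "z1 \<noteq> 0"
    "Omega c c1 c2 z1 > 0 \<and> (\<exists>a1 a2. h = h1 c c1 c2 z1 a1 a2) \<or>
     Omega c c1 c2 z1 < 0 \<and> (\<exists>b1 b2. h = h2 c c1 c2 z1 b1 b2) \<or>
     Omega c c1 c2 z1 = 0 \<and> (\<exists>a1 a2. h = h3 c c1 c2 z1 a1 a2)"
    unfolding admissible_def by blast
  then show ?R using h(2) by (intro exI[of _ c] exI[of _ c1] exI[of _ c2] exI[of _ z1]) auto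
next
  assume ?R
  then obtain c c1 c2 z1 where c: "c \<noteq> 0" "z1 \<noteq> 0"
    and par: "Omega c c1 c2 z1 > 0 \<longrightarrow> (\<exists>a1 a2. locally_parametrized_by S (rotational_X (h1 c c1 c2 z1 a1 a2)))"
      "Omega c c1 c2 z1 < 0 \<longrightarrow> (\<exists>b1 b2. locally_parametrized_by S (rotational_X (h2 c c1 c2 z1 b1 b2)))"
      "Omega c c1 c2 z1 = 0 \<longrightarrow> (\<exists>a1 a2. locally_parametrized_by S (rotational_X (h3 c c1 c2 z1 a1 a2)))"
    by blast
  have "\<exists>h. admissible h \<and> locally_parametrized_by S (rotational_X h)"
    using par admissibleI[OF c, of c1 c2] by (metis linorder_neqE_linordered_idom)
  then obtain h where h: "admissible h" "locally_parametrized_by S (rotational_X h)" by blast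
  from admissible_profile[OF h(1)] show ?L
    using HQSF_surface_of_rotation_if_parametrized[OF assms(1,2)] h(2) by metis
qed

end
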